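(* Let $p$ be a prime. The family of polynomials $(E^{(p)}_{2n})_{n\ge0}$ is an orthonormal basis for $C^{\mathrm{even}}(\mathbb{Z}_p^*,\mathbb{Q}_p)\cong C(\mathbb{Z}_p^*/\{\pm1\},\mathbb{Q}_p)$, and $(E^{(p)}_{n})_{n\ge0}$ is an orthonormal basis for $C(\mathbb{Z}_p^*,\mathbb{Q}_p)$.
   Context: $C(\mathbb{Z}_p^*,\mathbb{Q}_p)$ is the $\mathbb{Q}_p$-Banach space of continuous functions with the supremum norm (with $|p|=1/p$), and $C^{\mathrm{even}}(\mathbb{Z}_p^*,\mathbb{Q}_p)=\{f: f(-x)=f(x)\}$, identified with $C(\mathbb{Z}_p^*/\{\pm1\},\mathbb{Q}_p)$ via the projection $\mathbb{Z}_p^*\to\mathbb{Z}_p^*/\{\pm1\}$. A sequence $(v_k)_{k\ge0}$ in a $\mathbb{Q}_p$-Banach space $E$ is an orthonormal basis if each $x\in E$ has a unique representation $x=\sum_{k\ge0}c_kv_k$ with $c_k\in\mathbb{Q}_p$, $|c_k|\to0$, and $\|x\|=\max_k|c_k|$. Polynomials $E_n^{(p)}$: for $a\in\mathbb{Z}/p^j\mathbb{Z}$ let $\tilde a$ be its unique integer lift in $\{-\lfloor p^j/2\rfloor,\dots,p^j-1-\lfloor p^j/2\rfloor\}$. Put $e_0^{(p)}:=X$ and, for $j\ge1$, $e_j^{(p)}:=\frac{1}{(p^j)!}\prod_{a\in(\mathbb{Z}/p^j\mathbb{Z})^\times}(X-\tilde a)\in\mathbb{Q}[X]$. Every integer $n\ge0$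 can be uniquely written $n=a_0+\sum_{j\ge1}a_j\varphi(p^j)$ with $a_0\in\{0,\dots,p-2\}$, $a_j\in\{0,\dots,p-1\}$ for $j\ge1$ ($\varphi$ Euler's totient function); put $E_n^{(p)}:=\prod_{j\ge0}(e_j^{(p)})^{a_j}$. *)

theory Defs
  imports
    "HOL-Analysis.Analysis"
    "HOL-Library.Function_Algebras"
    "HOL-Computational_Algebra.Polynomial"
    "HOL-Computational_Algebra.Primes"
    "HOL-Number_Theory.Totient"
begin

section \<open>The \<open>p\<close>-adic absolute value on the rationals\<close>

definition padic_val :: "nat \<Rightarrow> rat \<Rightarrow> int" where
  "padic_val p q = int (multiplicity (int p) (fst (quotient_of q)))
                 - int (multiplicity (int p) (snd (quotient_of q)))"

definition padic_abs :: "nat \<Rightarrow> rat \<Rightarrow> real" where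
  "padic_abs p q = (if q = 0 then 0 else real p powi (- padic_val p q))"

lemma padic_val_Fract:
  assumes p: "prime p" and "a \<noteq> 0" "b \<noteq> 0"
  shows "padic_val p (Fract a b) = int (multiplicity (int p) a) - int (multiplicity (int p) b)"
proof -
  obtain c d where cd: "quotient_of (Fract a b) = (c, d)" by fastforce
  have d: "d > 0" using quotient_of_denom_pos[OF cd] .
  have eq: "Fract a b = Fract c d"
    using quotient_of_div[OF cd] by (simp add: Fract_of_int_quotient)
  then have ad: "a * d = c * b"
    using d assms by (simp add: eq_rat)
  have c: "c \<noteq> 0" using ad d assms by auto
  have pp: "prime_elem (int p)" using p by simp
  have "multiplicity (int p) (a * d) = multiplicity (int p) (c * b)" using ad by simp
  then have "multiplicity (int p) a + multiplicity (int p) d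
    = multiplicity (int p) c + multiplicity (int p) b"
    using assms c d pp by (simp add: prime_elem_multiplicity_mult_distrib)
  then show ?thesis by (simp add: padic_val_def cd)
qed

lemma padic_abs_0 [simp]: "padic_abs p 0 = 0"
  by (simp add: padic_abs_def)

lemma padic_abs_pos: "prime p \<Longrightarrow> q \<noteq> 0 \<Longrightarrow> padic_abs p q > 0"
  by (simp add: padic_abs_def prime_gt_0_nat)

lemma padic_abs_nonneg [simp]: "padic_abs p q \<ge> 0"
  by (simp add: padic_abs_def)

lemma padic_abs_eq_0_iff: "prime p \<Longrightarrow> padic_abs p q = 0 \<longleftrightarrow> q = 0"
  using padic_abs_pos[of p q] by (auto simp: less_le)

lemma padic_abs_minus [simp]:
  assumes "prime p" shows "padic_abs p (- q) = padic_abs p q"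
proof (cases q)
  case (Fract a b)
  show ?thesis
  proof (cases "a = 0")
    case True
    then show ?thesis using Fract by (simp add: rat_number_collapse)
  next
    case False
    have "q \<noteq> 0" using Fract False by (simp add: Zero_rat_def eq_rat)
    moreover have "padic_val p (- q) = padic_val p q"
      using Fract False assms padic_val_Fract[of p "- a" b] padic_val_Fract[of p a b]
        multiplicity_normalize_right[of "int p" a] multiplicity_normalize_right[of "int p" "- a"]
      by simp
    ultimately show ?thesis by (simp add: padic_abs_def)
  qed
qed

lemma padic_abs_mult:
  assumes p: "prime p" shows "padic_abs p (q * r) = padic_abs p q * padic_abs p r"
proof (cases "q = 0 \<or> r = 0")
  case True
  then show ?thesis by auto
next
  case False
  obtain a b where q: "q = Fract a b" "b > 0" by (cases q) auto
  obtain c d where r: "r = Fract c d" "d > 0" by (cases r) auto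
  have nz: "a \<noteq> 0" "c \<noteq> 0" using False q r by (auto simp: rat_number_collapse)
  have pp: "prime_elem (int p)" using p by simp
  have "padic_val p (q * r) = padic_val p q + padic_val p r"
    using nz q r p pp
    by (simp add: padic_val_Fract prime_elem_multiplicity_mult_distrib)
  moreover have "real p \<noteq> 0" using p prime_gt_0_nat by force
  ultimately show ?thesis using False
    by (simp add: padic_abs_def power_int_add power_int_diff power_int_minus field_simps)
qed

lemma padic_abs_1 [simp]: "prime p \<Longrightarrow> padic_abs p 1 = 1"
  by (simp add: padic_abs_def padic_val_def)

lemma padic_abs_inverse:
  assumes p: "prime p" shows "padic_abs p (inverse q) = inverse (padic_abs p q)"
proof (cases "q = 0")
  case False
  then have "padic_abs p (inverse q) * padic_abs p q = 1"
    using padic_abs_mult[OF p, of "inverse q" q] p by simp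
  then show ?thesis
    by (metis inverse_unique mult.commute)
qed auto

lemma padic_abs_ultra:
  assumes p: "prime p" shows "padic_abs p (q + r) \<le> max (padic_abs p q) (padic_abs p r)"
proof (cases "q = 0 \<or> r = 0 \<or> q + r = 0")
  case True
  then show ?thesis by (auto simp: le_max_iff_disj)
next
  case False
  obtain a b where q: "q = Fract a b" "b > 0" by (cases q) auto
  obtain c d where r: "r = Fract c d" "d > 0" by (cases r) auto
  have q': "q = Fract (a * d) (b * d)" and r': "r = Fract (c * b) (b * d)"
    using q r by (simp_all add: eq_rat)
  have bd: "b * d \<noteq> 0" using q r by simp
  have s: "q + r = Fract (a * d + c * b) (b * d)"
    using q r by simp
  have nz: "a * d \<noteq> 0" "c * b \<noteq> 0" "a * d + c * b \<noteq> 0"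
    using False q' r' s by (metis rat_number_collapse(1))+
  define k where "k = min (multiplicity (int p) (a * d)) (multiplicity (int p) (c * b))"
  have "int p ^ k dvd a * d + c * b"
    by (intro dvd_add) (auto simp: k_def multiplicity_dvd')
  then have "k \<le> multiplicity (int p) (a * d + c * b)"
    using nz p by (intro multiplicity_geI) (auto simp: prime_gt_Suc_0_nat)
  then have "padic_val p (q + r) \<ge> min (padic_val p q) (padic_val p r)"
    unfolding s unfolding q' r'
    unfolding padic_val_Fract[OF p nz(1) bd] padic_val_Fract[OF p nz(2) bd] padic_val_Fract[OF p nz(3) bd]
    unfolding k_def by linarith
  moreover have "real p > 1" using p prime_gt_1_nat by simp
  ultimately have "real p powi (- padic_val p (q + r))
      \<le> real p powi (max (- padic_val p q) (- padic_val p r))"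
    by (intro power_int_increasing) auto
  also have "\<dots> \<le> max (real p powi (- padic_val p q)) (real p powi (- padic_val p r))"
    by (auto simp: max_def)
  finally show ?thesis using False by (simp add: padic_abs_def)
qed

lemma padic_abs_triangle:
  assumes p: "prime p" shows "padic_abs p (q + r) \<le> padic_abs p q + padic_abs p r"
  using padic_abs_ultra[OF p, of q r] padic_abs_nonneg[of p q] padic_abs_nonneg[of p r]
  by linarith

lemma padic_abs_diff_commute:
  assumes p: "prime p" shows "padic_abs p (q - r) = padic_abs p (r - q)"
  using padic_abs_minus[OF p, of "q - r"] by simp

lemma padic_abs_triangle3:
  assumes p: "prime p" shows "\<bar>padic_abs p q - padic_abs p r\<bar> \<le> padic_abs p (q - r)"
  using padic_abs_triangle[OF p, of "q - r" r] padic_abs_triangle[OF p, of "r - q" q]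
    padic_abs_diff_commute[OF p, of q r] by simp

section \<open>Cauchy sequences of rationals for the \<open>p\<close>-adic absolute value\<close>

definition padic_null :: "nat \<Rightarrow> (nat \<Rightarrow> rat) \<Rightarrow> bool" where
  "padic_null p X \<longleftrightarrow> (\<lambda>n. padic_abs p (X n)) \<longlonglongrightarrow> 0"

definition padic_Cauchy :: "nat \<Rightarrow> (nat \<Rightarrow> rat) \<Rightarrow> bool" where
  "padic_Cauchy p X \<longleftrightarrow> (\<forall>e>0. \<exists>N. \<forall>m\<ge>N. \<forall>n\<ge>N. padic_abs p (X m - X n) < e)"

definition padic_rel :: "nat \<Rightarrow> (nat \<Rightarrow> rat) \<Rightarrow> (nat \<Rightarrow> rat) \<Rightarrow> bool" where
  "padic_rel p X Y \<longleftrightarrow> padic_Cauchy p X \<and> padic_Cauchy p Y \<and> padic_null p (\<lambda>n. X n - Y n)"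

lemma padic_Cauchy_const [simp]: "padic_Cauchy p (\<lambda>_. q)"
  by (simp add: padic_Cauchy_def)

lemma padic_null_zero [simp]: "padic_null p (\<lambda>_. 0)"
  by (simp add: padic_null_def)

lemma padic_null_const_iff: "prime p \<Longrightarrow> padic_null p (\<lambda>_. q) \<longleftrightarrow> q = 0"
  by (simp add: padic_null_def tendsto_const_iff padic_abs_eq_0_iff)

lemma padic_null_bound:
  assumes "Y \<longlonglongrightarrow> 0" and "\<And>n. padic_abs p (X n) \<le> Y n"
  shows "padic_null p X"
  unfolding padic_null_def
  by (rule tendsto_sandwich[OF _ _ tendsto_const assms(1)]) (use assms(2) in auto)

lemma padic_null_add:
  assumes "prime p" "padic_null p X" "padic_null p Y"
  shows "padic_null p (\<lambda>n. X n + Y n)"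
proof (rule padic_null_bound)
  show "(\<lambda>n. padic_abs p (X n) + padic_abs p (Y n)) \<longlonglongrightarrow> 0"
    using tendsto_add[OF assms(2,3)[unfolded padic_null_def]] by simp
qed (use assms padic_abs_triangle in auto)

lemma padic_null_minus:
  "prime p \<Longrightarrow> padic_null p X \<Longrightarrow> padic_null p (\<lambda>n. - X n)"
  by (simp add: padic_null_def)

lemma padic_Cauchy_add:
  assumes p: "prime p" and X: "padic_Cauchy p X" and Y: "padic_Cauchy p Y"
  shows "padic_Cauchy p (\<lambda>n. X n + Y n)"
  unfolding padic_Cauchy_def
proof (intro allI impI)
  fix e :: real assume e: "e > 0"
  obtain M where M: "\<forall>m\<ge>M. \<forall>n\<ge>M. padic_abs p (X m - X n) < e"
    using X e unfolding padic_Cauchy_def by blast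
  obtain N where N: "\<forall>m\<ge>N. \<forall>n\<ge>N. padic_abs p (Y m - Y n) < e"
    using Y e unfolding padic_Cauchy_def by blast
  have "padic_abs p ((X m + Y m) - (X n + Y n)) < e" if "m \<ge> max M N" "n \<ge> max M N" for m n
  proof -
    have "padic_abs p ((X m - X n) + (Y m - Y n))
        \<le> max (padic_abs p (X m - X n)) (padic_abs p (Y m - Y n))"
      by (rule padic_abs_ultra[OF p])
    also have "\<dots> < e" using M N that by auto
    finally show ?thesis by (simp add: algebra_simps)
  qed
  then show "\<exists>N. \<forall>m\<ge>N. \<forall>n\<ge>N. padic_abs p ((X m + Y m) - (X n + Y n)) < e" by blast
qed

lemma padic_Cauchy_minus:
  assumes p: "prime p" and X: "padic_Cauchy p X"
  shows "padic_Cauchy p (\<lambda>n. - X n)"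
proof -
  have "padic_abs p (- X m - - X n) = padic_abs p (X m - X n)" for m n
    using padic_abs_minus[OF p, of "X m - X n"] by simp
  then show ?thesis using X by (simp add: padic_Cauchy_def)
qed

lemma padic_Cauchy_abs_convergent:
  assumes p: "prime p" and X: "padic_Cauchy p X"
  shows "convergent (\<lambda>n. padic_abs p (X n))"
proof -
  have "Cauchy (\<lambda>n. padic_abs p (X n))"
    unfolding Cauchy_def dist_real_def
    using X padic_abs_triangle3[OF p] unfolding padic_Cauchy_def
    by (meson order.strict_trans1)
  then show ?thesis by (simp add: Cauchy_convergent_iff)
qed

lemma padic_Cauchy_bounded:
  assumes p: "prime p" and X: "padic_Cauchy p X"
  obtains B where "B > 0" "\<And>n. padic_abs p (X n) \<le> B"
proof -
  have "Bseq (\<lambda>n. padic_abs p (X n))"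
    using padic_Cauchy_abs_convergent[OF assms] by (rule convergent_imp_Bseq)
  then show ?thesis using that by (auto simp: Bseq_def)
qed

lemma padic_null_mult_bounded:
  assumes p: "prime p" and X: "padic_Cauchy p X" and Y: "padic_null p Y"
  shows "padic_null p (\<lambda>n. X n * Y n)"
proof -
  obtain B where B: "B > 0" "\<And>n. padic_abs p (X n) \<le> B"
    using padic_Cauchy_bounded[OF p X] by blast
  show ?thesis
  proof (rule padic_null_bound)
    show "(\<lambda>n. B * padic_abs p (Y n)) \<longlonglongrightarrow> 0"
      using tendsto_mult_left[OF Y[unfolded padic_null_def], of B] by simp
    show "padic_abs p (X n * Y n) \<le> B * padic_abs p (Y n)" for n
      using B by (simp add: padic_abs_mult[OF p] mult_right_mono)
  qed
qed

lemma padic_Cauchy_mult: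
  assumes p: "prime p" and X: "padic_Cauchy p X" and Y: "padic_Cauchy p Y"
  shows "padic_Cauchy p (\<lambda>n. X n * Y n)"
  unfolding padic_Cauchy_def
proof (intro allI impI)
  fix e :: real assume e: "e > 0"
  obtain A where A: "A > 0" "\<And>n. padic_abs p (X n) \<le> A"
    using padic_Cauchy_bounded[OF p X] by blast
  obtain B where B: "B > 0" "\<And>n. padic_abs p (Y n) \<le> B"
    using padic_Cauchy_bounded[OF p Y] by blast
  obtain M where M: "\<forall>m\<ge>M. \<forall>n\<ge>M. padic_abs p (X m - X n) < e / B"
    using X e B unfolding padic_Cauchy_def by (meson divide_pos_pos)
  obtain N where N: "\<forall>m\<ge>N. \<forall>n\<ge>N. padic_abs p (Y m - Y n) < e / A"
    using Y e A unfolding padic_Cauchy_def by (meson divide_pos_pos)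
  have "padic_abs p (X m * Y m - X n * Y n) < e" if mn: "m \<ge> max M N" "n \<ge> max M N" for m n
  proof -
    have "padic_abs p (X m) * padic_abs p (Y m - Y n) \<le> A * padic_abs p (Y m - Y n)"
      using A by (simp add: mult_right_mono)
    also have "\<dots> < A * (e / A)"
      using N mn A(1) by (intro mult_strict_left_mono) auto
    finally have 1: "padic_abs p (X m * (Y m - Y n)) < e"
      using A by (simp add: padic_abs_mult[OF p])
    have "padic_abs p (X m - X n) * padic_abs p (Y n) \<le> padic_abs p (X m - X n) * B"
      using B by (simp add: mult_left_mono)
    also have "\<dots> < (e / B) * B"
      using M mn B(1) by (intro mult_strict_right_mono) auto
    finally have 2: "padic_abs p ((X m - X n) * Y n) < e"
      using B by (simp add: padic_abs_mult[OF p])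
    have "padic_abs p (X m * (Y m - Y n) + (X m - X n) * Y n) < e"
      using padic_abs_ultra[OF p, of "X m * (Y m - Y n)" "(X m - X n) * Y n"] 1 2 by linarith
    then show ?thesis by (simp add: algebra_simps)
  qed
  then show "\<exists>N. \<forall>m\<ge>N. \<forall>n\<ge>N. padic_abs p (X m * Y m - X n * Y n) < e" by blast
qed

lemma padic_Cauchy_not_null:
  assumes p: "prime p" and X: "padic_Cauchy p X" and "\<not> padic_null p X"
  obtains L N where "L > 0" "\<And>n. n \<ge> N \<Longrightarrow> padic_abs p (X n) > L"
proof -
  obtain l where l: "(\<lambda>n. padic_abs p (X n)) \<longlonglongrightarrow> l"
    using padic_Cauchy_abs_convergent[OF p X] unfolding convergent_def by blast
  have "l \<ge> 0" using l by (rule LIMSEQ_le_const) auto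
  moreover have "l \<noteq> 0" using l assms(3) by (auto simp: padic_null_def)
  ultimately have "l / 2 > 0" "l / 2 < l" by auto
  moreover have "\<forall>\<^sub>F n in sequentially. l / 2 < padic_abs p (X n)"
    using order_tendstoD(1)[OF l \<open>l / 2 < l\<close>] .
  ultimately show ?thesis using that unfolding eventually_sequentially by blast
qed

lemma padic_Cauchy_inverse:
  assumes p: "prime p" and X: "padic_Cauchy p X" and nn: "\<not> padic_null p X"
  shows "padic_Cauchy p (\<lambda>n. inverse (X n))"
  unfolding padic_Cauchy_def
proof (intro allI impI)
  fix e :: real assume e: "e > 0"
  obtain L N where L: "L > 0" "\<And>n. n \<ge> N \<Longrightarrow> padic_abs p (X n) > L"
    using padic_Cauchy_not_null[OF assms] by blast
  obtain M where M: "\<forall>m\<ge>M. \<forall>n\<ge>M. padic_abs p (X m - X n) < e * (L * L)"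
    using X e L unfolding padic_Cauchy_def by (meson mult_pos_pos)
  have "padic_abs p (inverse (X m) - inverse (X n)) < e"
    if mn: "m \<ge> max M N" "n \<ge> max M N" for m n
  proof -
    have g: "padic_abs p (X m) > L" "padic_abs p (X n) > L" using L mn by auto
    then have nz: "X m \<noteq> 0" "X n \<noteq> 0" using L by auto
    have "inverse (X m) - inverse (X n) = (X n - X m) * inverse (X m * X n)"
      using nz by (simp add: field_simps)
    then have "padic_abs p (inverse (X m) - inverse (X n))
      = padic_abs p (X n - X m) / (padic_abs p (X m) * padic_abs p (X n))"
      by (simp only: padic_abs_mult[OF p] padic_abs_inverse[OF p] divide_inverse)
    also have "\<dots> \<le> padic_abs p (X n - X m) / (L * L)"
      using g L by (intro divide_left_mono mult_mono mult_pos_pos) auto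
    also have "\<dots> < e" using M mn L by (simp add: pos_divide_less_eq)
    finally show ?thesis .
  qed
  then show "\<exists>N. \<forall>m\<ge>N. \<forall>n\<ge>N. padic_abs p (inverse (X m) - inverse (X n)) < e" by blast
qed

lemma padic_rel_null_iff:
  assumes p: "prime p" and r: "padic_rel p X Y"
  shows "padic_null p X \<longleftrightarrow> padic_null p Y"
proof -
  have d: "padic_null p (\<lambda>n. X n - Y n)" using r by (simp add: padic_rel_def)
  show ?thesis
    using padic_null_add[OF p d, of Y] padic_null_add[OF p padic_null_minus[OF p d], of X] by auto
qed

lemma padic_null_diff_inverse:
  assumes p: "prime p" and r: "padic_rel p X Y" and nn: "\<not> padic_null p X"
  shows "padic_null p (\<lambda>n. inverse (X n) - inverse (Y n))"
proof -
  have X: "padic_Cauchy p X" and Y: "padic_Cauchy p Y" and d: "padic_null p (\<lambda>n. X n - Y n)"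
    using r by (auto simp: padic_rel_def)
  have nY: "\<not> padic_null p Y" using padic_rel_null_iff[OF p r] nn by simp
  obtain L N where L: "L > 0" "\<And>n. n \<ge> N \<Longrightarrow> padic_abs p (X n) > L"
    using padic_Cauchy_not_null[OF p X nn] by blast
  obtain L' N' where L': "L' > 0" "\<And>n. n \<ge> N' \<Longrightarrow> padic_abs p (Y n) > L'"
    using padic_Cauchy_not_null[OF p Y nY] by blast
  have "padic_null p (\<lambda>n. inverse (X n) * (inverse (Y n) * (Y n - X n)))"
    using padic_null_minus[OF p d]
    by (intro padic_null_mult_bounded[OF p] padic_Cauchy_inverse p X Y nn nY) simp
  moreover have "\<forall>\<^sub>F n in sequentially.
      inverse (X n) * (inverse (Y n) * (Y n - X n)) = inverse (X n) - inverse (Y n)"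
    using eventually_ge_at_top[of "max N N'"]
  proof eventually_elim
    case (elim n)
    then have "X n \<noteq> 0" "Y n \<noteq> 0" using L(1) L'(1) L(2)[of n] L'(2)[of n] by auto
    then show ?case by (simp add: field_simps)
  qed
  ultimately show ?thesis unfolding padic_null_def
    by (elim Lim_transform_eventually) (auto elim: eventually_mono)
qed

lemma padic_rel_refl: "padic_Cauchy p X \<Longrightarrow> padic_rel p X X"
  by (simp add: padic_rel_def)

lemma part_equivp_padic_rel:
  assumes p: "prime p" shows "part_equivp (padic_rel p)"
proof (rule part_equivpI)
  show "\<exists>X. padic_rel p X X" using padic_rel_refl[OF padic_Cauchy_const] by blast
  show "symp (padic_rel p)"
  proof (rule sympI)
    fix X Y assume "padic_rel p X Y"
    then show "padic_rel p Y X"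
      using padic_null_minus[OF p, of "\<lambda>n. X n - Y n"] by (simp add: padic_rel_def)
  qed
  show "transp (padic_rel p)"
  proof (rule transpI)
    fix X Y Z assume "padic_rel p X Y" "padic_rel p Y Z"
    then show "padic_rel p X Z"
      using padic_null_add[OF p, of "\<lambda>n. X n - Y n" "\<lambda>n. Y n - Z n"]
      by (simp add: padic_rel_def)
  qed
qed

section \<open>The field \<open>\<rat>\<^sub>p\<close>\<close>

text \<open>
  The prime \<open>p\<close> is the cardinality of the index type \<open>'a\<close>; the type \<open>'a padic\<close> is the
  completion of the rationals for the \<open>p\<close>-adic absolute value.  It is built as a type of
  equivalence classes by hand because \<open>quotient_type\<close> does not support a partial relation that
  depends on a phantom type variable.
\<close>

class prime_card =
  assumes prime_card: "prime (CARD('a))"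

typedef (overloaded) 'a padic =
  "{c. \<exists>X. padic_rel CARD('a::prime_card) X X \<and> c = Collect (padic_rel CARD('a) X)}"
  using padic_rel_refl[OF padic_Cauchy_const] by blast

definition abs_padic :: "(nat \<Rightarrow> rat) \<Rightarrow> 'a::prime_card padic" where
  "abs_padic = quot_type.abs (padic_rel CARD('a)) Abs_padic"

definition rep_padic :: "'a::prime_card padic \<Rightarrow> nat \<Rightarrow> rat" where
  "rep_padic = quot_type.rep Rep_padic"

definition cr_padic :: "(nat \<Rightarrow> rat) \<Rightarrow> 'a::prime_card padic \<Rightarrow> bool" where
  "cr_padic = (\<lambda>X x. padic_rel CARD('a) X X \<and> abs_padic X = x)"

interpretation padic: quot_type "padic_rel CARD('a)"
  "Abs_padic :: _ \<Rightarrow> 'a::prime_card padic" Rep_padic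
proof
  show "part_equivp (padic_rel CARD('a))"
    by (rule part_equivp_padic_rel[OF prime_card])
  show "\<exists>X. padic_rel CARD('a) X X \<and> Rep_padic x = Collect (padic_rel CARD('a) X)"
    for x :: "'a padic"
    using Rep_padic[of x] by simp
  show "Abs_padic (Rep_padic x) = x" for x :: "'a padic"
    by (rule Rep_padic_inverse)
  show "Rep_padic (Abs_padic c :: 'a padic) = c"
    if "\<exists>X. padic_rel CARD('a) X X \<and> c = Collect (padic_rel CARD('a) X)" for c
    using that by (intro Abs_padic_inverse) simp
  show "(Rep_padic x = Rep_padic y) = (x = y)" for x y :: "'a padic"
    by (rule Rep_padic_inject)
qed

lemma Quotient_padic:
  "Quotient (padic_rel CARD('a)) abs_padic (rep_padic :: 'a::prime_card padic \<Rightarrow> _) cr_padic"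
  unfolding abs_padic_def rep_padic_def
  by (rule Quotient3_to_Quotient[OF padic.Quotient])
     (simp add: cr_padic_def abs_padic_def)

setup_lifting Quotient_padic

lemma Domainp_pcr_padic [transfer_domain_rule]:
  "Domainp (pcr_padic :: _ \<Rightarrow> 'p::prime_card padic \<Rightarrow> bool) = padic_Cauchy CARD('p)"
  by (auto simp: padic.domain_eq padic_rel_def fun_eq_iff)

instantiation padic :: (prime_card) field
begin

lift_definition zero_padic :: "'a padic" is "\<lambda>_. 0"
  by (simp add: padic_rel_refl)

lift_definition one_padic :: "'a padic" is "\<lambda>_. 1"
  by (simp add: padic_rel_refl)

lift_definition plus_padic :: "'a padic \<Rightarrow> 'a padic \<Rightarrow> 'a padic" is "\<lambda>X Y n. X n + Y n"
proof -
  fix X X' Y Y' :: "nat \<Rightarrow> rat"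
  assume "padic_rel CARD('a) X X'" "padic_rel CARD('a) Y Y'"
  then show "padic_rel CARD('a) (\<lambda>n. X n + Y n) (\<lambda>n. X' n + Y' n)"
    using padic_null_add[OF prime_card[where 'a='a], of "\<lambda>n. X n - X' n" "\<lambda>n. Y n - Y' n"]
    by (simp add: padic_rel_def padic_Cauchy_add[OF prime_card] algebra_simps)
qed

lift_definition uminus_padic :: "'a padic \<Rightarrow> 'a padic" is "\<lambda>X n. - X n"
proof -
  fix X X' :: "nat \<Rightarrow> rat"
  assume "padic_rel CARD('a) X X'"
  then show "padic_rel CARD('a) (\<lambda>n. - X n) (\<lambda>n. - X' n)"
    using padic_null_minus[OF prime_card[where 'a='a], of "\<lambda>n. X n - X' n"]
    by (simp add: padic_rel_def padic_Cauchy_minus[OF prime_card])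
qed

lift_definition times_padic :: "'a padic \<Rightarrow> 'a padic \<Rightarrow> 'a padic" is "\<lambda>X Y n. X n * Y n"
proof -
  fix X X' Y Y' :: "nat \<Rightarrow> rat"
  assume a: "padic_rel CARD('a) X X'" "padic_rel CARD('a) Y Y'"
  have "padic_null CARD('a) (\<lambda>n. X n * (Y n - Y' n) + Y' n * (X n - X' n))"
    using a by (intro padic_null_add padic_null_mult_bounded prime_card) (auto simp: padic_rel_def)
  then show "padic_rel CARD('a) (\<lambda>n. X n * Y n) (\<lambda>n. X' n * Y' n)"
    using a by (simp add: padic_rel_def padic_Cauchy_mult[OF prime_card] algebra_simps)
qed

lift_definition inverse_padic :: "'a padic \<Rightarrow> 'a padic"
  is "\<lambda>X. if padic_null CARD('a) X then (\<lambda>_. 0) else (\<lambda>n. inverse (X n))"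
proof -
  fix X X' :: "nat \<Rightarrow> rat"
  assume a: "padic_rel CARD('a) X X'"
  have "padic_null CARD('a) X \<longleftrightarrow> padic_null CARD('a) X'"
    by (rule padic_rel_null_iff[OF prime_card a])
  moreover have "padic_rel CARD('a) (\<lambda>n. inverse (X n)) (\<lambda>n. inverse (X' n))"
    if "\<not> padic_null CARD('a) X" "\<not> padic_null CARD('a) X'"
    using a padic_null_diff_inverse[OF prime_card a that(1)] that
    by (auto simp: padic_rel_def padic_Cauchy_inverse[OF prime_card])
  ultimately show "padic_rel CARD('a)
      (if padic_null CARD('a) X then (\<lambda>_. 0) else (\<lambda>n. inverse (X n)))
      (if padic_null CARD('a) X' then (\<lambda>_. 0) else (\<lambda>n. inverse (X' n)))"
    by (simp add: padic_rel_refl)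
qed

definition "x - y = x + - y" for x y :: "'a padic"

definition "x div y = x * inverse y" for x y :: "'a padic"

instance
proof
  fix a b c :: "'a padic"
  show "a + b + c = a + (b + c)"
    by transfer (simp add: ac_simps padic_rel_refl padic_Cauchy_add[OF prime_card])
  show "a + b = b + a"
    by transfer (simp add: ac_simps padic_rel_refl padic_Cauchy_add[OF prime_card])
  show "0 + a = a"
    by transfer (simp add: padic_rel_refl)
  show "- a + a = 0"
    by transfer (simp add: padic_rel_refl)
  show "a - b = a + - b"
    by (rule minus_padic_def)
  show "a * b * c = a * (b * c)"
    by transfer (simp add: ac_simps padic_rel_refl padic_Cauchy_mult[OF prime_card])
  show "a * b = b * a"
    by transfer (simp add: ac_simps padic_rel_refl padic_Cauchy_mult[OF prime_card])
  show "1 * a = a"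
    by transfer (simp add: padic_rel_refl)
  show "(a + b) * c = a * c + b * c"
    by transfer (simp add: algebra_simps padic_rel_refl padic_Cauchy_add[OF prime_card]
        padic_Cauchy_mult[OF prime_card])
  show "(0::'a padic) \<noteq> 1"
    by transfer (simp add: padic_rel_def padic_null_const_iff[OF prime_card]
        padic_null_const_iff[OF prime_card, of "-1", simplified])
  show "inverse (0::'a padic) = 0"
    by transfer (simp add: padic_rel_refl)
  show "a div b = a * inverse b"
    by (rule divide_padic_def)
  show "inverse a * a = 1" if "a \<noteq> 0"
    using that
  proof transfer
    fix X :: "nat \<Rightarrow> rat"
    assume X: "padic_Cauchy CARD('a) X" and "\<not> padic_rel CARD('a) X (\<lambda>_. 0)"
    then have nn: "\<not> padic_null CARD('a) X" by (simp add: padic_rel_def)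
    obtain L N where L: "L > 0" "\<And>n. n \<ge> N \<Longrightarrow> padic_abs CARD('a) (X n) > L"
      using padic_Cauchy_not_null[OF prime_card X nn] by blast
    have "\<forall>\<^sub>F n in sequentially. 0 = padic_abs CARD('a) (inverse (X n) * X n - 1)"
      using eventually_ge_at_top[of N]
    proof eventually_elim
      case (elim n)
      then have "X n \<noteq> 0" using L(1) L(2)[of n] by auto
      then show ?case by simp
    qed
    then have "padic_null CARD('a) (\<lambda>n. inverse (X n) * X n - 1)"
      unfolding padic_null_def by (rule Lim_transform_eventually[OF tendsto_const])
    then show "padic_rel CARD('a) (\<lambda>n. (if padic_null CARD('a) X then \<lambda>_. 0
        else (\<lambda>n. inverse (X n))) n * X n) (\<lambda>_. 1)"
      using nn X
      by (simp add: padic_rel_def padic_Cauchy_inverse[OF prime_card] padic_Cauchy_mult[OF prime_card])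
  qed
qed

end

lift_definition padic_of_rat :: "rat \<Rightarrow> 'p::prime_card padic" is "\<lambda>q _. q"
  by (simp add: padic_rel_refl)

lemma padic_of_rat_eq_iff [simp]:
  "padic_of_rat q = (padic_of_rat r :: 'p::prime_card padic) \<longleftrightarrow> q = r"
  by transfer (auto simp: padic_rel_def padic_null_const_iff[OF prime_card])

lemma padic_of_rat_hom [simp]:
  "padic_of_rat 0 = 0" "padic_of_rat 1 = 1"
  "padic_of_rat (q + r) = padic_of_rat q + padic_of_rat r"
  "padic_of_rat (q * r) = padic_of_rat q * padic_of_rat r"
  "padic_of_rat (- q) = - padic_of_rat q"
  by (transfer; simp add: padic_rel_refl)+

lemma padic_of_rat_of_nat [simp]: "padic_of_rat (of_nat n) = of_nat n"
  by (induction n) simp_all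

instance padic :: (prime_card) field_char_0
proof
  show "inj (of_nat :: nat \<Rightarrow> 'a padic)"
  proof (rule injI)
    fix m n :: nat assume "of_nat m = (of_nat n :: 'a padic)"
    then have "padic_of_rat (of_nat m) = (padic_of_rat (of_nat n) :: 'a padic)" by simp
    then show "m = n" by (simp only: padic_of_rat_eq_iff of_nat_eq_iff)
  qed
qed

lemma padic_of_rat_eq: "padic_of_rat q = of_rat q"
proof (cases q)
  case (Fract a b)
  have int: "padic_of_rat (of_int i) = of_int i" for i
    by (cases i) (simp_all del: of_nat_Suc)
  have "padic_of_rat q * of_int b = of_int a"
    unfolding int[symmetric] padic_of_rat_hom(4)[symmetric]
    using Fract by (simp add: Fract_of_int_quotient del: padic_of_rat_hom)
  then show ?thesis
    using Fract by (simp add: of_rat_rat field_simps)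
qed

lift_definition pnorm :: "'a::prime_card padic \<Rightarrow> real" is "\<lambda>X. lim (\<lambda>n. padic_abs CARD('a) (X n))"
proof -
  fix X Y :: "nat \<Rightarrow> rat"
  assume r: "padic_rel CARD('a) X Y"
  obtain l where l: "(\<lambda>n. padic_abs CARD('a) (X n)) \<longlonglongrightarrow> l"
    using r padic_Cauchy_abs_convergent[OF prime_card] unfolding padic_rel_def convergent_def by blast
  have "(\<lambda>n. padic_abs CARD('a) (X n) - padic_abs CARD('a) (Y n)) \<longlonglongrightarrow> 0"
  proof (rule Lim_null_comparison)
    show "(\<lambda>n. padic_abs CARD('a) (X n - Y n)) \<longlonglongrightarrow> 0"
      using r by (simp add: padic_rel_def padic_null_def)
  qed (simp add: padic_abs_triangle3[OF prime_card])
  from tendsto_diff[OF l this] have "(\<lambda>n. padic_abs CARD('a) (Y n)) \<longlonglongrightarrow> l" by simp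
  with l show "lim (\<lambda>n. padic_abs CARD('a) (X n)) = lim (\<lambda>n. padic_abs CARD('a) (Y n))"
    by (simp add: limI)
qed

lemma padic_Cauchy_tendsto_lim:
  "padic_Cauchy CARD('p::prime_card) X \<Longrightarrow>
    (\<lambda>n. padic_abs CARD('p) (X n)) \<longlonglongrightarrow> lim (\<lambda>n. padic_abs CARD('p) (X n))"
  by (rule convergent_LIMSEQ_iff[THEN iffD1, OF padic_Cauchy_abs_convergent[OF prime_card]])

lemma pnorm_of_rat: "pnorm (of_rat q :: 'p::prime_card padic) = padic_abs CARD('p) q"
  unfolding padic_of_rat_eq[symmetric] by transfer (rule limI[OF tendsto_const])

lemma pnorm_zero [simp]: "pnorm (0 :: 'p::prime_card padic) = 0"
  using pnorm_of_rat[of 0, where 'p='p] by simp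

lemma pnorm_one [simp]: "pnorm (1 :: 'p::prime_card padic) = 1"
  using pnorm_of_rat[of 1, where 'p='p] padic_abs_1[OF prime_card[where 'a='p]] by simp

lemma pnorm_nonneg [simp]: "pnorm (x :: 'p::prime_card padic) \<ge> 0"
proof transfer
  fix X :: "nat \<Rightarrow> rat"
  assume X: "padic_Cauchy CARD('p) X"
  show "0 \<le> lim (\<lambda>n. padic_abs CARD('p) (X n))"
    by (rule LIMSEQ_le_const[OF padic_Cauchy_tendsto_lim[OF X]]) simp
qed

lemma pnorm_eq_0_iff [simp]: "pnorm (x :: 'p::prime_card padic) = 0 \<longleftrightarrow> x = 0"
proof transfer
  fix X :: "nat \<Rightarrow> rat"
  assume X: "padic_Cauchy CARD('p) X"
  show "lim (\<lambda>n. padic_abs CARD('p) (X n)) = 0 \<longleftrightarrow> padic_rel CARD('p) X (\<lambda>_. 0)"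
  proof
    assume "lim (\<lambda>n. padic_abs CARD('p) (X n)) = 0"
    then show "padic_rel CARD('p) X (\<lambda>_. 0)"
      using padic_Cauchy_tendsto_lim[OF X] X by (simp add: padic_rel_def padic_null_def)
  next
    assume "padic_rel CARD('p) X (\<lambda>_. 0)"
    then have "(\<lambda>n. padic_abs CARD('p) (X n)) \<longlonglongrightarrow> 0"
      by (simp add: padic_rel_def padic_null_def)
    then show "lim (\<lambda>n. padic_abs CARD('p) (X n)) = 0"
      by (rule limI)
  qed
qed

lemma pnorm_minus [simp]: "pnorm (- x) = pnorm (x :: 'p::prime_card padic)"
  by transfer (simp only: padic_abs_minus[OF prime_card])

lemma pnorm_mult: "pnorm (x * y) = pnorm x * pnorm (y :: 'p::prime_card padic)"
proof transfer
  fix X Y :: "nat \<Rightarrow> rat"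
  assume X: "padic_Cauchy CARD('p) X" and Y: "padic_Cauchy CARD('p) Y"
  show "lim (\<lambda>n. padic_abs CARD('p) (X n * Y n))
      = lim (\<lambda>n. padic_abs CARD('p) (X n)) * lim (\<lambda>n. padic_abs CARD('p) (Y n))"
    unfolding padic_abs_mult[OF prime_card]
    by (rule limI[OF tendsto_mult[OF padic_Cauchy_tendsto_lim[OF X] padic_Cauchy_tendsto_lim[OF Y]]])
qed

lemma pnorm_ultra: "pnorm (x + y) \<le> max (pnorm x) (pnorm (y :: 'p::prime_card padic))"
proof transfer
  fix X Y :: "nat \<Rightarrow> rat"
  assume X: "padic_Cauchy CARD('p) X" and Y: "padic_Cauchy CARD('p) Y"
  show "lim (\<lambda>n. padic_abs CARD('p) (X n + Y n))
      \<le> max (lim (\<lambda>n. padic_abs CARD('p) (X n))) (lim (\<lambda>n. padic_abs CARD('p) (Y n)))"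
    by (rule LIMSEQ_le[OF padic_Cauchy_tendsto_lim[OF padic_Cauchy_add[OF prime_card X Y]]
          tendsto_max[OF padic_Cauchy_tendsto_lim[OF X] padic_Cauchy_tendsto_lim[OF Y]]])
       (auto intro: padic_abs_ultra[OF prime_card])
qed

instantiation padic :: (prime_card) metric_space
begin

definition dist_padic :: "'a padic \<Rightarrow> 'a padic \<Rightarrow> real" where
  "dist_padic x y = pnorm (x - y)"

definition uniformity_padic :: "('a padic \<times> 'a padic) filter" where
  "uniformity_padic = (INF e\<in>{0 <..}. principal {(x, y). dist x y < e})"

definition open_padic :: "'a padic set \<Rightarrow> bool" where
  "open_padic U \<longleftrightarrow> (\<forall>x\<in>U. eventually (\<lambda>(x', y). x' = x \<longrightarrow> y \<in> U) uniformity)"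

instance
proof
  show "uniformity = (INF e\<in>{0 <..}. principal {(x :: 'a padic, y). dist x y < e})"
    by (rule uniformity_padic_def)
  show "open U \<longleftrightarrow> (\<forall>x\<in>U. eventually (\<lambda>(x', y). x' = x \<longrightarrow> y \<in> U) uniformity)"
    for U :: "'a padic set"
    by (rule open_padic_def)
  show "dist x y = 0 \<longleftrightarrow> x = y" for x y :: "'a padic"
    by (simp add: dist_padic_def)
  show "dist x y \<le> dist x z + dist y z" for x y z :: "'a padic"
  proof -
    have "pnorm (x - y) = pnorm ((x - z) + (z - y))" by simp
    also have "\<dots> \<le> max (pnorm (x - z)) (pnorm (z - y))" by (rule pnorm_ultra)
    also have "pnorm (z - y) = pnorm (y - z)"
      using pnorm_minus[of "z - y"] by simp
    finally show ?thesis
      using pnorm_nonneg[of "x - z"] pnorm_nonneg[of "y - z"]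
      unfolding dist_padic_def by linarith
  qed
qed

end

lemma padic_rat_dense:
  fixes x :: "'p::prime_card padic"
  assumes "e > 0"
  shows "\<exists>q. pnorm (x - of_rat q) < e"
  unfolding padic_of_rat_eq[symmetric] minus_padic_def using assms
proof transfer
  fix e :: real and X :: "nat \<Rightarrow> rat"
  assume e: "e > 0" and X: "padic_Cauchy CARD('p) X"
  obtain N where N: "\<forall>m\<ge>N. \<forall>n\<ge>N. padic_abs CARD('p) (X m - X n) < e / 2"
    using X half_gt_zero[OF e] unfolding padic_Cauchy_def by blast
  have C: "padic_Cauchy CARD('p) (\<lambda>n. X n + - X N)"
    by (intro padic_Cauchy_add prime_card X padic_Cauchy_const)
  have "lim (\<lambda>n. padic_abs CARD('p) (X n + - X N)) \<le> e / 2"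
    by (rule LIMSEQ_le_const2[OF padic_Cauchy_tendsto_lim[OF C]])
       (use N in \<open>auto intro!: exI[of _ N] less_imp_le\<close>)
  then show "\<exists>q. lim (\<lambda>n. padic_abs CARD('p) (X n + - q)) < e" using e by (intro exI[of _ "X N"]) auto
qed

instance padic :: (prime_card) complete_space
proof
  fix x :: "nat \<Rightarrow> 'a padic"
  assume Cx: "Cauchy x"
  have "\<exists>q. pnorm (x n - of_rat q) < inverse (real (Suc n))" for n
    by (rule padic_rat_dense) simp
  then obtain q where q: "\<And>n. pnorm (x n - of_rat (q n)) < inverse (real (Suc n))" by metis
  have 3: "pnorm (a + b + c) \<le> max (max (pnorm a) (pnorm b)) (pnorm c)" for a b c :: "'a padic"
    using pnorm_ultra[of "a + b" c] pnorm_ultra[of a b] by linarith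
  have mc: "pnorm (a - b) = pnorm (b - a)" for a b :: "'a padic"
    using pnorm_minus[of "a - b"] by simp
  have Cq: "padic_Cauchy CARD('a) q"
    unfolding padic_Cauchy_def
  proof (intro allI impI)
    fix e :: real assume e: "e > 0"
    obtain N where N: "\<forall>m\<ge>N. \<forall>n\<ge>N. dist (x m) (x n) < e"
      using Cx e unfolding Cauchy_def by blast
    obtain K where K: "inverse (real (Suc K)) < e" using e reals_Archimedean by blast
    have s: "pnorm (x n - of_rat (q n)) < e" if "n \<ge> K" for n
    proof -
      have "inverse (real (Suc n)) \<le> inverse (real (Suc K))" using that by simp
      then show ?thesis using q[of n] K by linarith
    qed
    have "padic_abs CARD('a) (q m - q n) < e" if "m \<ge> max N K" "n \<ge> max N K" for m n
    proof -
      have "padic_abs CARD('a) (q m - q n)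
        = pnorm ((of_rat (q m) - x m) + (x m - x n) + (x n - of_rat (q n)) :: 'a padic)"
        unfolding pnorm_of_rat[where 'p='a, symmetric] by (simp add: of_rat_diff)
      also have "\<dots> < e"
        using 3[of "of_rat (q m) - x m" "x m - x n" "x n - of_rat (q n)"] s[of m] s[of n]
          N[unfolded dist_padic_def] that mc[of "of_rat (q m)" "x m"] by fastforce
      finally show ?thesis .
    qed
    then show "\<exists>N. \<forall>m\<ge>N. \<forall>n\<ge>N. padic_abs CARD('a) (q m - q n) < e" by blast
  qed
  have "\<exists>l :: 'a padic. \<forall>e>0. \<exists>N. \<forall>n\<ge>N. pnorm (l + - padic_of_rat (q n)) \<le> e"
    using Cq
  proof transfer
    fix q :: "nat \<Rightarrow> rat"
    assume C: "padic_Cauchy CARD('a) q"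
    have "\<exists>N. \<forall>n\<ge>N. lim (\<lambda>k. padic_abs CARD('a) (q k + - q n)) \<le> e" if e: "e > 0" for e
    proof -
      obtain N where N: "\<forall>m\<ge>N. \<forall>n\<ge>N. padic_abs CARD('a) (q m - q n) < e"
        using C e unfolding padic_Cauchy_def by blast
      have "lim (\<lambda>k. padic_abs CARD('a) (q k + - q n)) \<le> e" if "n \<ge> N" for n
      proof -
        have D: "padic_Cauchy CARD('a) (\<lambda>k. q k + - q n)"
          by (intro padic_Cauchy_add prime_card C padic_Cauchy_const)
        show ?thesis
          by (rule LIMSEQ_le_const2[OF padic_Cauchy_tendsto_lim[OF D]])
             (use N that in \<open>auto intro!: exI[of _ N] less_imp_le\<close>)
      qed
      then show ?thesis by blast
    qed
    then show "\<exists>l\<in>Collect (padic_Cauchy CARD('a)). \<forall>e>0. \<exists>N. \<forall>n\<ge>N.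
        lim (\<lambda>k. padic_abs CARD('a) (l k + - q n)) \<le> e"
      using C by blast
  qed
  then obtain l :: "'a padic" where l: "\<And>e. e > 0 \<Longrightarrow> \<exists>N. \<forall>n\<ge>N. pnorm (l - of_rat (q n)) \<le> e"
    unfolding padic_of_rat_eq by auto
  have "x \<longlonglongrightarrow> l"
    unfolding lim_sequentially
  proof (intro allI impI)
    fix e :: real assume e: "e > 0"
    obtain N where N: "\<forall>n\<ge>N. pnorm (l - of_rat (q n)) \<le> e / 2" using l[of "e / 2"] e by auto
    obtain K where K: "inverse (real (Suc K)) < e" using e reals_Archimedean by blast
    have "dist (x n) l < e" if n: "n \<ge> max N K" for n
    proof -
      have "inverse (real (Suc n)) \<le> inverse (real (Suc K))" using n by simp
      then have "pnorm (x n - of_rat (q n)) < e" using q[of n] K by linarith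
      moreover have "pnorm (of_rat (q n) - l) < e"
        using N n e mc[of l "of_rat (q n)"] by fastforce
      ultimately show ?thesis
        using pnorm_ultra[of "x n - of_rat (q n)" "of_rat (q n) - l"]
        by (simp add: dist_padic_def)
    qed
    then show "\<exists>N. \<forall>n\<ge>N. dist (x n) l < e" by blast
  qed
  then show "convergent x" by (auto simp: convergent_def)
qed

section \<open>The groups \<open>\<int>\<^sub>p\<^sup>*\<close> and \<open>\<int>\<^sub>p\<^sup>* / {\<plusminus>1}\<close>\<close>

definition padic_int :: "'p::prime_card padic set" where
  "padic_int = {x. pnorm x \<le> 1}"

typedef (overloaded) 'p padic_unit =
  "{x :: 'p::prime_card padic. x \<in> padic_int \<and> (\<exists>y\<in>padic_int. x * y = 1)}"
proof (rule exI)
  have "(1 :: 'p padic) \<in> padic_int" by (simp add: padic_int_def)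
  moreover have "(1 :: 'p padic) * 1 = 1" by simp
  ultimately show "(1 :: 'p padic) \<in> {x. x \<in> padic_int \<and> (\<exists>y\<in>padic_int. x * y = 1)}" by blast
qed

instantiation padic_unit :: (prime_card) uminus
begin

definition uminus_padic_unit :: "'a padic_unit \<Rightarrow> 'a padic_unit" where
  "- x = Abs_padic_unit (- Rep_padic_unit x)"

instance ..

end

lemma Rep_padic_unit_uminus [simp]:
  "Rep_padic_unit (- x) = - Rep_padic_unit (x :: 'p::prime_card padic_unit)"
proof -
  obtain y where "Rep_padic_unit x \<in> padic_int" "y \<in> padic_int" "Rep_padic_unit x * y = 1"
    using Rep_padic_unit[of x] by blast
  then have "- Rep_padic_unit x \<in> padic_int" "- y \<in> padic_int" "- Rep_padic_unit x * - y = 1"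
    by (simp_all add: padic_int_def)
  then show ?thesis
    unfolding uminus_padic_unit_def by (intro Abs_padic_unit_inverse) blast
qed

instantiation padic_unit :: (prime_card) metric_space
begin

definition dist_padic_unit :: "'a padic_unit \<Rightarrow> 'a padic_unit \<Rightarrow> real" where
  "dist_padic_unit x y = dist (Rep_padic_unit x) (Rep_padic_unit y)"

definition uniformity_padic_unit :: "('a padic_unit \<times> 'a padic_unit) filter" where
  "uniformity_padic_unit = (INF e\<in>{0 <..}. principal {(x, y). dist x y < e})"

definition open_padic_unit :: "'a padic_unit set \<Rightarrow> bool" where
  "open_padic_unit U \<longleftrightarrow> (\<forall>x\<in>U. eventually (\<lambda>(x', y). x' = x \<longrightarrow> y \<in> U) uniformity)"

instance
proof
  show "uniformity = (INF e\<in>{0 <..}. principal {(x :: 'a padic_unit, y). dist x y < e})"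
    by (rule uniformity_padic_unit_def)
  show "open U \<longleftrightarrow> (\<forall>x\<in>U. eventually (\<lambda>(x', y). x' = x \<longrightarrow> y \<in> U) uniformity)"
    for U :: "'a padic_unit set"
    by (rule open_padic_unit_def)
  show "dist x y = 0 \<longleftrightarrow> x = y" for x y :: "'a padic_unit"
    by (simp add: dist_padic_unit_def Rep_padic_unit_inject)
  show "dist x y \<le> dist x z + dist y z" for x y z :: "'a padic_unit"
    unfolding dist_padic_unit_def by (rule dist_triangle2)
qed

end

quotient_type (overloaded) 'p padic_unit_pm =
  "'p::prime_card padic_unit" / "\<lambda>x y. x = y \<or> x = - y"
  morphisms rep_padic_unit_pm padic_unit_pm_class
proof -
  have "- (- x) = x" for x :: "'p padic_unit"
    by (simp flip: Rep_padic_unit_inject)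
  then show "equivp (\<lambda>x y :: 'p padic_unit. x = y \<or> x = - y)"
    by (intro equivpI reflpI sympI transpI) metis+
qed

text \<open>The quotient carries the quotient topology.\<close>

instantiation padic_unit_pm :: (prime_card) topological_space
begin

definition open_padic_unit_pm :: "'a padic_unit_pm set \<Rightarrow> bool" where
  "open_padic_unit_pm U \<longleftrightarrow> open (padic_unit_pm_class -` U)"

instance
proof
  show "open (UNIV :: 'a padic_unit_pm set)"
    by (simp add: open_padic_unit_pm_def)
  show "open (S \<inter> T)" if "open S" "open T" for S T :: "'a padic_unit_pm set"
    using that by (simp add: open_padic_unit_pm_def open_Int)
  show "open (\<Union>K)" if "\<forall>S\<in>K. open S" for K :: "'a padic_unit_pm set set"
    using that by (auto simp: open_padic_unit_pm_def vimage_Union)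
qed

end

section \<open>Spaces of continuous functions and orthonormal bases\<close>

text \<open>
  Functions carry the pointwise group structure of \<open>Function_Algebras\<close>.  The supremum norm is only
  used for continuous functions on the compact spaces \<open>\<int>\<^sub>p\<^sup>*\<close> and \<open>\<int>\<^sub>p\<^sup>* / {\<plusminus>1}\<close>, where the
  supremum is that of a bounded set.
\<close>

definition cont_fun :: "('a::topological_space \<Rightarrow> 'p::prime_card padic) set" where
  "cont_fun = {f. continuous_on UNIV f}"

definition cont_fun_even :: "('p::prime_card padic_unit \<Rightarrow> 'p padic) set" where
  "cont_fun_even = {f \<in> cont_fun. \<forall>x. f (- x) = f x}"

definition sup_norm :: "('a \<Rightarrow> 'p::prime_card padic) \<Rightarrow> real" where
  "sup_norm f = (SUP x. pnorm (f x))"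

definition fun_scale :: "'p::prime_card padic \<Rightarrow> ('a \<Rightarrow> 'p padic) \<Rightarrow> ('a \<Rightarrow> 'p padic)" where
  "fun_scale c f = (\<lambda>x. c * f x)"

definition is_expansion ::
  "('p::prime_card padic \<Rightarrow> 'v \<Rightarrow> 'v) \<Rightarrow> ('v \<Rightarrow> real) \<Rightarrow> (nat \<Rightarrow> 'v) \<Rightarrow> 'v::ab_group_add
    \<Rightarrow> (nat \<Rightarrow> 'p padic) \<Rightarrow> bool" where
  "is_expansion smul nrm v x c \<longleftrightarrow>
     (\<lambda>k. pnorm (c k)) \<longlonglongrightarrow> 0 \<and> (\<lambda>N. nrm (x - (\<Sum>k<N. smul (c k) (v k)))) \<longlonglongrightarrow> 0"

text \<open>
  \<open>E\<close> is the carrier of the Banach space, with scalar multiplication \<open>smul\<close> and norm \<open>nrm\<close>.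
  The last condition says that \<open>nrm x\<close> is the maximum of the \<open>pnorm (c k)\<close>.
\<close>

definition orthonormal_basis ::
  "'v::ab_group_add set \<Rightarrow> ('p::prime_card padic \<Rightarrow> 'v \<Rightarrow> 'v) \<Rightarrow> ('v \<Rightarrow> real) \<Rightarrow> (nat \<Rightarrow> 'v) \<Rightarrow> bool" where
  "orthonormal_basis E smul nrm v \<longleftrightarrow>
     (\<forall>k. v k \<in> E) \<and>
     (\<forall>x\<in>E. (\<exists>!c. is_expansion smul nrm v x c) \<and>
            (\<forall>c. is_expansion smul nrm v x c \<longrightarrow>
               (\<forall>k. pnorm (c k) \<le> nrm x) \<and> (\<exists>k. pnorm (c k) = nrm x)))"

definition isometric_iso ::
  "('a \<Rightarrow> 'p::prime_card padic) set \<Rightarrow> ('b \<Rightarrow> 'p padic) set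
    \<Rightarrow> (('a \<Rightarrow> 'p padic) \<Rightarrow> ('b \<Rightarrow> 'p padic)) \<Rightarrow> bool" where
  "isometric_iso E F T \<longleftrightarrow> bij_betw T E F \<and>
     (\<forall>f\<in>E. \<forall>g\<in>E. T (f + g) = T f + T g) \<and>
     (\<forall>c. \<forall>f\<in>E. T (fun_scale c f) = fun_scale c (T f)) \<and>
     (\<forall>f\<in>E. sup_norm (T f) = sup_norm f)"

section \<open>The polynomials \<open>E\<^sub>n\<close>\<close>

text \<open>The representative of \<open>a\<close> modulo \<open>m\<close> in \<open>{- (m div 2) .. m - 1 - m div 2}\<close>.\<close>

definition centered_lift :: "nat \<Rightarrow> nat \<Rightarrow> int" where
  "centered_lift m a = (THE t. t \<in> {- (int m div 2) .. int m - 1 - int m div 2} \<and> [t = int a] (mod int m))"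

lemma centered_lift_eq:
  assumes "m > 0"
  shows "centered_lift m a = (int a + int m div 2) mod int m - int m div 2"
  unfolding centered_lift_def
proof (rule the_equality)
  show "(int a + int m div 2) mod int m - int m div 2 \<in> {- (int m div 2) .. int m - 1 - int m div 2}
      \<and> [(int a + int m div 2) mod int m - int m div 2 = int a] (mod int m)"
    using assms pos_mod_bound[of "int m" "int a + int m div 2"]
    by (auto simp: cong_def mod_diff_left_eq)
  fix t assume t: "t \<in> {- (int m div 2) .. int m - 1 - int m div 2} \<and> [t = int a] (mod int m)"
  then have "(t + int m div 2) mod int m = (int a + int m div 2) mod int m"
    by (metis cong_def mod_add_left_eq)
  moreover have "(t + int m div 2) mod int m = t + int m div 2"
    using t by (intro mod_pos_pos_trivial) auto
  ultimately show "t = (int a + int m div 2) mod int m - int m div 2" by simp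
qed

text \<open>
  The product ranges over the units modulo \<open>p ^ j\<close>, each represented by its residue in
  \<open>totatives (p ^ j)\<close>.
\<close>

definition e_poly :: "nat \<Rightarrow> nat \<Rightarrow> rat poly" where
  "e_poly p j = (if j = 0 then [:0, 1:] else
     smult (1 / fact (p ^ j)) (\<Prod>a\<in>totatives (p ^ j). [:- of_int (centered_lift (p ^ j) a), 1:]))"

definition totient_digits :: "nat \<Rightarrow> nat \<Rightarrow> (nat \<Rightarrow> nat) \<Rightarrow> bool" where
  "totient_digits p n a \<longleftrightarrow>
     a 0 \<in> {0..p - 2} \<and> (\<forall>j\<ge>1. a j \<in> {0..p - 1}) \<and> finite {j. a j \<noteq> 0} \<and>
     n = a 0 + (\<Sum>j | j \<ge> 1 \<and> a j \<noteq> 0. a j * totient (p ^ j))"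

definition E_poly :: "nat \<Rightarrow> nat \<Rightarrow> rat poly" where
  "E_poly p n = (let a = (THE a. totient_digits p n a) in \<Prod>j | a j \<noteq> 0. e_poly p j ^ a j)"

lemma sum_base_digit:
  fixes p :: nat
  assumes "\<And>i. b i < p" "k < N"
  shows "(\<Sum>i<N. b i * p ^ i) div p ^ k mod p = b k"
  using assms
proof (induction k arbitrary: b N)
  case 0
  then obtain M where N: "N = Suc M" by (cases N) auto
  have "(\<Sum>i<N. b i * p ^ i) = b 0 + p * (\<Sum>i<M. b (Suc i) * p ^ i)"
    unfolding N by (subst sum.lessThan_Suc_shift) (simp add: sum_distrib_left mult_ac)
  then show ?case using 0(1)[of 0] by simp
next
  case (Suc k)
  then obtain M where N: "N = Suc M" by (cases N) auto
  have p: "p > 0" using Suc.prems(1)[of 0] by simp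
  have "(\<Sum>i<N. b i * p ^ i) = b 0 + p * (\<Sum>i<M. b (Suc i) * p ^ i)"
    unfolding N by (subst sum.lessThan_Suc_shift) (simp add: sum_distrib_left mult_ac)
  then have "(\<Sum>i<N. b i * p ^ i) div p = (\<Sum>i<M. b (Suc i) * p ^ i)"
    using Suc.prems(1)[of 0] p by simp
  then show ?case
    using Suc.IH[of "\<lambda>i. b (Suc i)" M] Suc.prems N by (simp add: div_mult2_eq)
qed

lemma base_digit_sum: "(\<Sum>i<N. (m div p ^ i mod p) * p ^ i) = m mod p ^ N" for p m :: nat
proof (induction N)
  case (Suc N)
  have "m mod (p ^ N * p) = p ^ N * (m div p ^ N mod p) + m mod p ^ N"
    by (rule mod_mult2_eq)
  then show ?case using Suc by (simp add: mult.commute)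
qed simp

lemma totient_digits_iff:
  assumes p: "prime p"
  shows "totient_digits p n a \<longleftrightarrow>
    a = (\<lambda>j. if j = 0 then n mod (p - 1) else n div (p - 1) div p ^ (j - 1) mod p)" (is "_ \<longleftrightarrow> a = ?d")
proof -
  have p1: "p > 1" using p prime_gt_1_nat by blast
  have sum_eq: "(\<Sum>j | j \<ge> 1 \<and> b j \<noteq> 0. b j * totient (p ^ j))
      = (p - 1) * (\<Sum>i<N. b (Suc i) * p ^ i)"
    if N: "\<And>j. b j \<noteq> 0 \<Longrightarrow> j \<le> N" for b :: "nat \<Rightarrow> nat" and N
  proof -
    have "(\<Sum>j | j \<ge> 1 \<and> b j \<noteq> 0. b j * totient (p ^ j)) = (\<Sum>j\<in>Suc ` {..<N}. b j * totient (p ^ j))"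
    proof (rule sum.mono_neutral_left)
      show "{j. j \<ge> 1 \<and> b j \<noteq> 0} \<subseteq> Suc ` {..<N}"
      proof
        fix j assume j: "j \<in> {j. j \<ge> 1 \<and> b j \<noteq> 0}"
        then obtain i where i: "j = Suc i" by (cases j) auto
        then have "i < N" using j N[of j] by simp
        then show "j \<in> Suc ` {..<N}" using i by simp
      qed
    qed auto
    also have "\<dots> = (\<Sum>i<N. b (Suc i) * totient (p ^ Suc i))"
      by (subst sum.reindex) auto
    also have "\<dots> = (p - 1) * (\<Sum>i<N. b (Suc i) * p ^ i)"
      using p by (simp add: totient_prime_power_Suc sum_distrib_left mult_ac del: power_Suc)
    finally show ?thesis .
  qed
  show ?thesis
  proof
    assume t: "totient_digits p n a"
    then have fin: "finite {j. a j \<noteq> 0}" by (simp add: totient_digits_def)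
    then obtain N0 where N0: "\<And>j. a j \<noteq> 0 \<Longrightarrow> j \<le> N0"
      using finite_nat_set_iff_bounded_le by auto
    then have b: "n = a 0 + (p - 1) * (\<Sum>i<N. a (Suc i) * p ^ i)" if "N \<ge> N0" for N
    proof -
      have "n = a 0 + (\<Sum>j | j \<ge> 1 \<and> a j \<noteq> 0. a j * totient (p ^ j))"
        using t by (simp add: totient_digits_def)
      moreover have "j \<le> N" if "a j \<noteq> 0" for j
        using N0[OF that] \<open>N \<ge> N0\<close> by linarith
      ultimately show ?thesis using sum_eq[of a N] by simp
    qed
    have a0: "a 0 < p - 1" using t p1 by (auto simp: totient_digits_def)
    have aj: "a (Suc i) < p" for i
    proof -
      have "a (Suc i) \<le> p - 1" using t by (auto simp: totient_digits_def)
      then show ?thesis using p1 by linarith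
    qed
    show "a = ?d"
    proof
      fix j
      show "a j = ?d j"
      proof (cases j)
        case 0
        then show ?thesis using b[of N0] a0 by simp
      next
        case (Suc k)
        have "n div (p - 1) = (\<Sum>i<max N0 (Suc k). a (Suc i) * p ^ i)"
          using b[of "max N0 (Suc k)"] a0 by simp
        then show ?thesis
          using Suc sum_base_digit[of "\<lambda>i. a (Suc i)" p k "max N0 (Suc k)"] aj by simp
      qed
    qed
  next
    assume a: "a = ?d"
    define m where "m = n div (p - 1)"
    have m: "m < p ^ i" if "i \<ge> m" for i
      using that p1 less_exp[of m] power_increasing[of m i p] power_mono[of 2 p m] by linarith
    have supp: "j \<le> Suc m" if "a j \<noteq> 0" for j
    proof (rule ccontr)
      assume j: "\<not> j \<le> Suc m"
      then have "m div p ^ (j - 1) = 0" using m[of "j - 1"] by simp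
      then show False using that j by (simp add: a m_def)
    qed
    have "(\<Sum>i<Suc m. a (Suc i) * p ^ i) = m mod p ^ Suc m"
      by (subst base_digit_sum[symmetric]) (simp add: a m_def)
    also have "\<dots> = m" using m[of "Suc m"] by (intro mod_less) auto
    finally have "n = a 0 + (p - 1) * (\<Sum>i<Suc m. a (Suc i) * p ^ i)"
      by (simp add: a m_def)
    then have "n = a 0 + (\<Sum>j | j \<ge> 1 \<and> a j \<noteq> 0. a j * totient (p ^ j))"
      using sum_eq[of a "Suc m"] supp by simp
    moreover have "finite {j. a j \<noteq> 0}"
      by (rule finite_subset[of _ "{..Suc m}"]) (use supp in auto)
    moreover have "a 0 < p - 1" using p1 by (simp add: a)
    moreover have "a j < p" if "j \<ge> 1" for j using p1 that by (simp add: a)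
    ultimately show "totient_digits p n a"
      unfolding totient_digits_def by (fastforce)
  qed
qed

lemma ex1_totient_digits: "prime p \<Longrightarrow> \<exists>!a. totient_digits p n a"
  by (simp add: totient_digits_iff)

definition E_fun :: "nat \<Rightarrow> 'p::prime_card padic_unit \<Rightarrow> 'p padic" where
  "E_fun n x = poly (map_poly of_rat (E_poly CARD('p) n)) (Rep_padic_unit x)"

end

theory Submission
  imports Defs
begin

text \<open>
  If \<open>x\<close> and \<open>y\<close> are units with \<open>x \<equiv> y\<close> modulo \<open>p\<^sup>h\<close>, then \<open>\<bar>e\<^sub>h(x) - e\<^sub>h(y)\<bar> = p\<^sup>h \<bar>x - y\<bar>\<close>, so on each
  class modulo \<open>p\<^sup>h\<close> the residue of \<open>e\<^sub>h\<close> separates the classes modulo \<open>p\<^bsup>h+1\<^esup>\<close>.  With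
  \<open>N = \<phi>(p\<^sup>h)\<close> one has \<open>E\<^bsub>k+aN\<^esub> = E\<^sub>k e\<^sub>h\<^sup>a\<close> for \<open>k < N\<close>.  Interpolation by polynomials in \<open>e\<^sub>h\<close> on
  each class therefore shows, by induction on \<open>h\<close>, that the \<open>E\<^sub>n\<close> with \<open>n < \<phi>(p\<^sup>h)\<close> form modulo \<open>p\<close>
  a basis of the functions that are constant on the classes modulo \<open>p\<^sup>h\<close>, which is the criterion
  for an orthonormal basis.  The even case follows since \<open>E\<^bsub>2n\<^esub>\<close> is even and
  \<open>E\<^bsub>2n+1\<^esub> = w E\<^bsub>2n\<^esub>\<close> for a fixed \<open>w\<close> such that \<open>w(x) - w(-x)\<close> is a unit for every unit \<open>x\<close>.
\<close>

section \<open>The absolute value on \<open>\<rat>\<^sub>p\<close>\<close>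

text \<open>No residue field is formed: statements modulo \<open>p\<close> become norm bounds that
  lose a factor \<open>1 / p\<close>. The functions \<open>E_k\<close> with
  \<open>k < totient (p ^ h)\<close> are constant on classes modulo \<open>p ^ h\<close> only up to
  an error of norm at most \<open>1 / p\<close>, so at a finite level both halves of the basis
  property carry a slack \<open>M / p\<close>, where \<open>M\<close> bounds the coefficients or the
  function. For the coefficients the slack disappears because \<open>M\<close> can be taken to be
  the largest of them; for approximation, because the step is repeated on the remainder. The
  stretching factor \<open>p ^ h\<close> of \<open>e_h\<close> comes from its denominator: the
  factors other than the one for the class of \<open>x\<close> have together the norm of
  \<open>(p ^ h - 1)!\<close>, so division by \<open>(p ^ h)!\<close> leaves \<open>p ^ h\<close>.
  Points at distance exactly \<open>1 / p ^ h\<close> are thereby sent to points at distance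
  \<open>1\<close>, where interpolation enlarges no bound. Even functions cannot be treated by
  averaging over the signs, since \<open>1 / 2\<close> is not integral for \<open>p = 2\<close>; the
  splitting by \<open>w\<close> works for all primes, with \<open>w = e_0\<close> for odd
  \<open>p\<close> and \<open>w = e_1\<close> for \<open>p = 2\<close>.\<close>

lemma prime_card_gt_1: "CARD('p::prime_card) > 1"
  using prime_gt_1_nat[OF prime_card] .

lemma pnorm_diff_commute: "pnorm (x - y) = pnorm (y - x :: 'p::prime_card padic)"
  using pnorm_minus[of "x - y"] by simp

lemma pnorm_diff_le: "pnorm (x - y) \<le> max (pnorm x) (pnorm (y :: 'p::prime_card padic))"
  using pnorm_ultra[of x "- y"] by simp

lemma pnorm_diff_trans:
  fixes x y z :: "'p::prime_card padic"
  assumes "pnorm (x - y) \<le> r" "pnorm (y - z) \<le> r"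
  shows "pnorm (x - z) \<le> r"
  using pnorm_ultra[of "x - y" "y - z"] assms by simp

lemma pnorm_le_of_diff:
  fixes x y :: "'p::prime_card padic"
  assumes "pnorm (x - y) \<le> r" "pnorm y \<le> r"
  shows "pnorm x \<le> r"
  using pnorm_ultra[of "x - y" y] assms by simp

lemma pnorm_eq_of_diff_less:
  fixes x y :: "'p::prime_card padic"
  assumes "pnorm (x - y) < pnorm x"
  shows "pnorm y = pnorm x"
proof (rule antisym)
  show "pnorm y \<le> pnorm x" using pnorm_diff_le[of x "x - y"] assms by simp
  show "pnorm x \<le> pnorm y" using pnorm_ultra[of "x - y" y] assms by simp
qed

lemma pnorm_sum_le:
  fixes f :: "'i \<Rightarrow> 'p::prime_card padic"
  assumes "r \<ge> 0" "\<And>i. i \<in> A \<Longrightarrow> pnorm (f i) \<le> r"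
  shows "pnorm (sum f A) \<le> r"
  using assms(2)
proof (induction A rule: infinite_finite_induct)
  case (insert a A)
  then show ?case using pnorm_ultra[of "f a" "sum f A"] by fastforce
qed (use assms(1) in auto)

lemma pnorm_power: "pnorm (x ^ n) = pnorm (x :: 'p::prime_card padic) ^ n"
  by (induction n) (simp_all add: pnorm_mult)

lemma pnorm_prod: "pnorm (prod f A) = (\<Prod>i\<in>A. pnorm (f i :: 'p::prime_card padic))"
  by (induction A rule: infinite_finite_induct) (simp_all add: pnorm_mult)

lemma pnorm_inverse: "pnorm (inverse x) = inverse (pnorm (x :: 'p::prime_card padic))"
proof (cases "x = 0")
  case False
  then have "pnorm (inverse x) * pnorm x = 1" by (simp flip: pnorm_mult)
  then show ?thesis by (metis inverse_unique mult.commute)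
qed simp

lemma pnorm_divide: "pnorm (x / y) = pnorm x / pnorm (y :: 'p::prime_card padic)"
  by (simp add: divide_inverse pnorm_mult pnorm_inverse)

lemma pnorm_of_int:
  assumes "n \<noteq> 0"
  shows "pnorm (of_int n :: 'p::prime_card padic) = 1 / real CARD('p) ^ multiplicity (int CARD('p)) n"
proof -
  have "padic_val CARD('p) (of_int n) = int (multiplicity (int CARD('p)) n)"
    using padic_val_Fract[OF prime_card[where 'a='p] assms, of 1] by (simp add: of_int_rat)
  moreover have "pnorm (of_int n :: 'p padic) = padic_abs CARD('p) (of_int n)"
    using pnorm_of_rat[of "of_int n", where 'p='p] by simp
  ultimately show ?thesis
    using assms by (simp add: padic_abs_def power_int_minus divide_inverse)
qed

lemma pnorm_of_int_le_iff:
  "pnorm (of_int n :: 'p::prime_card padic) \<le> 1 / real CARD('p) ^ h \<longleftrightarrow> int CARD('p) ^ h dvd n"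
proof (cases "n = 0")
  case False
  have p: "real CARD('p) > 1" using prime_card_gt_1[where 'p='p] by simp
  have "pnorm (of_int n :: 'p padic) \<le> 1 / real CARD('p) ^ h
      \<longleftrightarrow> real CARD('p) ^ h \<le> real CARD('p) ^ multiplicity (int CARD('p)) n"
    unfolding pnorm_of_int[OF False] using p by (simp add: field_simps)
  also have "\<dots> \<longleftrightarrow> h \<le> multiplicity (int CARD('p)) n"
    using p by simp
  also have "\<dots> \<longleftrightarrow> int CARD('p) ^ h dvd n"
    using False prime_card[where 'a='p]
    by (intro power_dvd_iff_le_multiplicity[symmetric]) (auto simp: prime_gt_Suc_0_nat)
  finally show ?thesis .
qed simp

lemma pnorm_of_int_le_1: "pnorm (of_int n :: 'p::prime_card padic) \<le> 1"
  using pnorm_of_int_le_iff[of n 0, where 'p='p] by simp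

lemma pnorm_of_int_ge:
  assumes "\<not> int CARD('p) ^ Suc h dvd n"
  shows "pnorm (of_int n :: 'p::prime_card padic) \<ge> 1 / real CARD('p) ^ h"
proof -
  have n: "n \<noteq> 0" using assms by auto
  have p: "real CARD('p) > 1" using prime_card_gt_1[where 'p='p] by simp
  have "multiplicity (int CARD('p)) n \<le> h"
    using assms multiplicity_dvd'[of "Suc h" "int CARD('p)" n] by fastforce
  then show ?thesis
    using p unfolding pnorm_of_int[OF n]
    by (intro divide_left_mono) (auto intro: power_increasing)
qed

lemma pnorm_of_int_eq_1_iff:
  "pnorm (of_int n :: 'p::prime_card padic) = 1 \<longleftrightarrow> \<not> int CARD('p) dvd n"
proof
  assume "pnorm (of_int n :: 'p padic) = 1"
  then show "\<not> int CARD('p) dvd n"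
    using pnorm_of_int_le_iff[of n 1, where 'p='p] prime_card_gt_1[where 'p='p] by auto
next
  assume "\<not> int CARD('p) dvd n"
  then show "pnorm (of_int n :: 'p padic) = 1"
    using pnorm_of_int_ge[of 0 n, where 'p='p] pnorm_of_int_le_1[of n, where 'p='p] by simp
qed

lemma pnorm_card: "pnorm (of_nat CARD('p) :: 'p::prime_card padic) = 1 / real CARD('p)"
proof -
  have "multiplicity (int CARD('p)) (int CARD('p)) = 1"
    using prime_card_gt_1[where 'p='p] by (intro multiplicity_self) auto
  then show ?thesis
    using pnorm_of_int[of "int CARD('p)", where 'p='p] prime_card_gt_1[where 'p='p] by simp
qed

text \<open>A rational \<open>a / b\<close> in lowest terms close to \<open>x\<close> is itself
  integral, so \<open>p\<close> does not divide \<open>b\<close>; the natural number is then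
  \<open>a\<close> times an inverse of \<open>b\<close>, reduced modulo
  \<open>p ^ h\<close>.\<close>

lemma approx_by_nat:
  fixes x :: "'p::prime_card padic"
  assumes "pnorm x \<le> 1"
  shows "\<exists>n < CARD('p) ^ h. pnorm (x - of_nat n) \<le> 1 / real CARD('p) ^ h"
proof -
  let ?p = "int CARD('p)"
  have p: "prime ?p" using prime_card[where 'a='p] by simp
  have p1: "real CARD('p) > 1" using prime_card_gt_1[where 'p='p] by simp
  obtain q where q: "pnorm (x - of_rat q) < 1 / real CARD('p) ^ h"
    using padic_rat_dense[of "1 / real CARD('p) ^ h" x] p1 by auto
  have r1: "1 / real CARD('p) ^ h \<le> 1" using p1 by simp
  have q1: "pnorm (of_rat q :: 'p padic) \<le> 1"
    using pnorm_diff_le[of x "x - of_rat q"] assms q r1 by simp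
  obtain a b where ab: "q = Fract a b" "b > 0" "coprime a b" by (cases q) auto
  have qab: "(of_rat q :: 'p padic) = of_int a / of_int b" using ab by (simp add: of_rat_rat)
  have "\<not> ?p dvd b"
  proof
    assume b: "?p dvd b"
    then have "\<not> ?p dvd a" using ab(3) p by (meson not_prime_unit coprime_common_divisor)
    then have "pnorm (of_int a :: 'p padic) = 1" by (simp add: pnorm_of_int_eq_1_iff)
    moreover have "pnorm (of_int b :: 'p padic) < 1"
      using b pnorm_of_int_le_1[of b, where 'p='p] pnorm_of_int_eq_1_iff[of b, where 'p='p] by linarith
    moreover have "pnorm (of_int b :: 'p padic) > 0"
      using ab(2) pnorm_nonneg[of "of_int b :: 'p padic"] by (simp add: less_le)
    ultimately show False using q1 unfolding qab pnorm_divide by (simp add: field_simps)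
  qed
  then have b1: "pnorm (of_int b :: 'p padic) = 1" by (simp add: pnorm_of_int_eq_1_iff)
  have "coprime b (?p ^ h)"
    using \<open>\<not> ?p dvd b\<close> p by (metis coprime_commute coprime_power_left_iff prime_imp_coprime)
  then obtain c where c: "[b * c = 1] (mod ?p ^ h)" using coprime_iff_invertible_int by blast
  define n where "n = nat ((a * c) mod ?p ^ h)"
  have n: "int n = (a * c) mod ?p ^ h" using p1 by (simp add: n_def)
  have "[b * int n = b * (a * c)] (mod ?p ^ h)" unfolding n by (simp add: cong_def mod_mult_right_eq)
  also have "b * (a * c) = a * (b * c)" by simp
  also have "[a * (b * c) = a * 1] (mod ?p ^ h)" by (intro cong_mult cong_refl c)
  finally have "?p ^ h dvd a - b * int n" by (metis cong_iff_dvd_diff cong_sym mult.right_neutral)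
  then have "pnorm (of_int (a - b * int n) :: 'p padic) \<le> 1 / real CARD('p) ^ h"
    by (simp only: pnorm_of_int_le_iff)
  moreover have "(of_rat q - of_nat n :: 'p padic) = of_int (a - b * int n) / of_int b"
    using ab(2) unfolding qab by (simp add: field_simps)
  ultimately have "pnorm (of_rat q - of_nat n :: 'p padic) \<le> 1 / real CARD('p) ^ h"
    by (simp add: pnorm_divide b1 del: of_int_diff)
  then have "pnorm (x - of_nat n) \<le> 1 / real CARD('p) ^ h"
    using q pnorm_diff_trans[of x "of_rat q" "1 / real CARD('p) ^ h" "of_nat n"] by simp
  moreover have "n < CARD('p) ^ h"
  proof -
    have "int n < ?p ^ h" unfolding n using p1 by (intro pos_mod_bound) simp
    then show ?thesis by (metis of_nat_less_iff of_nat_power)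
  qed
  ultimately show ?thesis by blast
qed

section \<open>Interpolation at points with unit differences\<close>

lemma poly_split_root:
  fixes q :: "'a::idom poly"
  assumes "degree q \<le> Suc d"
  obtains s where "q = [:poly q x0:] + [:- x0, 1:] * s" "degree s \<le> d"
proof -
  have "[:- x0, 1:] dvd q - [:poly q x0:]" by (simp add: dvd_iff_poly_eq_0)
  then obtain s where s: "q - [:poly q x0:] = [:- x0, 1:] * s" by (rule dvdE)
  have "degree s \<le> d"
  proof (cases "s = 0")
    case False
    then have "Suc (degree s) = degree ([:- x0, 1:] * s)" by (subst degree_mult_eq) auto
    also have "\<dots> = degree (q - [:poly q x0:])" by (simp only: s)
    also have "\<dots> \<le> Suc d" using assms by (intro degree_diff_le) auto
    finally show ?thesis by simp
  qed simp
  moreover have "q = [:poly q x0:] + [:- x0, 1:] * s" using s by (simp add: algebra_simps)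
  ultimately show ?thesis using that by blast
qed

text \<open>Coefficient bounds survive one step of Newton's interpolation form when the node is
  integral; both lemmas on nodes with unit differences rest on this.\<close>

lemma pnorm_coeff_newton_step:
  fixes s :: "'p::prime_card padic poly"
  assumes "\<And>n. pnorm (coeff s n) \<le> r" "pnorm c \<le> r" "pnorm x0 \<le> 1"
  shows "pnorm (coeff ([:c:] + [:- x0, 1:] * s) n) \<le> r"
proof -
  have r: "r \<ge> 0" using assms(2) pnorm_nonneg[of c] by linarith
  have 1: "pnorm (coeff (pCons 0 s) n) \<le> r" "pnorm (coeff [:c:] n) \<le> r"
    using assms(1,2) r by (cases n; simp)+
  have "pnorm x0 * pnorm (coeff s n) \<le> 1 * r" using assms by (intro mult_mono) auto
  then have 2: "pnorm (x0 * coeff s n) \<le> r" by (simp add: pnorm_mult)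
  have "coeff ([:c:] + [:- x0, 1:] * s) n = coeff [:c:] n + (coeff (pCons 0 s) n - x0 * coeff s n)"
    by simp
  moreover have "pnorm (coeff (pCons 0 s) n - x0 * coeff s n) \<le> r"
    using pnorm_diff_le[of "coeff (pCons 0 s) n" "x0 * coeff s n"] 1(1) 2 by linarith
  ultimately show ?thesis
    using 1(2) order_trans[OF pnorm_ultra[of "coeff [:c:] n" "coeff (pCons 0 s) n - x0 * coeff s n"]]
    by (simp only: max.bounded_iff)
qed

text \<open>Newton's divided differences have denominators of norm \<open>1\<close> here, so they
  obey the same bound as the values. Equivalently, the Vandermonde determinant of the nodes is a
  unit.\<close>

lemma poly_coeff_bound:
  fixes q :: "'p::prime_card padic poly" and X :: "nat \<Rightarrow> 'p padic"
  assumes "degree q \<le> d"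
    and "\<And>i. i \<le> d \<Longrightarrow> pnorm (X i) \<le> 1"
    and "\<And>i j. i \<le> d \<Longrightarrow> j \<le> d \<Longrightarrow> i \<noteq> j \<Longrightarrow> pnorm (X i - X j) = 1"
    and "\<And>i. i \<le> d \<Longrightarrow> pnorm (poly q (X i)) \<le> r"
  shows "pnorm (coeff q n) \<le> r"
  using assms
proof (induction d arbitrary: q n)
  case 0
  then obtain c where q: "q = [:c:]" by (auto elim: degree_eq_zeroE)
  have "pnorm c \<le> r" using 0(4)[of 0] q by simp
  then show ?case using q order_trans[OF pnorm_nonneg[of c]] by (cases n) auto
next
  case (Suc d)
  obtain s where s: "q = [:poly q (X (Suc d)):] + [:- X (Suc d), 1:] * s" "degree s \<le> d"
    using poly_split_root[OF Suc.prems(1)] by blast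
  have "pnorm (poly s (X i)) \<le> r" if i: "i \<le> d" for i
  proof -
    have "poly q (X i) = poly q (X (Suc d)) + (X i - X (Suc d)) * poly s (X i)"
      by (subst s(1)) (simp add: algebra_simps)
    then have "pnorm (poly q (X i) - poly q (X (Suc d))) = pnorm (X i - X (Suc d)) * pnorm (poly s (X i))"
      by (simp add: pnorm_mult)
    moreover have "pnorm (X i - X (Suc d)) = 1" using Suc.prems(3) i by simp
    moreover have "pnorm (poly q (X i) - poly q (X (Suc d))) \<le> r"
      using pnorm_diff_le[of "poly q (X i)" "poly q (X (Suc d))"] Suc.prems(4)[of i]
        Suc.prems(4)[of "Suc d"] i by linarith
    ultimately show ?thesis by simp
  qed
  then have "pnorm (coeff s n) \<le> r" for n
    by (intro Suc.IH s(2)) (use Suc.prems(2,3) in auto)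
  then show ?case
    by (subst s(1)) (intro pnorm_coeff_newton_step Suc.prems, auto)
qed

text \<open>The Newton form also constructs the interpolating polynomial: the quotients
  \<open>z i\<close> are the values required of the cofactor of \<open>X - X (Suc d)\<close>, and
  dividing by differences of norm \<open>1\<close> keeps the bound \<open>M\<close>.\<close>

lemma poly_interpolation_bound:
  fixes X y :: "nat \<Rightarrow> 'p::prime_card padic"
  assumes "\<And>i. i \<le> d \<Longrightarrow> pnorm (X i) \<le> 1"
    and "\<And>i j. i \<le> d \<Longrightarrow> j \<le> d \<Longrightarrow> i \<noteq> j \<Longrightarrow> pnorm (X i - X j) = 1"
    and "\<And>i. i \<le> d \<Longrightarrow> pnorm (y i) \<le> M"
  shows "\<exists>q. degree q \<le> d \<and> (\<forall>n. pnorm (coeff q n) \<le> M) \<and> (\<forall>i\<le>d. poly q (X i) = y i)"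
  using assms
proof (induction d arbitrary: y)
  case 0
  have "pnorm (coeff [:y 0:] n) \<le> M" for n
    using 0(3)[of 0] order_trans[OF pnorm_nonneg[of "y 0"]] by (cases n) auto
  then show ?case by (intro exI[of _ "[:y 0:]"]) auto
next
  case (Suc d)
  define z where "z i = (y i - y (Suc d)) / (X i - X (Suc d))" for i
  have u: "pnorm (X i - X (Suc d)) = 1" if "i \<le> d" for i using Suc.prems(2) that by simp
  have "pnorm (z i) \<le> M" if i: "i \<le> d" for i
    using u[OF i] pnorm_diff_le[of "y i" "y (Suc d)"] Suc.prems(3)[of i] Suc.prems(3)[of "Suc d"] i
    by (simp add: z_def pnorm_divide)
  then obtain s where s: "degree s \<le> d" "\<And>n. pnorm (coeff s n) \<le> M" "\<And>i. i \<le> d \<Longrightarrow> poly s (X i) = z i"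
    using Suc.IH[of z] Suc.prems(1,2) by fastforce
  define q where "q = [:y (Suc d):] + [:- X (Suc d), 1:] * s"
  have "degree ([:- X (Suc d), 1:] * s) \<le> Suc d"
    using degree_mult_le[of "[:- X (Suc d), 1:]" s] s(1) by simp
  then have "degree q \<le> Suc d" unfolding q_def by (intro degree_add_le) auto
  moreover have "pnorm (coeff q n) \<le> M" for n
    unfolding q_def by (intro pnorm_coeff_newton_step s Suc.prems) auto
  moreover have "poly q (X i) = y i" if i: "i \<le> Suc d" for i
  proof (cases "i = Suc d")
    case False
    then have i: "i \<le> d" using i by simp
    have "X i - X (Suc d) \<noteq> 0" using u[OF i] by auto
    have "poly q (X i) = y (Suc d) + (X i - X (Suc d)) * z i"
      using s(3)[OF i] by (simp add: q_def algebra_simps)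
    then show ?thesis using \<open>X i - X (Suc d) \<noteq> 0\<close> by (simp add: z_def)
  qed (simp add: q_def)
  ultimately show ?case by blast
qed

lemma poly_eq_sum_atMost:
  fixes q :: "'a::comm_semiring_1 poly"
  assumes "degree q \<le> d"
  shows "poly q x = (\<Sum>a\<le>d. coeff q a * x ^ a)"
  unfolding poly_altdef
  by (rule sum.mono_neutral_left) (use assms in \<open>auto simp: coeff_eq_0\<close>)

section \<open>The polynomials \<open>e\<^sub>j\<close> on units\<close>

text \<open>The image of \<open>Rep_padic_unit\<close>, kept as a subset of the field so that
  polynomials and differences of units need no coercion.\<close>

definition padic_units :: "'p::prime_card padic set" where
  "padic_units = {x. pnorm x = 1}"

lemma padic_unitsI: "pnorm x = 1 \<Longrightarrow> x \<in> padic_units"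
  by (simp add: padic_units_def)

lemma pnorm_padic_units: "x \<in> padic_units \<Longrightarrow> pnorm x = 1"
  by (simp add: padic_units_def)

definition rat_poly_val :: "rat poly \<Rightarrow> 'p::prime_card padic \<Rightarrow> 'p padic" where
  "rat_poly_val q x = poly (map_poly of_rat q) x"

lemma rat_poly_val_mult:
  "rat_poly_val (q * r) x = rat_poly_val q x * (rat_poly_val r x :: 'p::prime_card padic)"
proof -
  have "map_poly of_rat (q * r) = map_poly of_rat q * (map_poly of_rat r :: 'p padic poly)"
    by (rule poly_eqI) (simp add: coeff_map_poly coeff_mult of_rat_sum of_rat_mult)
  then show ?thesis by (simp add: rat_poly_val_def)
qed

lemma rat_poly_val_const: "rat_poly_val [:c:] x = (of_rat c :: 'p::prime_card padic)"
  by (simp add: rat_poly_val_def map_poly_pCons)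

lemma rat_poly_val_linear:
  "rat_poly_val [:c, 1:] x = (x + of_rat c :: 'p::prime_card padic)"
  by (simp add: rat_poly_val_def map_poly_pCons)

lemma rat_poly_val_1: "rat_poly_val 1 x = (1 :: 'p::prime_card padic)"
  using rat_poly_val_const[of 1] by (simp add: one_pCons)

lemma rat_poly_val_smult:
  "rat_poly_val (smult c q) x = of_rat c * (rat_poly_val q x :: 'p::prime_card padic)"
  using rat_poly_val_mult[of "[:c:]" q] by (simp add: rat_poly_val_const)

lemma rat_poly_val_power:
  "rat_poly_val (q ^ n) x = (rat_poly_val q x :: 'p::prime_card padic) ^ n"
  by (induction n) (simp_all add: rat_poly_val_mult rat_poly_val_1)

lemma rat_poly_val_prod:
  "rat_poly_val (prod f A) x = (\<Prod>i\<in>A. rat_poly_val (f i) x :: 'p::prime_card padic)"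
  by (induction A rule: infinite_finite_induct) (simp_all add: rat_poly_val_mult rat_poly_val_1)

definition e_val :: "nat \<Rightarrow> 'p::prime_card padic \<Rightarrow> 'p padic" where
  "e_val j x = rat_poly_val (e_poly CARD('p) j) x"

lemma e_val_0: "e_val 0 x = x"
  using rat_poly_val_linear[of 0 x] by (simp add: e_val_def e_poly_def)

lemma e_val_pos:
  fixes x :: "'p::prime_card padic"
  assumes "j \<ge> 1"
  shows "e_val j x = (\<Prod>a\<in>totatives (CARD('p) ^ j). x - of_int (centered_lift (CARD('p) ^ j) a))
    / of_nat (fact (CARD('p) ^ j))"
proof -
  have "rat_poly_val [:- of_int c, 1:] x = x - of_int c" for c
    by (simp only: rat_poly_val_linear of_rat_minus of_rat_of_int_eq diff_conv_add_uminus)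
  moreover have "(of_rat (1 / fact n) :: 'p padic) = 1 / of_nat (fact n)" for n
    using of_rat_of_nat_eq[of "fact n", where 'a="'p padic"] by (simp add: of_rat_divide)
  ultimately show ?thesis
    using assms by (simp add: e_val_def e_poly_def rat_poly_val_smult rat_poly_val_prod)
qed

lemma pnorm_of_int_cong:
  assumes "int CARD('p) ^ h dvd a - b" "\<not> int CARD('p) ^ h dvd a"
  shows "pnorm (of_int b :: 'p::prime_card padic) = pnorm (of_int a :: 'p padic)"
proof (rule pnorm_eq_of_diff_less)
  have "pnorm (of_int (a - b) :: 'p padic) \<le> 1 / real CARD('p) ^ h"
    using assms(1) by (simp only: pnorm_of_int_le_iff)
  also have "\<dots> < pnorm (of_int a :: 'p padic)"
    using assms(2) pnorm_of_int_le_iff[of a h, where 'p='p] by linarith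
  finally show "pnorm (of_int a - of_int b :: 'p padic) < pnorm (of_int a :: 'p padic)" by simp
qed

section \<open>Products over residue classes and the size of \<open>e_h\<close>\<close>

text \<open>As \<open>a\<close> varies, the least positive residue of \<open>a0 - a\<close> modulo
  \<open>m\<close> runs through \<open>1, ..., m - 1\<close>, and the norm of an integer not
  divisible by \<open>m\<close> depends only on its class. Hence the product is that of the factors
  of \<open>(m - 1)!\<close>.\<close>

lemma prod_pnorm_residues:
  fixes h :: nat
  defines "m \<equiv> CARD('p::prime_card) ^ h"
  assumes a0: "a0 < m"
  shows "(\<Prod>a\<in>{0..<m} - {a0}. pnorm (of_int (int a0 - int a) :: 'p padic))
    = pnorm (of_nat (fact (m - 1)) :: 'p padic)"
proof -
  have "(\<Prod>a\<in>{0..<m} - {a0}. pnorm (of_int (int a0 - int a) :: 'p padic))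
      = (\<Prod>s\<in>{1..m - 1}. pnorm (of_nat s :: 'p padic))"
  proof (rule prod.reindex_bij_witness[of _ "\<lambda>s. if s \<le> a0 then a0 - s else a0 + m - s"
        "\<lambda>a. if a < a0 then a0 - a else a0 + m - a"])
    fix a assume a: "a \<in> {0..<m} - {a0}"
    have "pnorm (of_int (int (a0 + m - a)) :: 'p padic) = pnorm (of_int (int a0 - int a) :: 'p padic)"
      if "\<not> a < a0"
    proof (rule pnorm_of_int_cong[of h])
      have eq: "int (a0 + m - a) = int a0 + int m - int a" using a by auto
      have mp: "int CARD('p) ^ h = int m" by (simp add: m_def)
      show "int CARD('p) ^ h dvd int a0 - int a - int (a0 + m - a)"
        unfolding eq mp by simp
      show "\<not> int CARD('p) ^ h dvd int a0 - int a"
        unfolding mp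
        using a that zdvd_not_zless[of "int a - int a0" "int m"] dvd_minus_iff[of "int m" "int a - int a0"]
        by auto
    qed
    then show "pnorm (of_nat (if a < a0 then a0 - a else a0 + m - a) :: 'p padic)
        = pnorm (of_int (int a0 - int a) :: 'p padic)"
      by (auto simp: of_nat_diff)
  qed (use a0 in auto)
  also have "\<dots> = pnorm (of_nat (fact (m - 1)) :: 'p padic)"
    by (simp add: fact_prod pnorm_prod)
  finally show ?thesis .
qed

lemma pnorm_diff_centered_lift:
  "pnorm (of_int (centered_lift (CARD('p) ^ h) a) - of_nat a :: 'p::prime_card padic)
    \<le> 1 / real CARD('p) ^ h"
proof -
  let ?m = "int (CARD('p) ^ h)"
  have "[centered_lift (CARD('p) ^ h) a = int a] (mod ?m)"
    using prime_card_gt_1[where 'p='p]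
    by (subst centered_lift_eq) (simp_all add: cong_def mod_diff_left_eq)
  then have "int CARD('p) ^ h dvd centered_lift (CARD('p) ^ h) a - int a"
    by (simp add: cong_iff_dvd_diff)
  then have "pnorm (of_int (centered_lift (CARD('p) ^ h) a - int a) :: 'p padic)
      \<le> 1 / real CARD('p) ^ h"
    by (simp only: pnorm_of_int_le_iff)
  then show ?thesis by simp
qed

lemma coprime_card_power_iff:
  assumes "h \<ge> 1"
  shows "coprime a (CARD('p::prime_card) ^ h) \<longleftrightarrow> \<not> CARD('p) dvd a"
proof -
  have "coprime a (CARD('p) ^ h) \<longleftrightarrow> coprime CARD('p) a"
    using assms by (simp add: coprime_commute)
  also have "\<dots> \<longleftrightarrow> \<not> CARD('p) dvd a"
    using prime_card[where 'a='p] prime_imp_coprime[of "CARD('p)" a] prime_card_gt_1[where 'p='p]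
    by (auto simp: coprime_absorb_left)
  finally show ?thesis .
qed

lemma unit_residue:
  fixes x :: "'p::prime_card padic"
  assumes "x \<in> padic_units" "h \<ge> 1"
  obtains a where "a < CARD('p) ^ h" "a \<in> totatives (CARD('p) ^ h)"
    "pnorm (x - of_nat a) \<le> 1 / real CARD('p) ^ h"
proof -
  have p: "real CARD('p) > 1" using prime_card_gt_1[where 'p='p] by simp
  have x: "pnorm x = 1" using assms(1) by (rule pnorm_padic_units)
  obtain a where a: "a < CARD('p) ^ h" "pnorm (x - of_nat a) \<le> 1 / real CARD('p) ^ h"
    using approx_by_nat[of x h] x by auto
  have "1 / real CARD('p) ^ h < 1" using p assms(2) by simp
  then have "pnorm (of_nat a :: 'p padic) = 1" using pnorm_eq_of_diff_less[of x "of_nat a"] a x by simp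
  then have nd: "\<not> CARD('p) dvd a" using pnorm_of_int_eq_1_iff[of "int a", where 'p='p] by simp
  then have "a > 0" by (intro Nat.gr0I) auto
  then have "a \<in> totatives (CARD('p) ^ h)"
    using a nd coprime_card_power_iff[OF assms(2), of a, where 'p='p] by (simp add: in_totatives_iff)
  then show ?thesis using that a by blast
qed

text \<open>
  Modulo \<open>p\<^sup>h\<close>, \<open>x\<close> and the lift of \<open>a\<close> are \<open>a\<^sub>0\<close> and \<open>a\<close>, so the factor for \<open>a\<close> has the size of
  \<open>a\<^sub>0 - a\<close>.  Adding the factors for the non-units \<open>a\<close>, which have size \<open>1\<close>, gives the size of
  \<open>(p\<^sup>h - 1)!\<close>.
\<close>

lemma prod_pnorm_totatives:
  fixes x :: "'p::prime_card padic" and h :: nat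
  defines "m \<equiv> CARD('p) ^ h"
  assumes h: "h \<ge> 1" and a0: "a0 < m" "a0 \<in> totatives m"
    and x: "pnorm (x - of_nat a0) \<le> 1 / real CARD('p) ^ h"
  shows "(\<Prod>a\<in>totatives m - {a0}. pnorm (x - of_int (centered_lift m a)))
    = pnorm (of_nat (fact m) :: 'p padic) * real CARD('p) ^ h"
    and "\<And>a. a \<in> totatives m - {a0} \<Longrightarrow>
      pnorm (x - of_int (centered_lift m a)) \<ge> real CARD('p) / real CARD('p) ^ h"
proof -
  have p: "real CARD('p) > 1" using prime_card_gt_1[where 'p='p] by simp
  have mp: "int CARD('p) ^ h = int m" by (simp add: m_def)
  have m1: "m > 1" using prime_card_gt_1[where 'p='p] h one_less_power[of "CARD('p)" h] by (simp add: m_def)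
  have tot: "a \<in> totatives m \<longleftrightarrow> a < m \<and> \<not> CARD('p) dvd a" for a
  proof -
    have "CARD('p) dvd m" using h by (simp add: m_def)
    then show ?thesis
      using m1 coprime_card_power_iff[OF h, of a, where 'p='p]
      unfolding in_totatives_iff m_def[symmetric] by (cases "a = 0"; cases "a = m") auto
  qed
  have nd: "\<not> int m dvd int a0 - int a" if "a < m" "a \<noteq> a0" for a
  proof
    assume "int m dvd int a0 - int a"
    then have "int a0 mod int m = int a mod int m" by (simp add: mod_eq_dvd_iff)
    then show False using that a0 by simp
  qed
  have val: "pnorm (x - of_int (centered_lift m a)) = pnorm (of_int (int a0 - int a) :: 'p padic)"
    if a: "a < m" "a \<noteq> a0" for a
  proof (rule pnorm_eq_of_diff_less)
    have "pnorm (of_int (int a0 - int a) - (x - of_int (centered_lift m a)))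
        = pnorm ((of_int (centered_lift m a) - of_nat a) - (x - of_nat a0))"
      by (simp add: algebra_simps)
    also have "\<dots> \<le> 1 / real CARD('p) ^ h"
      using pnorm_diff_le[of "of_int (centered_lift m a) - of_nat a" "x - of_nat a0"] x
        pnorm_diff_centered_lift[of h a, where 'p='p] unfolding m_def[symmetric] by linarith
    also have "\<dots> < pnorm (of_int (int a0 - int a) :: 'p padic)"
      using nd[OF a] pnorm_of_int_le_iff[of "int a0 - int a" h, where 'p='p] unfolding mp by linarith
    finally show "pnorm (of_int (int a0 - int a) - (x - of_int (centered_lift m a)))
        < pnorm (of_int (int a0 - int a) :: 'p padic)" .
  qed
  have "(\<Prod>a\<in>totatives m - {a0}. pnorm (x - of_int (centered_lift m a)))
      = (\<Prod>a\<in>totatives m - {a0}. pnorm (of_int (int a0 - int a) :: 'p padic))"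
    by (intro prod.cong refl val) (auto simp: tot)
  also have "\<dots> = (\<Prod>a\<in>{0..<m} - {a0}. pnorm (of_int (int a0 - int a) :: 'p padic))"
  proof (rule prod.mono_neutral_left)
    show "\<forall>a\<in>{0..<m} - {a0} - (totatives m - {a0}). pnorm (of_int (int a0 - int a) :: 'p padic) = 1"
    proof
      fix a assume "a \<in> {0..<m} - {a0} - (totatives m - {a0})"
      then have "int CARD('p) dvd int a" "\<not> int CARD('p) dvd int a0" using a0 by (auto simp: tot)
      then have "\<not> int CARD('p) dvd int a0 - int a" using dvd_diff_left_iff by blast
      then show "pnorm (of_int (int a0 - int a) :: 'p padic) = 1"
        by (rule pnorm_of_int_eq_1_iff[THEN iffD2])
    qed
  qed (auto simp: tot)
  also have "\<dots> = pnorm (of_nat (fact (m - 1)) :: 'p padic)"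
    using prod_pnorm_residues[of a0 h, where 'p='p] a0 by (simp only: m_def)
  also have "\<dots> = pnorm (of_nat (fact m) :: 'p padic) * real CARD('p) ^ h"
  proof -
    have "(of_nat (fact m) :: 'p padic) = of_nat CARD('p) ^ h * of_nat (fact (m - 1))"
    proof -
      have "(fact m :: 'p padic) = of_nat m * fact (m - 1)" using m1 by (intro fact_reduce) simp
      then show ?thesis by (simp add: m_def)
    qed
    then show ?thesis using p by (simp add: pnorm_mult pnorm_power pnorm_card power_divide)
  qed
  finally show "(\<Prod>a\<in>totatives m - {a0}. pnorm (x - of_int (centered_lift m a)))
      = pnorm (of_nat (fact m) :: 'p padic) * real CARD('p) ^ h" .
  fix a assume "a \<in> totatives m - {a0}"
  then have a: "a < m" "a \<noteq> a0" by (auto simp: tot)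
  \<comment> \<open>The norms of integers are discrete: not being divisible by \<open>p ^ h\<close>
    puts the norm a whole factor \<open>p\<close> above \<open>1 / p ^ h\<close>. This gap is what
    makes the variation of the remaining factors negligible when \<open>x\<close> moves inside its
    class.\<close>
  have "\<not> int CARD('p) ^ Suc (h - 1) dvd int a0 - int a"
    using nd[OF a] h unfolding mp[symmetric] by (simp del: of_nat_power)
  then have "1 / real CARD('p) ^ (h - 1) \<le> pnorm (of_int (int a0 - int a) :: 'p padic)"
    by (rule pnorm_of_int_ge)
  moreover have "1 / real CARD('p) ^ (h - 1) = real CARD('p) / real CARD('p) ^ h"
    using h p by (cases h) auto
  ultimately show "pnorm (x - of_int (centered_lift m a)) \<ge> real CARD('p) / real CARD('p) ^ h"
    using val[OF a] by simp
qed

text \<open>Each factor changes by at most \<open>pnorm (x - y) / R\<close> relative to its size,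
  and by the ultrametric inequality the product changes by no larger relative amount. The induction
  swaps one factor at a time; the claim is multiplied by \<open>R\<close> to avoid division.\<close>

lemma pnorm_prod_linear_diff:
  fixes x y :: "'p::prime_card padic" and L :: "'i \<Rightarrow> 'p padic"
  assumes "finite S" "\<And>a. a \<in> S \<Longrightarrow> pnorm (y - L a) \<ge> R" "pnorm (x - y) < R"
  shows "R * pnorm ((\<Prod>a\<in>S. x - L a) - (\<Prod>a\<in>S. y - L a)) \<le> pnorm (x - y) * (\<Prod>a\<in>S. pnorm (y - L a))"
  using assms(1,2)
proof (induction S rule: finite_induct)
  case (insert a S)
  let ?X = "\<Prod>a\<in>S. x - L a" and ?Y = "\<Prod>a\<in>S. y - L a"
  have R: "R > 0" using assms(3) pnorm_nonneg[of "x - y"] by linarith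
  have ya: "pnorm (y - L a) \<ge> R" using insert.prems by simp
  have xa: "pnorm (x - L a) = pnorm (y - L a)"
  proof (rule pnorm_eq_of_diff_less)
    have "pnorm (y - L a - (x - L a)) = pnorm (x - y)" by (simp add: pnorm_diff_commute)
    then show "pnorm (y - L a - (x - L a)) < pnorm (y - L a)" using assms(3) ya by simp
  qed
  have "R * pnorm ((x - L a) * (?X - ?Y)) = pnorm (y - L a) * (R * pnorm (?X - ?Y))"
    by (simp add: pnorm_mult xa)
  also have "\<dots> \<le> pnorm (y - L a) * (pnorm (x - y) * (\<Prod>a\<in>S. pnorm (y - L a)))"
    using insert by (intro mult_left_mono) auto
  finally have 1: "R * pnorm ((x - L a) * (?X - ?Y)) \<le> pnorm (x - y) * (\<Prod>a\<in>insert a S. pnorm (y - L a))"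
    using insert.hyps by (simp add: mult_ac)
  have "R * pnorm ((x - y) * ?Y) = R * (pnorm (x - y) * (\<Prod>a\<in>S. pnorm (y - L a)))"
    by (simp add: pnorm_mult pnorm_prod)
  also have "\<dots> \<le> pnorm (y - L a) * (pnorm (x - y) * (\<Prod>a\<in>S. pnorm (y - L a)))"
    using ya by (intro mult_right_mono mult_nonneg_nonneg prod_nonneg) auto
  finally have 2: "R * pnorm ((x - y) * ?Y) \<le> pnorm (x - y) * (\<Prod>a\<in>insert a S. pnorm (y - L a))"
    using insert.hyps by (simp add: mult_ac)
  have "(\<Prod>a\<in>insert a S. x - L a) - (\<Prod>a\<in>insert a S. y - L a) = (x - L a) * (?X - ?Y) + (x - y) * ?Y"
    using insert.hyps by (simp add: algebra_simps)
  then have "pnorm ((\<Prod>a\<in>insert a S. x - L a) - (\<Prod>a\<in>insert a S. y - L a))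
      \<le> max (pnorm ((x - L a) * (?X - ?Y))) (pnorm ((x - y) * ?Y))"
    by (simp only: pnorm_ultra)
  then have "R * pnorm ((\<Prod>a\<in>insert a S. x - L a) - (\<Prod>a\<in>insert a S. y - L a))
      \<le> R * max (pnorm ((x - L a) * (?X - ?Y))) (pnorm ((x - y) * ?Y))"
    using R by (intro mult_left_mono) auto
  also have "\<dots> \<le> pnorm (x - y) * (\<Prod>a\<in>insert a S. pnorm (y - L a))"
    using 1 2 by (auto simp: max_def)
  finally show ?case .
qed simp

text \<open>Write \<open>e_h(z) = (z - L a0) * G(z)\<close>, where \<open>a0\<close> is the class of
  \<open>x\<close> and \<open>G\<close> has norm \<open>p ^ h\<close> on that class. Then
  \<open>e_h(x) - e_h(y) = (x - y) * G(x) + (y - L a0) * (G(x) - G(y))\<close>. The relative change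
  of \<open>G\<close> is at most \<open>pnorm (x - y) * p ^ h / p\<close>, and
  \<open>y - L a0\<close> has norm at most \<open>1 / p ^ h\<close>, so the second summand is
  smaller than the first by a factor of at least \<open>p\<close> and the first one determines the
  norm.\<close>

lemma e_val_pnorm_and_diff:
  fixes x y :: "'p::prime_card padic"
  assumes x: "x \<in> padic_units"
  shows pnorm_e_val_le_1: "pnorm (e_val h x) \<le> 1"
    and pnorm_e_val_diff: "pnorm (x - y) \<le> 1 / real CARD('p) ^ h \<Longrightarrow>
      pnorm (e_val h x - e_val h y) = real CARD('p) ^ h * pnorm (x - y)"
proof -
  have p: "real CARD('p) > 1" using prime_card_gt_1[where 'p='p] by simp
  have "pnorm (e_val h x) \<le> 1 \<and> (pnorm (x - y) \<le> 1 / real CARD('p) ^ h \<longrightarrow>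
      pnorm (e_val h x - e_val h y) = real CARD('p) ^ h * pnorm (x - y))"
  proof (cases "h = 0")
    case True
    then show ?thesis using pnorm_padic_units[OF x] by (simp add: e_val_0)
  next
    case False
    then have h: "h \<ge> 1" by simp
    define m where "m = CARD('p) ^ h"
    define r where "r = 1 / real CARD('p) ^ h"
    define L :: "nat \<Rightarrow> 'p padic" where "L a = of_int (centered_lift m a)" for a
    obtain a0 where a0: "a0 < m" "a0 \<in> totatives m" "pnorm (x - of_nat a0) \<le> r"
      using unit_residue[OF x h] unfolding m_def r_def by blast
    define S where "S = totatives m - {a0}"
    define F where "F = pnorm (of_nat (fact m) :: 'p padic)"
    have F: "F > 0" by (simp add: F_def less_le fact_nonzero del: of_nat_fact)
    have r: "r > 0" using p by (simp add: r_def)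
    have S: "finite S" by (simp add: S_def)
    note P = prod_pnorm_totatives[OF h a0[unfolded m_def r_def], folded m_def, folded S_def F_def L_def]
    have La0: "pnorm (z - L a0) \<le> r" if "pnorm (z - of_nat a0) \<le> r" for z
      using pnorm_diff_trans[OF that, of "L a0"] pnorm_diff_centered_lift[of h a0, where 'p='p]
      by (simp add: L_def m_def r_def pnorm_diff_commute)
    have e: "e_val h z = (z - L a0) * (\<Prod>a\<in>S. z - L a) / of_nat (fact m)" for z
      unfolding e_val_pos[OF h] m_def[symmetric] L_def[symmetric] S_def
      using prod.remove[OF finite_totatives a0(2)] by simp
    have "pnorm (e_val h x) = pnorm (x - L a0) * (F * real CARD('p) ^ h) / F"
      unfolding e pnorm_divide pnorm_mult pnorm_prod P(1) F_def ..
    also have "\<dots> = pnorm (x - L a0) * real CARD('p) ^ h" using F by simp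
    also have "\<dots> \<le> r * real CARD('p) ^ h" using La0[OF a0(3)] by (intro mult_right_mono) auto
    also have "\<dots> = 1" using p by (simp add: r_def)
    finally have 1: "pnorm (e_val h x) \<le> 1" .
    moreover have "pnorm (e_val h x - e_val h y) = real CARD('p) ^ h * pnorm (x - y)"
      if xy: "pnorm (x - y) \<le> r"
    proof (cases "x = y")
      case False
      let ?X = "\<Prod>a\<in>S. x - L a" and ?Y = "\<Prod>a\<in>S. y - L a"
      have d: "pnorm (x - y) > 0" using False pnorm_nonneg[of "x - y"] by (simp add: less_le)
      have y: "pnorm (y - of_nat a0) \<le> r"
        using xy pnorm_diff_trans[of y x r "of_nat a0"] a0(3) by (simp add: pnorm_diff_commute)
      note Py = prod_pnorm_totatives[OF h a0(1,2)[unfolded m_def] y[unfolded r_def],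
          folded m_def, folded S_def F_def L_def]
      have "real CARD('p) * r * pnorm (?X - ?Y) \<le> pnorm (x - y) * (\<Prod>a\<in>S. pnorm (y - L a))"
      proof (rule pnorm_prod_linear_diff[OF S])
        show "pnorm (y - L a) \<ge> real CARD('p) * r" if "a \<in> S" for a
          using Py(2)[OF that] by (simp add: r_def)
        have "1 * r < real CARD('p) * r" using p r by (intro mult_strict_right_mono)
        then show "pnorm (x - y) < real CARD('p) * r" using xy by simp
      qed
      then have X: "real CARD('p) * r * pnorm (?X - ?Y) \<le> pnorm (x - y) * pnorm ?X"
        unfolding Py(1) P(1)[folded pnorm_prod] .
      have nX: "pnorm ?X > 0" using P(1) F p by (simp add: pnorm_prod)
      have "real CARD('p) * pnorm ((y - L a0) * (?X - ?Y)) \<le> real CARD('p) * (r * pnorm (?X - ?Y))"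
        using La0[OF y] p unfolding pnorm_mult by (intro mult_left_mono mult_right_mono) auto
      also have "\<dots> \<le> pnorm (x - y) * pnorm ?X" using X by (simp add: mult_ac)
      also have "\<dots> < real CARD('p) * (pnorm (x - y) * pnorm ?X)"
        using p d nX by simp
      finally have "pnorm ((y - L a0) * (?X - ?Y)) < pnorm ((x - y) * ?X)"
        using p by (simp add: pnorm_mult)
      moreover have "(x - y) * ?X - ((x - L a0) * ?X - (y - L a0) * ?Y) = - ((y - L a0) * (?X - ?Y))"
        by (simp add: algebra_simps)
      ultimately have "pnorm ((x - L a0) * ?X - (y - L a0) * ?Y) = pnorm ((x - y) * ?X)"
        by (intro pnorm_eq_of_diff_less) (simp only: pnorm_minus)
      moreover have "e_val h x - e_val h y = ((x - L a0) * ?X - (y - L a0) * ?Y) / of_nat (fact m)"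
        unfolding e diff_divide_distrib ..
      ultimately have "pnorm (e_val h x - e_val h y) = pnorm (x - y) * pnorm ?X / F"
        by (simp add: pnorm_divide pnorm_mult F_def)
      also have "\<dots> = real CARD('p) ^ h * pnorm (x - y)"
        using F P(1) by (simp add: pnorm_prod)
      finally show ?thesis .
    qed simp
    ultimately show ?thesis by (simp add: r_def)
  qed
  then show "pnorm (e_val h x) \<le> 1"
    and "pnorm (x - y) \<le> 1 / real CARD('p) ^ h \<Longrightarrow>
      pnorm (e_val h x - e_val h y) = real CARD('p) ^ h * pnorm (x - y)" by blast+
qed

section \<open>The polynomials \<open>E\<^sub>n\<close> on units\<close>

text \<open>
  The number of values of the digit \<open>a\<^sub>h\<close>, which is also the number of classes modulo
  \<open>p\<^bsup>h+1\<^esup>\<close> in a class of units modulo \<open>p\<^sup>h\<close>.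
\<close>

definition digit_count :: "nat \<Rightarrow> nat \<Rightarrow> nat" where
  "digit_count p h = (if h = 0 then p - 1 else p)"

lemma totient_Suc_power:
  assumes "prime p"
  shows "totient (p ^ Suc h) = digit_count p h * totient (p ^ h)"
proof (cases h)
  case 0
  then show ?thesis using assms by (simp add: digit_count_def totient_prime)
next
  case (Suc g)
  have "totient (p ^ Suc h) = p * (p ^ g * (p - 1))"
    using totient_prime_power_Suc[OF assms, of h] Suc by simp
  also have "p ^ g * (p - 1) = totient (p ^ h)"
    unfolding Suc by (rule totient_prime_power_Suc[OF assms, symmetric])
  finally show ?thesis using Suc by (simp add: digit_count_def)
qed

lemma le_totient_power:
  assumes "prime p"
  shows "n \<le> totient (p ^ Suc n)"
proof -
  have p: "p \<ge> 2" using assms by (rule prime_ge_2_nat)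
  have "n < 2 ^ n" by (rule less_exp)
  also have "\<dots> \<le> p ^ n" using p by (intro power_mono) auto
  also have "\<dots> \<le> p ^ n * (p - 1)" using p by simp
  finally show ?thesis using assms by (simp only: totient_prime_power_Suc)
qed

section \<open>Digit expansions and the factorization of \<open>E_n\<close>\<close>

lemma E_poly_eq_prod:
  assumes p: "prime p" and d: "totient_digits p n d" and J: "\<And>j. j \<ge> J \<Longrightarrow> d j = 0"
  shows "E_poly p n = (\<Prod>j<J. e_poly p j ^ d j)"
proof -
  have "(THE d. totient_digits p n d) = d"
  proof (rule the_equality)
    show "d' = d" if "totient_digits p n d'" for d'
      using that d by (simp only: totient_digits_iff[OF p])
  qed (rule d)
  then have "E_poly p n = (\<Prod>j | d j \<noteq> 0. e_poly p j ^ d j)" by (simp add: E_poly_def)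
  also have "\<dots> = (\<Prod>j<J. e_poly p j ^ d j)"
  proof (rule prod.mono_neutral_left)
    have "j < J" if "d j \<noteq> 0" for j using J[of j] that by (cases "J \<le> j") auto
    then show "{j. d j \<noteq> 0} \<subseteq> {..<J}" by auto
  qed auto
  finally show ?thesis .
qed

text \<open>A nonzero digit at a position \<open>j \<ge> h\<close> would alone contribute at least
  \<open>totient (p ^ j) \<ge> totient (p ^ h)\<close>, which exceeds \<open>k\<close>.\<close>

lemma ex_totient_digits_bounded:
  assumes p: "prime p" and k: "k < totient (p ^ h)"
  shows "\<exists>d. totient_digits p k d \<and> (\<forall>j\<ge>h. d j = 0)"
proof -
  obtain d where d: "totient_digits p k d" using ex1_totient_digits[OF p] by blast
  have fin: "finite {j. j \<ge> 1 \<and> d j \<noteq> 0}"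
    by (rule finite_subset[of _ "{j. d j \<noteq> 0}"]) (use d in \<open>auto simp: totient_digits_def\<close>)
  have k_eq: "k = d 0 + (\<Sum>j | j \<ge> 1 \<and> d j \<noteq> 0. d j * totient (p ^ j))"
    using d by (simp add: totient_digits_def)
  have "d j = 0" if j: "j \<ge> h" for j
  proof (rule ccontr)
    assume dj: "d j \<noteq> 0"
    have "d j * totient (p ^ j) \<le> k"
    proof (cases "j = 0")
      case True
      then show ?thesis using k_eq by simp
    next
      case False
      then have "d j * totient (p ^ j) \<le> (\<Sum>j | j \<ge> 1 \<and> d j \<noteq> 0. d j * totient (p ^ j))"
        using dj by (intro member_le_sum fin) auto
      then show ?thesis using k_eq by linarith
    qed
    moreover have "totient (p ^ j) \<le> d j * totient (p ^ j)" using dj by simp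
    moreover have "totient (p ^ h) \<le> totient (p ^ j)"
      by (rule dvd_imp_le[OF totient_dvd[OF le_imp_power_dvd[OF j]]]) (use p in \<open>simp add: prime_gt_0_nat\<close>)
    ultimately show False using k by linarith
  qed
  then show ?thesis using d by blast
qed

text \<open>All digits of \<open>k\<close> sit below position \<open>h\<close>, so adding
  \<open>a * totient (p ^ h)\<close> writes the digit \<open>a\<close> into an empty position and
  produces no carry.\<close>

lemma E_poly_step:
  assumes p: "prime p" and k: "k < totient (p ^ h)" and a: "a < digit_count p h"
  shows "E_poly p (k + a * totient (p ^ h)) = E_poly p k * e_poly p h ^ a"
proof -
  have p2: "p \<ge> 2" using p by (rule prime_ge_2_nat)
  obtain d where d: "totient_digits p k d" and dh: "\<And>j. j \<ge> h \<Longrightarrow> d j = 0"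
    using ex_totient_digits_bounded[OF p k] by blast
  define d' where "d' = d(h := a)"
  have sum: "(\<Sum>j | j \<ge> 1 \<and> f j \<noteq> 0. f j * totient (p ^ j)) = (\<Sum>j\<in>{1..h}. f j * totient (p ^ j))"
    if "\<And>j. j > h \<Longrightarrow> f j = 0" for f :: "nat \<Rightarrow> nat"
  proof (rule sum.mono_neutral_left)
    have "j \<le> h" if "f j \<noteq> 0" for j using \<open>\<And>j. j > h \<Longrightarrow> f j = 0\<close>[of j] that by (cases "j > h") auto
    then show "{j. j \<ge> 1 \<and> f j \<noteq> 0} \<subseteq> {1..h}" by auto
  qed auto
  have k_eq: "k = d 0 + (\<Sum>j\<in>{1..h}. d j * totient (p ^ j))"
    using d sum[of d] dh by (simp add: totient_digits_def)
  \<comment> \<open>Position \<open>0\<close> has weight \<open>totient 1 = 1\<close> but stands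
    outside the sum, so \<open>h = 0\<close> is treated apart; there \<open>k = 0\<close> and the
    new digit is \<open>d' 0\<close>.\<close>
  have "k + a * totient (p ^ h) = d' 0 + (\<Sum>j\<in>{1..h}. d' j * totient (p ^ j))"
  proof (cases h)
    case 0
    then show ?thesis using k_eq dh[of 0] by (simp add: d'_def)
  next
    case (Suc g)
    have "(\<Sum>j\<in>{1..g}. d' j * totient (p ^ j)) = (\<Sum>j\<in>{1..g}. d j * totient (p ^ j))"
      by (intro sum.cong) (auto simp: d'_def Suc)
    moreover have "d' h = a" "d' 0 = d 0" "d h = 0" using dh by (simp_all add: d'_def Suc)
    ultimately show ?thesis using k_eq by (simp add: Suc)
  qed
  then have "k + a * totient (p ^ h) = d' 0 + (\<Sum>j | j \<ge> 1 \<and> d' j \<noteq> 0. d' j * totient (p ^ j))"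
    using sum[of d'] dh by (simp add: d'_def)
  moreover have "d' 0 \<in> {0..p - 2}" "\<forall>j\<ge>1. d' j \<in> {0..p - 1}"
    using d a p2 by (auto simp: totient_digits_def d'_def digit_count_def split: if_splits)
  moreover have "finite {j. d' j \<noteq> 0}"
  proof (rule finite_subset)
    have "j \<le> h" if "d' j \<noteq> 0" for j using dh[of j] that by (cases "j > h") (auto simp: d'_def)
    then show "{j. d' j \<noteq> 0} \<subseteq> {..h}" by auto
  qed simp
  ultimately have d': "totient_digits p (k + a * totient (p ^ h)) d'"
    by (simp add: totient_digits_def)
  have "E_poly p (k + a * totient (p ^ h)) = (\<Prod>j<Suc h. e_poly p j ^ d' j)"
    using dh by (intro E_poly_eq_prod p d') (auto simp: d'_def)
  also have "\<dots> = (\<Prod>j<h. e_poly p j ^ d j) * e_poly p h ^ a"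
    by (simp add: d'_def)
  also have "(\<Prod>j<h. e_poly p j ^ d j) = E_poly p k"
    using dh by (intro E_poly_eq_prod[symmetric] p d) auto
  finally show ?thesis .
qed

lemma E_poly_0: "prime p \<Longrightarrow> E_poly p 0 = 1"
  using E_poly_eq_prod[of p 0 "\<lambda>_. 0" 0] by (simp add: totient_digits_def)

section \<open>Size and variation of \<open>E_n\<close> on units\<close>

definition E_val :: "nat \<Rightarrow> 'p::prime_card padic \<Rightarrow> 'p padic" where
  "E_val n x = rat_poly_val (E_poly CARD('p) n) x"

lemma E_val_0: "E_val 0 x = (1 :: 'p::prime_card padic)"
  by (simp add: E_val_def E_poly_0[OF prime_card] rat_poly_val_1)

lemma E_val_step:
  assumes "k < totient (CARD('p::prime_card) ^ h)" "a < digit_count CARD('p) h"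
  shows "E_val (k + a * totient (CARD('p) ^ h)) x = E_val k x * (e_val h x :: 'p padic) ^ a"
  using assms by (simp add: E_val_def e_val_def E_poly_step[OF prime_card] rat_poly_val_mult rat_poly_val_power)

lemma less_totient_Suc_power:
  assumes "prime p" "n < totient (p ^ Suc h)"
  obtains k a where "k < totient (p ^ h)" "a < digit_count p h" "n = k + a * totient (p ^ h)"
proof
  let ?N = "totient (p ^ h)"
  have N: "?N > 0" using assms(1) by (simp add: prime_gt_0_nat)
  show "n mod ?N < ?N" using N by simp
  show "n div ?N < digit_count p h"
    using assms N by (simp add: totient_Suc_power less_mult_imp_div_less del: power_Suc)
  show "n = n mod ?N + n div ?N * ?N" by simp
qed

lemma pnorm_mult_le_1: "pnorm x \<le> 1 \<Longrightarrow> pnorm y \<le> 1 \<Longrightarrow> pnorm (x * y :: 'p::prime_card padic) \<le> 1"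
  by (simp add: pnorm_mult mult_le_one)

lemma pnorm_mult_diff_le:
  fixes x y x' y' :: "'p::prime_card padic"
  assumes "pnorm x \<le> 1" "pnorm y' \<le> 1" "pnorm (x - x') \<le> r" "pnorm (y - y') \<le> r"
  shows "pnorm (x * y - x' * y') \<le> r"
proof -
  have "pnorm (x * (y - y')) \<le> 1 * r" unfolding pnorm_mult using assms by (intro mult_mono) auto
  moreover have "pnorm ((x - x') * y') \<le> r * 1"
    unfolding pnorm_mult using assms order_trans[OF pnorm_nonneg] by (intro mult_mono) auto
  moreover have "x * y - x' * y' = x * (y - y') + (x - x') * y'" by (simp add: algebra_simps)
  ultimately show ?thesis using pnorm_ultra[of "x * (y - y')" "(x - x') * y'"] by simp
qed

lemma pnorm_power_diff_le:
  fixes x y :: "'p::prime_card padic"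
  assumes "pnorm x \<le> 1" "pnorm y \<le> 1" "pnorm (x - y) \<le> r"
  shows "pnorm (x ^ n - y ^ n) \<le> r"
proof (induction n)
  case 0
  then show ?case using order_trans[OF pnorm_nonneg assms(3)] by simp
next
  case (Suc n)
  show ?case using assms Suc
    by (simp add: pnorm_mult_diff_le pnorm_power power_le_one)
qed

lemma pnorm_E_val_le_1_less:
  fixes x :: "'p::prime_card padic"
  assumes "x \<in> padic_units"
  shows "n < totient (CARD('p) ^ h) \<Longrightarrow> pnorm (E_val n x) \<le> 1"
proof (induction h arbitrary: n)
  case 0
  then show ?case by (simp add: E_val_0)
next
  case (Suc h)
  obtain k a where ka: "k < totient (CARD('p) ^ h)" "a < digit_count CARD('p) h"
    "n = k + a * totient (CARD('p) ^ h)"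
    using less_totient_Suc_power[OF prime_card Suc.prems] by blast
  have "pnorm (e_val h x ^ a) \<le> 1"
    using pnorm_e_val_le_1[OF assms] by (simp add: pnorm_power power_le_one)
  then show ?case
    using Suc.IH[OF ka(1)] unfolding ka(3) E_val_step[OF ka(1,2)] by (simp add: pnorm_mult_le_1)
qed

lemma less_totient_Suc: "n < totient (CARD('p::prime_card) ^ Suc (Suc n))"
  using le_totient_power[OF prime_card[where 'a='p], of "Suc n"] by (simp del: power_Suc)

lemma pnorm_E_val_le_1:
  "x \<in> padic_units \<Longrightarrow> pnorm (E_val n (x :: 'p::prime_card padic)) \<le> 1"
  using pnorm_E_val_le_1_less less_totient_Suc[of n, where 'p='p] by blast

text \<open>Only \<open>e_j\<close> with \<open>j < h\<close> occur in \<open>E_n\<close>, and the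
  steepest of them, \<open>e_j\<close> with \<open>j = h - 1\<close>, stretches distances by
  \<open>p ^ (h - 1)\<close>. This constant is written as a quotient so that it makes sense at
  \<open>h = 0\<close>, where \<open>n = 0\<close> and \<open>E_n\<close> is constant.\<close>

lemma pnorm_E_val_diff:
  fixes x y :: "'p::prime_card padic"
  assumes x: "x \<in> padic_units" and y: "y \<in> padic_units"
  shows "n < totient (CARD('p) ^ h) \<Longrightarrow> pnorm (x - y) \<le> 1 / real CARD('p) ^ h \<Longrightarrow>
    pnorm (E_val n x - E_val n y) \<le> real CARD('p) ^ h / real CARD('p) * pnorm (x - y)"
proof (induction h arbitrary: n)
  case 0
  then show ?case by (simp add: E_val_0)
next
  case (Suc h)
  have p: "real CARD('p) > 1" using prime_card_gt_1[where 'p='p] by simp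
  obtain k a where ka: "k < totient (CARD('p) ^ h)" "a < digit_count CARD('p) h"
    "n = k + a * totient (CARD('p) ^ h)"
    using less_totient_Suc_power[OF prime_card Suc.prems(1)] by blast
  have "1 / real CARD('p) ^ Suc h \<le> 1 / real CARD('p) ^ h"
    using p by (intro divide_left_mono power_increasing) auto
  then have xy: "pnorm (x - y) \<le> 1 / real CARD('p) ^ h" using Suc.prems(2) by linarith
  have eq: "real CARD('p) ^ Suc h / real CARD('p) = real CARD('p) ^ h" using p by simp
  have "real CARD('p) ^ h / real CARD('p) \<le> real CARD('p) ^ h / 1"
    using p by (intro divide_left_mono) auto
  then have "real CARD('p) ^ h / real CARD('p) * pnorm (x - y) \<le> real CARD('p) ^ h * pnorm (x - y)"
    by (intro mult_right_mono) auto
  then have 1: "pnorm (E_val k x - E_val k y) \<le> real CARD('p) ^ h * pnorm (x - y)"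
    using Suc.IH[OF ka(1) xy] by linarith
  have 2: "pnorm (e_val h x ^ a - e_val h y ^ a) \<le> real CARD('p) ^ h * pnorm (x - y)"
    by (intro pnorm_power_diff_le pnorm_e_val_le_1 x y) (simp add: pnorm_e_val_diff[OF x xy])
  have "pnorm (e_val h y ^ a) \<le> 1"
    using pnorm_e_val_le_1[OF y] by (simp add: pnorm_power power_le_one)
  then show ?case
    unfolding ka(3) E_val_step[OF ka(1,2)] eq
    by (intro pnorm_mult_diff_le pnorm_E_val_le_1 x 1 2)
qed

lemma pnorm_E_val_diff_same_class:
  fixes x y :: "'p::prime_card padic"
  assumes "x \<in> padic_units" "y \<in> padic_units" "n < totient (CARD('p) ^ h)"
    "pnorm (x - y) \<le> 1 / real CARD('p) ^ h"
  shows "pnorm (E_val n x - E_val n y) \<le> 1 / real CARD('p)"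
proof -
  have p: "real CARD('p) > 1" using prime_card_gt_1[where 'p='p] by simp
  have "real CARD('p) ^ h / real CARD('p) * pnorm (x - y)
      \<le> real CARD('p) ^ h / real CARD('p) * (1 / real CARD('p) ^ h)"
    using assms(4) by (intro mult_left_mono) auto
  also have "\<dots> = 1 / real CARD('p)" using p by simp
  finally show ?thesis using pnorm_E_val_diff[OF assms] by linarith
qed

text \<open>Representatives of the unit classes modulo \<open>p ^ Suc h\<close> inside the class of
  \<open>x\<close> modulo \<open>p ^ h\<close>. For \<open>h = 0\<close> these are
  \<open>1, ..., p - 1\<close>, the class of \<open>0\<close> being left out; for
  \<open>h > 0\<close> they are \<open>x + i * p ^ h\<close>, all of them units. As
  \<open>e_h\<close> stretches by \<open>p ^ h\<close>, their images under \<open>e_h\<close> are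
  interpolation nodes with unit differences.\<close>

lemma unit_subclasses:
  fixes x :: "'p::prime_card padic"
  assumes x: "x \<in> padic_units"
  obtains X where "\<And>i. i < digit_count CARD('p) h \<Longrightarrow> X i \<in> padic_units"
    "\<And>i. i < digit_count CARD('p) h \<Longrightarrow> pnorm (X i - x) \<le> 1 / real CARD('p) ^ h"
    "\<And>i j. i < digit_count CARD('p) h \<Longrightarrow> j < digit_count CARD('p) h \<Longrightarrow> i \<noteq> j \<Longrightarrow>
      pnorm (X i - X j) = 1 / real CARD('p) ^ h"
    "\<And>y. y \<in> padic_units \<Longrightarrow> pnorm (y - x) \<le> 1 / real CARD('p) ^ h \<Longrightarrow>
      \<exists>i<digit_count CARD('p) h. pnorm (y - X i) \<le> 1 / real CARD('p) ^ Suc h"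
proof -
  have p: "real CARD('p) > 1" using prime_card_gt_1[where 'p='p] by simp
  have x1: "pnorm x = 1" using x by (rule pnorm_padic_units)
  have small: "pnorm (of_nat i - of_nat j :: 'p padic) = 1"
    if "i < CARD('p)" "j < CARD('p)" "i \<noteq> j" for i j
  proof -
    have "\<not> int CARD('p) dvd int i - int j"
    proof
      assume "int CARD('p) dvd int i - int j"
      then have "int i mod int CARD('p) = int j mod int CARD('p)" by (simp add: mod_eq_dvd_iff)
      then show False using that by simp
    qed
    then show ?thesis using pnorm_of_int_eq_1_iff[of "int i - int j", where 'p='p] by simp
  qed
  show ?thesis
  proof (cases "h = 0")
    case True
    have q: "digit_count CARD('p) h = CARD('p) - 1" using True by (simp add: digit_count_def)
    let ?X = "\<lambda>i. of_nat (Suc i) :: 'p padic"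
    have X: "?X i \<in> padic_units" if "i < CARD('p) - 1" for i
      using small[of "Suc i" 0] that by (auto intro: padic_unitsI)
    have "pnorm (?X i - x) \<le> 1" if "i < CARD('p) - 1" for i
      using pnorm_diff_le[of "?X i" x] pnorm_padic_units[OF X[OF that]] x1 by (simp del: of_nat_Suc)
    moreover have "pnorm (?X i - ?X j) = 1" if "i < CARD('p) - 1" "j < CARD('p) - 1" "i \<noteq> j" for i j
      using small[of "Suc i" "Suc j"] that by (simp del: of_nat_Suc)
    moreover have "\<exists>i<CARD('p) - 1. pnorm (y - ?X i) \<le> 1 / real CARD('p) ^ 1" if y: "y \<in> padic_units" for y
    proof -
      obtain n where n: "n < CARD('p) ^ 1" "pnorm (y - of_nat n) \<le> 1 / real CARD('p) ^ 1"
        using approx_by_nat[of y 1] pnorm_padic_units[OF y] by auto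
      have "n \<noteq> 0"
      proof
        assume "n = 0"
        then show False using n pnorm_padic_units[OF y] p by simp
      qed
      then show ?thesis using n by (intro exI[of _ "n - 1"]) (auto simp del: of_nat_Suc)
    qed
    ultimately show ?thesis
      using X True by (intro that[of ?X, unfolded q]) (simp_all del: of_nat_Suc)
  next
    case False
    then have q: "digit_count CARD('p) h = CARD('p)" by (simp add: digit_count_def)
    let ?P = "of_nat CARD('p) ^ h :: 'p padic"
    let ?X = "\<lambda>i. x + of_nat i * ?P :: 'p padic"
    have P: "pnorm ?P = 1 / real CARD('p) ^ h" by (simp add: pnorm_power pnorm_card power_divide)
    have P0: "?P \<noteq> 0" using P p by (metis pnorm_zero divide_eq_0_iff power_not_zero not_one_less_zero zero_neq_one)
    have X: "pnorm (?X i - x) \<le> 1 / real CARD('p) ^ h" for i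
      using pnorm_of_int_le_1[of "int i", where 'p='p] p by (simp add: pnorm_mult P divide_right_mono)
    have X1: "?X i \<in> padic_units" for i
    proof (rule padic_unitsI)
      have "1 / real CARD('p) ^ h < 1" using p False by simp
      then have "pnorm (x - ?X i) < pnorm x" using X[of i] x1 pnorm_diff_commute[of x "?X i"] by simp
      from pnorm_eq_of_diff_less[OF this] show "pnorm (?X i) = 1" using x1 by simp
    qed
    have "pnorm (?X i - ?X j) = 1 / real CARD('p) ^ h" if "i < CARD('p)" "j < CARD('p)" "i \<noteq> j" for i j
    proof -
      have "?X i - ?X j = (of_nat i - of_nat j) * ?P" by (simp add: algebra_simps)
      then show ?thesis using small[OF that] by (simp add: pnorm_mult P)
    qed
    moreover have "\<exists>i<CARD('p). pnorm (y - ?X i) \<le> 1 / real CARD('p) ^ Suc h"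
      if y: "pnorm (y - x) \<le> 1 / real CARD('p) ^ h" for y
    proof -
      have "pnorm ((y - x) / ?P) \<le> 1" using y p by (simp add: pnorm_divide P field_simps)
      then obtain i where i: "i < CARD('p) ^ 1" "pnorm ((y - x) / ?P - of_nat i) \<le> 1 / real CARD('p) ^ 1"
        using approx_by_nat by blast
      have "y - ?X i = ((y - x) / ?P - of_nat i) * ?P" using P0 by (simp add: field_simps)
      then have "pnorm (y - ?X i) = pnorm ((y - x) / ?P - of_nat i) * (1 / real CARD('p) ^ h)"
        by (simp only: pnorm_mult P)
      also have "\<dots> \<le> 1 / real CARD('p) ^ 1 * (1 / real CARD('p) ^ h)"
        using i by (intro mult_right_mono) auto
      finally show ?thesis using i by auto
    qed
    ultimately show ?thesis
      using X X1 by (intro that[of ?X, unfolded q]) blast+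
  qed
qed

section \<open>Coefficients bounded by values\<close>

lemma sum_lessThan_add:
  "(\<Sum>n<m + N. g n) = (\<Sum>n<m. g n) + (\<Sum>k<N. g (k + m))" for g :: "nat \<Rightarrow> 'a::comm_monoid_add"
  by (induction N) (simp_all add: algebra_simps)

lemma sum_lessThan_mult:
  "(\<Sum>n<q * N. g n) = (\<Sum>a<q. \<Sum>k<N. g (k + a * N))" for g :: "nat \<Rightarrow> 'a::comm_monoid_add"
  by (induction q) (simp_all add: sum_lessThan_add[of g _ N, unfolded add.commute[of _ N]])

text \<open>Grouping by the top digit turns a combination at level \<open>Suc h\<close> into a
  polynomial in \<open>e_h\<close> whose coefficients are combinations at level \<open>h\<close>;
  both inductions on the level run through this form.\<close>

lemma E_val_sum_Suc:
  fixes x :: "'p::prime_card padic"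
  defines "N \<equiv> \<lambda>h. totient (CARD('p) ^ h)"
  shows "(\<Sum>n<N (Suc h). c n * E_val n x)
    = (\<Sum>a<digit_count CARD('p) h. (\<Sum>k<N h. c (k + a * N h) * E_val k x) * e_val h x ^ a)"
proof -
  have "(\<Sum>n<N (Suc h). c n * E_val n x)
      = (\<Sum>a<digit_count CARD('p) h. \<Sum>k<N h. c (k + a * N h) * E_val (k + a * N h) x)"
    unfolding N_def totient_Suc_power[OF prime_card[where 'a='p]] by (rule sum_lessThan_mult)
  also have "\<dots> = (\<Sum>a<digit_count CARD('p) h. (\<Sum>k<N h. c (k + a * N h) * E_val k x) * e_val h x ^ a)"
    by (intro sum.cong refl) (auto simp: N_def E_val_step sum_distrib_right mult.assoc)
  finally show ?thesis .
qed

lemma digit_count_pos: "digit_count CARD('p::prime_card) h > 0"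
  using prime_card_gt_1[where 'p='p] by (simp add: digit_count_def)

text \<open>On one class modulo \<open>p ^ h\<close> the inner sums \<open>b a\<close> are constant
  up to \<open>M / p \<le> r\<close>. There the given sum is, up to \<open>r\<close>, a polynomial
  in \<open>e_h\<close> with constant coefficients; its values at the subclass nodes are bounded by
  \<open>r\<close>, hence so are its coefficients \<open>b a x\<close>. The induction hypothesis
  then applies to each \<open>b a\<close>.\<close>

lemma E_val_coeff_bound_level:
  fixes c :: "nat \<Rightarrow> 'p::prime_card padic"
  assumes "\<And>k. k < totient (CARD('p) ^ h) \<Longrightarrow> pnorm (c k) \<le> M" "M / real CARD('p) \<le> r"
    and "\<And>x. x \<in> padic_units \<Longrightarrow> pnorm (\<Sum>k<totient (CARD('p) ^ h). c k * E_val k x) \<le> r"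
    and "k < totient (CARD('p) ^ h)"
  shows "pnorm (c k) \<le> r"
  using assms
proof (induction h arbitrary: c k)
  case 0
  then show ?case using padic_unitsI[of "1 :: 'p padic"] 0(3)[of 1] by (simp add: E_val_0)
next
  case (Suc h)
  let ?N = "totient (CARD('p) ^ h)" and ?q = "digit_count CARD('p) h"
  have p: "real CARD('p) > 1" using prime_card_gt_1[where 'p='p] by simp
  have M: "M \<ge> 0" using Suc.prems(1)[OF Suc.prems(4)] pnorm_nonneg[of "c k"] by linarith
  have r: "r \<ge> 0" using Suc.prems(2) M p order_trans[of 0 "M / real CARD('p)" r] by simp
  have less: "k + a * ?N < totient (CARD('p) ^ Suc h)" if "k < ?N" "a < ?q" for k a
  proof -
    have "k + a * ?N < Suc a * ?N" using that by simp
    also have "\<dots> \<le> ?q * ?N" using that by (intro mult_le_mono1) auto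
    finally show ?thesis by (simp only: totient_Suc_power[OF prime_card[where 'a='p]])
  qed
  define b where "b a x = (\<Sum>k<?N. c (k + a * ?N) * E_val k x)" for a x
  have b: "pnorm (b a x) \<le> r" if a: "a < ?q" and x: "x \<in> padic_units" for a x
  proof -
    obtain X where X: "\<And>i. i < ?q \<Longrightarrow> X i \<in> padic_units"
      "\<And>i. i < ?q \<Longrightarrow> pnorm (X i - x) \<le> 1 / real CARD('p) ^ h"
      "\<And>i j. i < ?q \<Longrightarrow> j < ?q \<Longrightarrow> i \<noteq> j \<Longrightarrow> pnorm (X i - X j) = 1 / real CARD('p) ^ h"
      by (rule unit_subclasses[OF x, of h]) blast
    have q: "i \<le> ?q - 1 \<longleftrightarrow> i < ?q" for i using digit_count_pos[of h, where 'p='p] by linarith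
    \<comment> \<open>Freezing the inner sums at \<open>x\<close> produces a genuine polynomial,
      with as many coefficients as the class of \<open>x\<close> has subclasses.\<close>
    define Q where "Q = (\<Sum>a<?q. monom (b a x) a)"
    have coeffQ: "coeff Q n = (if n < ?q then b n x else 0)" for n
      by (simp add: Q_def coeff_sum sum.delta)
    have polyQ: "poly Q y = (\<Sum>a<?q. b a x * y ^ a)" for y
      by (simp add: Q_def poly_sum poly_monom)
    have "pnorm (coeff Q a) \<le> r"
    proof (rule poly_coeff_bound[of Q "?q - 1" "\<lambda>i. e_val h (X i)"])
      show "degree Q \<le> ?q - 1"
      proof (rule degree_le, intro allI impI)
        fix i assume "?q - 1 < i"
        then have "\<not> i < ?q" by linarith
        then show "coeff Q i = 0" by (simp add: coeffQ)
      qed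
      show "pnorm (e_val h (X i)) \<le> 1" if "i \<le> ?q - 1" for i
        using X(1)[OF that[unfolded q]] by (rule pnorm_e_val_le_1)
      show "pnorm (e_val h (X i) - e_val h (X j)) = 1" if "i \<le> ?q - 1" "j \<le> ?q - 1" "i \<noteq> j" for i j
        using that[unfolded q] X(1)[of i] X(3)[of i j] p by (simp add: pnorm_e_val_diff)
      show "pnorm (poly Q (e_val h (X i))) \<le> r" if "i \<le> ?q - 1" for i
      proof (rule pnorm_le_of_diff)
        have i: "i < ?q" using that[unfolded q] .
        \<comment> \<open>This is where the slack enters: \<open>x\<close> and \<open>X i\<close>
          lie in one class modulo \<open>p ^ h\<close>, so each \<open>E_val k\<close> with
          \<open>k < ?N\<close> differs there by at most \<open>1 / p\<close>.\<close>
        have bd: "pnorm (b a x - b a (X i)) \<le> r" if a: "a < ?q" for a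
        proof -
          have "pnorm (c (k + a * ?N) * (E_val k x - E_val k (X i))) \<le> M * (1 / real CARD('p))"
            if k: "k < ?N" for k
            unfolding pnorm_mult
            using X(2)[OF i] M Suc.prems(1)[OF less[OF k a]]
            by (intro mult_mono pnorm_E_val_diff_same_class[OF x X(1)[OF i] k])
              (simp_all add: pnorm_diff_commute[of x])
          then have "pnorm (\<Sum>k<?N. c (k + a * ?N) * (E_val k x - E_val k (X i))) \<le> M * (1 / real CARD('p))"
            using M by (intro pnorm_sum_le) auto
          also have "(\<Sum>k<?N. c (k + a * ?N) * (E_val k x - E_val k (X i))) = b a x - b a (X i)"
            by (simp add: b_def right_diff_distrib sum_subtractf)
          finally show ?thesis using Suc.prems(2) by simp
        qed
        have "pnorm ((b a x - b a (X i)) * e_val h (X i) ^ a) \<le> r * 1" if "a < ?q" for a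
          unfolding pnorm_mult pnorm_power
          using bd[OF that] r pnorm_e_val_le_1[OF X(1)[OF i]]
          by (intro mult_mono power_le_one) auto
        then have "pnorm (\<Sum>a<?q. (b a x - b a (X i)) * e_val h (X i) ^ a) \<le> r"
          using r by (intro pnorm_sum_le) auto
        then show "pnorm (poly Q (e_val h (X i)) - (\<Sum>a<?q. b a (X i) * e_val h (X i) ^ a)) \<le> r"
          by (simp add: polyQ left_diff_distrib sum_subtractf)
        show "pnorm (\<Sum>a<?q. b a (X i) * e_val h (X i) ^ a) \<le> r"
          using Suc.prems(3)[OF X(1)[OF i]] unfolding E_val_sum_Suc b_def .
      qed
    qed
    then show ?thesis using a by (simp add: coeffQ)
  qed
  obtain k' a where ka: "k' < ?N" "a < ?q" "k = k' + a * ?N"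
    using less_totient_Suc_power[OF prime_card Suc.prems(4)] by blast
  have "pnorm (c (k' + a * ?N)) \<le> r"
  proof (rule Suc.IH[of "\<lambda>k. c (k + a * ?N)"])
    show "pnorm (c (k + a * ?N)) \<le> M" if "k < ?N" for k
      using Suc.prems(1)[OF less[OF that ka(2)]] .
    show "pnorm (\<Sum>k<?N. c (k + a * ?N) * E_val k x) \<le> r" if "x \<in> padic_units" for x
      using b[OF ka(2) that] unfolding b_def .
  qed (use ka(1) Suc.prems(2) in auto)
  then show ?case using ka by simp
qed

lemma sum_lessThan_pad:
  fixes v :: "nat \<Rightarrow> 'a::semiring_0"
  assumes "N \<le> N'"
  shows "(\<Sum>k<N'. (if k < N then c k else 0) * v k) = (\<Sum>k<N. c k * v k)"
  by (rule sum.mono_neutral_cong_right) (use assms in auto)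

text \<open>With \<open>M\<close> the largest coefficient norm, the bound at a finite level gives
  \<open>M \<le> max r (M / p)\<close>. Since \<open>M / p < M\<close> unless \<open>M = 0\<close>,
  this forces \<open>M \<le> r\<close>.\<close>

lemma E_val_coeff_bound:
  fixes c :: "nat \<Rightarrow> 'p::prime_card padic"
  assumes sum: "\<And>x. x \<in> padic_units \<Longrightarrow> pnorm (\<Sum>k<N. c k * E_val k x) \<le> r" and k: "k < N"
  shows "pnorm (c k) \<le> r"
proof -
  have p: "real CARD('p) > 1" using prime_card_gt_1[where 'p='p] by simp
  define c' where "c' k = (if k < N then c k else 0)" for k
  \<comment> \<open>The level \<open>Suc N\<close> is large enough that \<open>N \<le> n\<close>, so
    padding the coefficients by zeros completes the sum to a full level.\<close>
  define n where "n = totient (CARD('p) ^ Suc N)"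
  have n: "N \<le> n" unfolding n_def by (rule le_totient_power[OF prime_card])
  define M where "M = Max ((\<lambda>k. pnorm (c' k)) ` {..<n})"
  have c'M: "pnorm (c' k) \<le> M" if "k < n" for k
    unfolding M_def by (rule Max_ge) (use that in auto)
  have M0: "M \<ge> 0" using c'M[of k] k n pnorm_nonneg[of "c' k"] by linarith
  have r0: "r \<ge> 0"
    using sum[OF padic_unitsI[OF pnorm_one]] order_trans[OF pnorm_nonneg] by blast
  have le: "pnorm (c' k) \<le> max r (M / real CARD('p))" if "k < n" for k
  proof (rule E_val_coeff_bound_level[of "Suc N" c' M])
    show "pnorm (\<Sum>k<totient (CARD('p) ^ Suc N). c' k * E_val k x) \<le> max r (M / real CARD('p))"
      if "x \<in> padic_units" for x
      using sum[OF that] n unfolding c'_def n_def[symmetric]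
      by (simp add: sum_lessThan_pad le_max_iff_disj)
  qed (use c'M that in \<open>auto simp: n_def\<close>)
  have "M \<in> (\<lambda>k. pnorm (c' k)) ` {..<n}"
    unfolding M_def by (rule Max_in) (use k n in \<open>auto simp: lessThan_empty_iff\<close>)
  then have "M \<le> max r (M / real CARD('p))" using le by auto
  moreover have "M / real CARD('p) < M" if "M > 0" using that p by (simp add: divide_less_eq)
  ultimately have "M \<le> r" using M0 r0 by (cases "M = 0") (auto simp: max_def split: if_splits)
  then show ?thesis using c'M[of k] k n by (auto simp: c'_def)
qed

section \<open>Approximation at a finite level\<close>

text \<open>On each class modulo \<open>p ^ h\<close>, \<open>f\<close> is interpolated at subclass
  representatives by a polynomial in \<open>e_h\<close> with coefficients bounded by
  \<open>M\<close>. The coefficients are functions of the class modulo \<open>p ^ h\<close>, so the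
  induction hypothesis approximates each of them by a combination at level \<open>h\<close>. No
  error exceeds \<open>M / p\<close>, and by the ultrametric inequality the errors do not add
  up.\<close>

lemma E_val_approx_level:
  fixes f :: "'p::prime_card padic \<Rightarrow> 'p padic"
  assumes "\<And>x. x \<in> padic_units \<Longrightarrow> pnorm (f x) \<le> M"
    and "\<And>x y. x \<in> padic_units \<Longrightarrow> y \<in> padic_units \<Longrightarrow> pnorm (x - y) \<le> 1 / real CARD('p) ^ h
      \<Longrightarrow> pnorm (f x - f y) \<le> M / real CARD('p)"
  shows "\<exists>c. \<forall>x\<in>padic_units. pnorm (f x - (\<Sum>k<totient (CARD('p) ^ h). c k * E_val k x)) \<le> M / real CARD('p)"
  using assms
proof (induction h arbitrary: f)
  case 0
  have "pnorm (f x - f 1) \<le> M / real CARD('p)" if "x \<in> padic_units" for x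
    using that pnorm_diff_le[of x 1] by (intro 0 padic_unitsI) (auto simp: pnorm_padic_units)
  then show ?case by (intro exI[of _ "\<lambda>_. f 1"]) (simp add: E_val_0)
next
  case (Suc h)
  let ?N = "totient (CARD('p) ^ h)" and ?q = "digit_count CARD('p) h"
  let ?R = "1 / real CARD('p) ^ h"
  have p: "real CARD('p) > 1" using prime_card_gt_1[where 'p='p] by simp
  have M: "M \<ge> 0"
    using order_trans[OF pnorm_nonneg Suc.prems(1)[OF padic_unitsI[OF pnorm_one]]] .
  have q: "i \<le> ?q - 1 \<longleftrightarrow> i < ?q" for i using digit_count_pos[of h, where 'p='p] by linarith
  have "\<forall>z\<in>padic_units. \<exists>Q. degree Q \<le> ?q - 1 \<and> (\<forall>n. pnorm (coeff Q n) \<le> M) \<and>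
      (\<forall>y\<in>padic_units. pnorm (y - z) \<le> ?R \<longrightarrow> pnorm (f y - poly Q (e_val h y)) \<le> M / real CARD('p))"
  proof
    fix z :: "'p padic" assume z: "z \<in> padic_units"
    obtain X where X: "\<And>i. i < ?q \<Longrightarrow> X i \<in> padic_units"
      "\<And>i. i < ?q \<Longrightarrow> pnorm (X i - z) \<le> ?R"
      "\<And>i j. i < ?q \<Longrightarrow> j < ?q \<Longrightarrow> i \<noteq> j \<Longrightarrow> pnorm (X i - X j) = ?R"
      and cover: "\<And>y. y \<in> padic_units \<Longrightarrow> pnorm (y - z) \<le> ?R \<Longrightarrow>
        \<exists>i<?q. pnorm (y - X i) \<le> 1 / real CARD('p) ^ Suc h"
      by (rule unit_subclasses[OF z, of h]) blast
    have "\<exists>Q. degree Q \<le> ?q - 1 \<and> (\<forall>n. pnorm (coeff Q n) \<le> M) \<and>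
        (\<forall>i\<le>?q - 1. poly Q (e_val h (X i)) = f (X i))"
    proof (rule poly_interpolation_bound)
      show "pnorm (e_val h (X i)) \<le> 1" if "i \<le> ?q - 1" for i
        using X(1)[OF that[unfolded q]] by (rule pnorm_e_val_le_1)
      show "pnorm (e_val h (X i) - e_val h (X j)) = 1" if "i \<le> ?q - 1" "j \<le> ?q - 1" "i \<noteq> j" for i j
        using that[unfolded q] X(1)[of i] X(3)[of i j] p by (simp add: pnorm_e_val_diff)
      show "pnorm (f (X i)) \<le> M" if "i \<le> ?q - 1" for i
        using Suc.prems(1)[OF X(1)[OF that[unfolded q]]] .
    qed
    then obtain Q where Q: "degree Q \<le> ?q - 1" "\<And>n. pnorm (coeff Q n) \<le> M"
      "\<And>i. i < ?q \<Longrightarrow> poly Q (e_val h (X i)) = f (X i)" unfolding q by blast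
    have "pnorm (f y - poly Q (e_val h y)) \<le> M / real CARD('p)"
      if y: "y \<in> padic_units" "pnorm (y - z) \<le> ?R" for y
    proof -
      \<comment> \<open>Between \<open>y\<close> and the representative of its subclass,
        \<open>f\<close> varies by at most \<open>M / p\<close> by hypothesis, and
        \<open>e_h\<close> by at most \<open>p ^ h / p ^ Suc h = 1 / p\<close>. Exact interpolation
        at \<open>X i\<close> thus becomes approximation at \<open>y\<close>.\<close>
      obtain i where i: "i < ?q" "pnorm (y - X i) \<le> 1 / real CARD('p) ^ Suc h"
        using cover[OF y] by blast
      have "1 / real CARD('p) ^ Suc h \<le> ?R"
        using p by (intro divide_left_mono power_increasing) auto
      then have "pnorm (y - X i) \<le> ?R" using i(2) by linarith
      then have "pnorm (e_val h y - e_val h (X i)) = real CARD('p) ^ h * pnorm (y - X i)"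
        by (rule pnorm_e_val_diff[OF y(1)])
      also have "\<dots> \<le> real CARD('p) ^ h * (1 / real CARD('p) ^ Suc h)"
        using i(2) by (intro mult_left_mono) auto
      also have "\<dots> = 1 / real CARD('p)" using p by simp
      finally have e: "pnorm (e_val h y ^ a - e_val h (X i) ^ a) \<le> 1 / real CARD('p)" for a
        by (intro pnorm_power_diff_le pnorm_e_val_le_1 y X i)
      have "pnorm (coeff Q a * (e_val h y ^ a - e_val h (X i) ^ a)) \<le> M * (1 / real CARD('p))" for a
        unfolding pnorm_mult using Q(2) e M by (intro mult_mono) auto
      then have "pnorm (\<Sum>a\<le>?q - 1. coeff Q a * (e_val h y ^ a - e_val h (X i) ^ a)) \<le> M / real CARD('p)"
        using M by (intro pnorm_sum_le) auto
      also have "(\<Sum>a\<le>?q - 1. coeff Q a * (e_val h y ^ a - e_val h (X i) ^ a))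
          = poly Q (e_val h y) - f (X i)"
        unfolding Q(3)[OF i(1), symmetric] poly_eq_sum_atMost[OF Q(1)]
        by (simp only: right_diff_distrib sum_subtractf)
      finally have "pnorm (f (X i) - poly Q (e_val h y)) \<le> M / real CARD('p)"
        by (simp add: pnorm_diff_commute)
      moreover have "pnorm (f y - f (X i)) \<le> M / real CARD('p)"
        by (rule Suc.prems(2)[OF y(1) X(1)[OF i(1)] i(2)])
      ultimately show ?thesis by (rule pnorm_diff_trans[rotated])
    qed
    then show "\<exists>Q. degree Q \<le> ?q - 1 \<and> (\<forall>n. pnorm (coeff Q n) \<le> M) \<and>
      (\<forall>y\<in>padic_units. pnorm (y - z) \<le> ?R \<longrightarrow> pnorm (f y - poly Q (e_val h y)) \<le> M / real CARD('p))"
      using Q(1,2) by blast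
  qed
  then obtain Q where Q: "\<And>z. z \<in> padic_units \<Longrightarrow> degree (Q z) \<le> ?q - 1"
      "\<And>z n. z \<in> padic_units \<Longrightarrow> pnorm (coeff (Q z) n) \<le> M"
      "\<And>z y. z \<in> padic_units \<Longrightarrow> y \<in> padic_units \<Longrightarrow> pnorm (y - z) \<le> ?R \<Longrightarrow>
        pnorm (f y - poly (Q z) (e_val h y)) \<le> M / real CARD('p)"
    by metis
  \<comment> \<open>The chosen predicate depends only on the class of \<open>x\<close>, hence so
    does the choice. This makes the coefficients of \<open>Q (\<rho> x)\<close> exactly constant on
    classes modulo \<open>p ^ h\<close>, as the induction hypothesis requires.\<close>
  define \<rho> where "\<rho> x = (SOME z. z \<in> padic_units \<and> pnorm (z - x) \<le> ?R)" for x :: "'p padic"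
  have \<rho>: "\<rho> x \<in> padic_units \<and> pnorm (\<rho> x - x) \<le> ?R" if "x \<in> padic_units" for x
    unfolding \<rho>_def by (rule someI[of _ x]) (use that in simp)
  have \<rho>_cong: "\<rho> x = \<rho> y" if "pnorm (x - y) \<le> ?R" for x y
  proof -
    have "pnorm (z - x) \<le> ?R \<longleftrightarrow> pnorm (z - y) \<le> ?R" for z
      using pnorm_diff_trans[of z x ?R y] pnorm_diff_trans[of z y ?R x] that
      by (auto simp: pnorm_diff_commute)
    then show ?thesis by (simp add: \<rho>_def)
  qed
  have "\<exists>c. \<forall>x\<in>padic_units. pnorm (coeff (Q (\<rho> x)) a - (\<Sum>k<?N. c k * E_val k x)) \<le> M / real CARD('p)" for a
  proof (rule Suc.IH)
    show "pnorm (coeff (Q (\<rho> x)) a) \<le> M" if "x \<in> padic_units" for x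
      using Q(2) \<rho>[OF that] by blast
    show "pnorm (coeff (Q (\<rho> x)) a - coeff (Q (\<rho> y)) a) \<le> M / real CARD('p)"
      if "pnorm (x - y) \<le> ?R" for x y
      using M by (simp add: \<rho>_cong[OF that])
  qed
  then obtain C where C: "\<And>a x. x \<in> padic_units \<Longrightarrow>
      pnorm (coeff (Q (\<rho> x)) a - (\<Sum>k<?N. C a k * E_val k x)) \<le> M / real CARD('p)"
    by metis
  define c where "c n = C (n div ?N) (n mod ?N)" for n
  have "pnorm (f x - (\<Sum>n<totient (CARD('p) ^ Suc h). c n * E_val n x)) \<le> M / real CARD('p)"
    if x: "x \<in> padic_units" for x
  proof (rule pnorm_diff_trans)
    show "pnorm (f x - poly (Q (\<rho> x)) (e_val h x)) \<le> M / real CARD('p)"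
      using \<rho>[OF x] by (intro Q(3) x) (auto simp: pnorm_diff_commute)
    have cC: "c (k + a * ?N) = C a k" if "k < ?N" for a k
    proof -
      have "?N \<noteq> 0" using that by linarith
      then have "(k + a * ?N) div ?N = a + k div ?N" by (rule div_mult_self1)
      then show ?thesis using that by (simp add: c_def)
    qed
    have inner: "(\<Sum>k<?N. c (k + a * ?N) * E_val k x) = (\<Sum>k<?N. C a k * E_val k x)" for a
      by (intro sum.cong) (auto simp: cC)
    have "{..?q - 1} = {..<?q}" using q by auto
    then have eq: "poly (Q (\<rho> x)) (e_val h x) - (\<Sum>n<totient (CARD('p) ^ Suc h). c n * E_val n x)
        = (\<Sum>a<?q. (coeff (Q (\<rho> x)) a - (\<Sum>k<?N. C a k * E_val k x)) * e_val h x ^ a)"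
      using \<rho>[OF x] unfolding E_val_sum_Suc
      by (simp add: poly_eq_sum_atMost[OF Q(1)] left_diff_distrib sum_subtractf inner)
    have "pnorm ((coeff (Q (\<rho> x)) a - (\<Sum>k<?N. C a k * E_val k x)) * e_val h x ^ a)
        \<le> M / real CARD('p) * 1" for a
      unfolding pnorm_mult pnorm_power
      using C[OF x] M pnorm_e_val_le_1[OF x] by (intro mult_mono power_le_one) auto
    then show "pnorm (poly (Q (\<rho> x)) (e_val h x) - (\<Sum>n<totient (CARD('p) ^ Suc h). c n * E_val n x))
        \<le> M / real CARD('p)"
      unfolding eq using M by (intro pnorm_sum_le) auto
  qed
  then show ?case by blast
qed

section \<open>A criterion for orthonormal bases\<close>

lemma sum_fun_scale_apply:
  fixes N :: nat
  shows "(\<Sum>k<N. fun_scale (c k) (v k)) x = (\<Sum>k<N. c k * v k x)"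
  by (induction N) (simp_all add: fun_scale_def)

lemma pnorm_le_sup_norm:
  fixes f :: "'a \<Rightarrow> 'p::prime_card padic"
  assumes "\<And>x. pnorm (f x) \<le> M"
  shows "pnorm (f x) \<le> sup_norm f"
  unfolding sup_norm_def by (rule cSUP_upper) (use assms in \<open>auto intro: bdd_aboveI2[where M = M]\<close>)

lemma sup_norm_le:
  fixes f :: "'a \<Rightarrow> 'p::prime_card padic"
  assumes "\<And>x. pnorm (f x) \<le> M"
  shows "sup_norm f \<le> M"
  unfolding sup_norm_def by (rule cSUP_least) (use assms in auto)

text \<open>Applied to differences of approximants, \<open>coeff_bound\<close> makes their
  coefficients Cauchy uniformly in the index, and the limits form an expansion. Applied to the
  difference of two expansions it gives uniqueness, and applied to partial sums it bounds each
  coefficient by the norm. The norm is attained because only finitely many coefficients matter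
  beyond a small remainder.\<close>

lemma orthonormal_basis_criterion:
  fixes v :: "nat \<Rightarrow> 'a \<Rightarrow> 'p::prime_card padic"
  assumes v: "\<And>k. v k \<in> E" "\<And>k x. pnorm (v k x) \<le> 1"
    and bounded: "\<And>f. f \<in> E \<Longrightarrow> \<exists>M. \<forall>x. pnorm (f x) \<le> M"
    and coeff_bound: "\<And>c N r k. (\<And>x. pnorm (\<Sum>k<N. c k * v k x) \<le> r) \<Longrightarrow> k < N \<Longrightarrow> pnorm (c k) \<le> r"
    and dense: "\<And>f \<epsilon>. f \<in> E \<Longrightarrow> \<epsilon> > 0 \<Longrightarrow> \<exists>N c. \<forall>x. pnorm (f x - (\<Sum>k<N. c k * v k x)) \<le> \<epsilon>"
  shows "orthonormal_basis E fun_scale sup_norm v"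
  unfolding orthonormal_basis_def
proof (intro conjI ballI allI)
  fix f assume f: "f \<in> E"
  define D where "D c N = sup_norm (f - (\<Sum>k<N. fun_scale (c k) (v k)))" for c N
  obtain M where M: "\<And>x. pnorm (f x) \<le> M" using bounded[OF f] by blast
  have term_le: "pnorm (a * v k x) \<le> pnorm a" for a k x
    using mult_left_mono[OF v(2)[of k x], of "pnorm a"] by (simp add: pnorm_mult)
  have sum_le: "pnorm (\<Sum>k<N. c k * v k x) \<le> r" if "r \<ge> 0" "\<And>k. k < N \<Longrightarrow> pnorm (c k) \<le> r" for c N x r
    by (rule pnorm_sum_le) (use that term_le order_trans in blast)+
  have D_le: "D c N \<le> r" if "\<And>x. pnorm (f x - (\<Sum>k<N. c k * v k x)) \<le> r" for c N r
    unfolding D_def by (rule sup_norm_le) (use that in \<open>simp add: sum_fun_scale_apply\<close>)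
  have le_D: "pnorm (f x - (\<Sum>k<N. c k * v k x)) \<le> D c N" for c N x
  proof -
    \<comment> \<open>The real supremum dominates the values only when they are bounded, so a crude
      bound for the remainder is supplied first.\<close>
    have "pnorm ((f - (\<Sum>k<N. fun_scale (c k) (v k))) x) \<le> D c N"
      unfolding D_def
    proof (rule pnorm_le_sup_norm)
      fix x
      have "pnorm (\<Sum>k<N. c k * v k x) \<le> (\<Sum>k<N. pnorm (c k))"
        by (rule sum_le) (auto intro: sum_nonneg member_le_sum)
      then show "pnorm ((f - (\<Sum>k<N. fun_scale (c k) (v k))) x) \<le> max M (\<Sum>k<N. pnorm (c k))"
        using pnorm_diff_le[of "f x" "\<Sum>k<N. c k * v k x"] M[of x]
        by (simp add: sum_fun_scale_apply)
    qed
    then show ?thesis by (simp add: sum_fun_scale_apply)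
  qed
  have expansion_iff: "is_expansion fun_scale sup_norm v f c \<longleftrightarrow>
      (\<lambda>k. pnorm (c k)) \<longlonglongrightarrow> 0 \<and> D c \<longlonglongrightarrow> 0" for c
    by (simp add: is_expansion_def D_def[abs_def])
  have ex: "\<exists>c. is_expansion fun_scale sup_norm v f c"
  proof -
    have "\<forall>n. \<exists>N c. \<forall>x. pnorm (f x - (\<Sum>k<N. c k * v k x)) \<le> 1 / real (Suc n)"
      using dense[OF f] by simp
    then obtain N s0 where s0: "\<And>n x. pnorm (f x - (\<Sum>k<N n. s0 n k * v k x)) \<le> 1 / real (Suc n)"
      by metis
    \<comment> \<open>Padding by zeros puts all approximants on a common index set. It also forces
      \<open>pnorm (c k) \<le> 1 / real (Suc n)\<close> for \<open>k \<ge> N n\<close> in the limit,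
      which is why the coefficients tend to \<open>0\<close>.\<close>
    define s where "s n k = (if k < N n then s0 n k else 0)" for n k
    have s: "pnorm (f x - (\<Sum>k<K. s n k * v k x)) \<le> 1 / real (Suc n)" if "K \<ge> N n" for n K x
      using s0[of x n] sum_lessThan_pad[OF that, of "s0 n" "\<lambda>k. v k x"] by (simp add: s_def)
    have diff: "pnorm (s n k - s m k) \<le> 1 / real (Suc n)" if "n \<le> m" for n m k
    proof (rule coeff_bound[where N = "max (Suc k) (max (N n) (N m))" and c = "\<lambda>k. s n k - s m k"])
      fix x
      let ?K = "max (Suc k) (max (N n) (N m))"
      have K: "N n \<le> ?K" "N m \<le> ?K" by (simp_all add: le_max_iff_disj)
      have "1 / real (Suc m) \<le> 1 / real (Suc n)" using that by (intro divide_left_mono) auto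
      then have "pnorm (f x - (\<Sum>k<?K. s m k * v k x)) \<le> 1 / real (Suc n)"
        using s[OF K(2), of x] by linarith
      moreover have "pnorm ((\<Sum>k<?K. s n k * v k x) - f x) \<le> 1 / real (Suc n)"
        using s[OF K(1), of x] by (simp only: pnorm_diff_commute[of "f x"])
      ultimately have "pnorm ((\<Sum>k<?K. s n k * v k x) - (\<Sum>k<?K. s m k * v k x)) \<le> 1 / real (Suc n)"
        by (rule pnorm_diff_trans[rotated])
      then show "pnorm (\<Sum>k<?K. (s n k - s m k) * v k x) \<le> 1 / real (Suc n)"
        by (simp add: left_diff_distrib sum_subtractf)
    qed simp
    have "Cauchy (\<lambda>n. s n k)" for k
    proof (rule metric_CauchyI)
      fix e :: real assume "e > 0"
      then obtain n where n: "1 / real (Suc n) < e" using nat_approx_posE by blast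
      have "dist (s m k) (s m' k) < e" if "m \<ge> n" "m' \<ge> n" for m m'
        using pnorm_diff_trans[of "s m k" "s n k" "1 / real (Suc n)" "s m' k"]
          diff[OF that(1)] diff[OF that(2)] n
        by (simp add: dist_padic_def pnorm_diff_commute[of "s m k"])
      then show "\<exists>n. \<forall>m\<ge>n. \<forall>m'\<ge>n. dist (s m k) (s m' k) < e" by blast
    qed
    then have "\<forall>k. \<exists>l. (\<lambda>n. s n k) \<longlonglongrightarrow> l" by (metis Cauchy_convergent convergent_def)
    then obtain c where c: "\<And>k. (\<lambda>n. s n k) \<longlonglongrightarrow> c k" by metis
    have sc: "pnorm (s n k - c k) \<le> 1 / real (Suc n)" for n k
    proof -
      have "(\<lambda>m. dist (s n k) (s m k)) \<longlonglongrightarrow> dist (s n k) (c k)"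
        by (intro tendsto_intros c)
      then have "dist (s n k) (c k) \<le> 1 / real (Suc n)"
        by (rule LIMSEQ_le_const2) (use diff in \<open>auto simp: dist_padic_def intro!: exI[of _ n]\<close>)
      then show ?thesis by (simp add: dist_padic_def)
    qed
    have "(\<lambda>k. pnorm (c k)) \<longlonglongrightarrow> 0"
    proof (rule metric_LIMSEQ_I)
      fix e :: real assume "e > 0"
      then obtain n where n: "1 / real (Suc n) < e" using nat_approx_posE by blast
      have "pnorm (c k) < e" if "k \<ge> N n" for k
        using sc[of n k] that n by (simp add: s_def)
      then show "\<exists>n. \<forall>k\<ge>n. dist (pnorm (c k)) 0 < e" by (auto simp: dist_real_def)
    qed
    moreover have "D c \<longlonglongrightarrow> 0"
    proof (rule metric_LIMSEQ_I)
      fix e :: real assume "e > 0"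
      then obtain n where n: "1 / real (Suc n) < e" using nat_approx_posE by blast
      have "\<bar>D c K\<bar> < e" if K: "K \<ge> N n" for K
      proof -
        have "pnorm (f x - (\<Sum>k<K. c k * v k x)) \<le> 1 / real (Suc n)" for x
        proof (rule pnorm_diff_trans[OF s[OF K]])
          have "pnorm (\<Sum>k<K. (s n k - c k) * v k x) \<le> 1 / real (Suc n)"
            by (rule sum_le) (use sc in auto)
          then show "pnorm ((\<Sum>k<K. s n k * v k x) - (\<Sum>k<K. c k * v k x)) \<le> 1 / real (Suc n)"
            by (simp add: left_diff_distrib sum_subtractf)
        qed
        then have "D c K \<le> 1 / real (Suc n)" by (rule D_le)
        moreover have "D c K \<ge> 0" using order_trans[OF pnorm_nonneg le_D] .
        ultimately show ?thesis using n by simp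
      qed
      then show "\<exists>n. \<forall>K\<ge>n. dist (D c K) 0 < e" by (auto simp: dist_real_def)
    qed
    ultimately show ?thesis using expansion_iff by blast
  qed
  have unique: "c = d" if "is_expansion fun_scale sup_norm v f c" "is_expansion fun_scale sup_norm v f d" for c d
  proof
    fix k
    have "pnorm (c k - d k) \<le> max (D c N) (D d N)" if "N \<ge> Suc k" for N
    proof (rule coeff_bound[where N = N and c = "\<lambda>k. c k - d k"])
      fix x
      have "pnorm ((f x - (\<Sum>k<N. d k * v k x)) - (f x - (\<Sum>k<N. c k * v k x))) \<le> max (D c N) (D d N)"
        using pnorm_diff_le[of "f x - (\<Sum>k<N. d k * v k x)" "f x - (\<Sum>k<N. c k * v k x)"]
          le_D[where x = x and N = N and c = c] le_D[where x = x and N = N and c = d] by linarith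
      then show "pnorm (\<Sum>k<N. (c k - d k) * v k x) \<le> max (D c N) (D d N)"
        by (simp add: left_diff_distrib sum_subtractf)
    qed (use that in simp)
    moreover have "(\<lambda>N. max (D c N) (D d N)) \<longlonglongrightarrow> max 0 0"
      using that expansion_iff by (intro tendsto_max) auto
    ultimately have "pnorm (c k - d k) \<le> max 0 0" by (intro LIMSEQ_le_const) auto
    then have "pnorm (c k - d k) = 0" using pnorm_nonneg[of "c k - d k"] by linarith
    then show "c k = d k" by simp
  qed
  show "\<exists>!c. is_expansion fun_scale sup_norm v f c" using ex unique by blast
  fix c
  show "is_expansion fun_scale sup_norm v f c \<longrightarrow>
      (\<forall>k. pnorm (c k) \<le> sup_norm f) \<and> (\<exists>k. pnorm (c k) = sup_norm f)"
  proof
    assume c: "is_expansion fun_scale sup_norm v f c"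
    have f_le: "pnorm (f x) \<le> sup_norm f" for x by (rule pnorm_le_sup_norm[OF M])
    have c_le: "pnorm (c k) \<le> sup_norm f" for k
    proof -
      have "pnorm (c k) \<le> max (sup_norm f) (D c N)" if "N \<ge> Suc k" for N
      proof (rule coeff_bound[where N = N and c = c])
        show "pnorm (\<Sum>k<N. c k * v k x) \<le> max (sup_norm f) (D c N)" for x
          using pnorm_diff_le[of "f x" "f x - (\<Sum>k<N. c k * v k x)"] f_le[of x] le_D[where x = x and N = N and c = c] by simp
      qed (use that in simp)
      moreover have "(\<lambda>N. max (sup_norm f) (D c N)) \<longlonglongrightarrow> max (sup_norm f) 0"
        using c expansion_iff by (intro tendsto_max tendsto_const) auto
      ultimately have "pnorm (c k) \<le> max (sup_norm f) 0" by (intro LIMSEQ_le_const) auto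
      moreover have "sup_norm f \<ge> 0" using order_trans[OF pnorm_nonneg f_le] .
      ultimately show ?thesis by simp
    qed
    have "\<exists>k. pnorm (c k) = sup_norm f"
    proof (rule ccontr)
      assume "\<not> ?thesis"
      then have less: "pnorm (c k) < sup_norm f" for k using c_le[of k] by (meson less_le)
      have pos: "sup_norm f > 0" using less[of 0] pnorm_nonneg[of "c 0"] by linarith
      have "\<forall>\<^sub>F N in sequentially. D c N < sup_norm f"
        using c pos expansion_iff order_tendstoD(2)[of "D c" 0 sequentially "sup_norm f"] by blast
      then obtain N where N: "D c N < sup_norm f" by (auto simp: eventually_sequentially)
      \<comment> \<open>Being a maximum of finitely many numbers below \<open>sup_norm f\<close>,
        \<open>B\<close> is below it too, yet it bounds both the partial sum and the remainder,
        hence \<open>f\<close>.\<close>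
      define B where "B = Max (insert (D c N) ((\<lambda>k. pnorm (c k)) ` {..<N}))"
      have B: "B < sup_norm f" unfolding B_def using N less by (subst Max_less_iff) auto
      have DB: "D c N \<le> B" unfolding B_def by (rule Max_ge) auto
      have cB: "pnorm (c k) \<le> B" if "k < N" for k unfolding B_def by (rule Max_ge) (use that in auto)
      have B0: "B \<ge> 0" using DB order_trans[OF pnorm_nonneg le_D] order_trans by blast
      have "pnorm (f x) \<le> B" for x
      proof (rule pnorm_le_of_diff)
        show "pnorm (f x - (\<Sum>k<N. c k * v k x)) \<le> B" using le_D DB order_trans by blast
        show "pnorm (\<Sum>k<N. c k * v k x) \<le> B" by (rule sum_le[OF B0 cB])
      qed
      then have "sup_norm f \<le> B" by (rule sup_norm_le)
      then show False using B by simp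
    qed
    then show "(\<forall>k. pnorm (c k) \<le> sup_norm f) \<and> (\<exists>k. pnorm (c k) = sup_norm f)"
      using c_le by blast
  qed
qed (rule v(1))

section \<open>Continuous functions on the units\<close>

lemma Rep_padic_unit_in_units: "Rep_padic_unit x \<in> (padic_units :: 'p::prime_card padic set)"
proof -
  obtain y where y: "pnorm (Rep_padic_unit x) \<le> 1" "pnorm y \<le> 1" "Rep_padic_unit x * y = 1"
    using Rep_padic_unit[of x] unfolding padic_int_def by blast
  have "pnorm (Rep_padic_unit x) * pnorm y = 1" using y(3) by (simp flip: pnorm_mult)
  then have "1 \<le> pnorm (Rep_padic_unit x)"
    using mult_left_mono[OF y(2) pnorm_nonneg[of "Rep_padic_unit x"]] by simp
  then show ?thesis using y(1) by (simp add: padic_units_def)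
qed

lemma Rep_Abs_padic_unit:
  assumes "x \<in> padic_units"
  shows "Rep_padic_unit (Abs_padic_unit x) = (x :: 'p::prime_card padic)"
proof (rule Abs_padic_unit_inverse)
  have "pnorm x = 1" using assms by (rule pnorm_padic_units)
  moreover from this have "x \<noteq> 0" by auto
  ultimately have "x \<in> padic_int" "inverse x \<in> padic_int" "x * inverse x = 1"
    by (auto simp: padic_int_def pnorm_inverse)
  then show "x \<in> {x. x \<in> padic_int \<and> (\<exists>y\<in>padic_int. x * y = 1)}" by blast
qed

lemma exists_small_radius:
  assumes "e > 0"
  shows "\<exists>h. 1 / real CARD('p::prime_card) ^ h < e"
proof -
  have "inverse (real CARD('p)) < 1" using prime_card_gt_1[where 'p='p] by (simp add: inverse_less_1_iff)
  then obtain h where "inverse (real CARD('p)) ^ h < e"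
    using real_arch_pow_inv[of e "inverse (real CARD('p))"] assms by blast
  then show ?thesis by (auto simp: divide_inverse power_inverse)
qed

text \<open>Complete, since the norm is locally constant away from \<open>0\<close> and so a limit
  of units is a unit; totally bounded, since the integers below \<open>p ^ h\<close> form a finite
  net of mesh \<open>1 / p ^ h\<close>.\<close>

lemma compact_padic_units: "compact (padic_units :: 'p::prime_card padic set)"
  unfolding compact_eq_totally_bounded
proof (intro conjI allI impI)
  show "complete (padic_units :: 'p padic set)"
    unfolding complete_def
  proof (intro allI impI, elim conjE)
    fix f :: "nat \<Rightarrow> 'p padic"
    assume f: "\<forall>n. f n \<in> padic_units" "Cauchy f"
    obtain l where l: "f \<longlonglongrightarrow> l" using f(2) by (metis Cauchy_convergent convergent_def)
    obtain n where "dist (f n) l < 1" using metric_LIMSEQ_D[OF l, of 1] by auto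
    then have "pnorm (f n - l) < pnorm (f n)" using f(1) by (simp add: dist_padic_def pnorm_padic_units)
    from pnorm_eq_of_diff_less[OF this] have "l \<in> padic_units" using f(1) by (simp add: padic_units_def)
    then show "\<exists>l\<in>padic_units. f \<longlonglongrightarrow> l" using l by blast
  qed
next
  fix e :: real assume "e > 0"
  then obtain h where h: "1 / real CARD('p) ^ h < e" using exists_small_radius by blast
  have "padic_units \<subseteq> (\<Union>x\<in>of_nat ` {..<CARD('p) ^ h}. ball (x :: 'p padic) e)"
  proof
    fix y :: "'p padic" assume "y \<in> padic_units"
    then have "pnorm y \<le> 1" by (simp add: padic_units_def)
    then obtain n where "n < CARD('p) ^ h" "pnorm (y - of_nat n) \<le> 1 / real CARD('p) ^ h"
      using approx_by_nat by blast
    then show "y \<in> (\<Union>x\<in>of_nat ` {..<CARD('p) ^ h}. ball x e)"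
      using h by (force simp: dist_padic_def pnorm_diff_commute[of y])
  qed
  then show "\<exists>k. finite k \<and> padic_units \<subseteq> (\<Union>x\<in>k. ball (x :: 'p padic) e)"
    by (intro exI[of _ "of_nat ` {..<CARD('p) ^ h}"]) auto
qed

lemma compact_padic_unit: "compact (UNIV :: 'p::prime_card padic_unit set)"
proof -
  have "continuous_on padic_units (Abs_padic_unit :: 'p padic \<Rightarrow> _)"
    unfolding continuous_on_iff by (auto simp: dist_padic_unit_def Rep_Abs_padic_unit)
  then have "compact ((Abs_padic_unit :: 'p padic \<Rightarrow> _) ` padic_units)"
    using compact_padic_units by (rule compact_continuous_image)
  also have "(Abs_padic_unit :: 'p padic \<Rightarrow> _) ` padic_units = UNIV"
    by (metis Rep_padic_unit_in_units Rep_padic_unit_inverse image_eqI UNIV_eq_I)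
  finally show ?thesis .
qed

text \<open>Compactness makes a continuous function nearly constant on the classes modulo a single
  \<open>p ^ h\<close>, which is the form of continuity that the approximation at a finite level
  takes as input.\<close>

lemma cont_fun_iff_uniform:
  fixes f :: "'p::prime_card padic_unit \<Rightarrow> 'p padic"
  shows "f \<in> cont_fun \<longleftrightarrow> (\<forall>e>0. \<exists>h. \<forall>x y.
    pnorm (Rep_padic_unit x - Rep_padic_unit y) \<le> 1 / real CARD('p) ^ h \<longrightarrow> pnorm (f x - f y) \<le> e)"
    (is "_ \<longleftrightarrow> ?U")
proof
  assume "f \<in> cont_fun"
  then have "uniformly_continuous_on UNIV f"
    using compact_padic_unit by (auto simp: cont_fun_def intro: compact_uniformly_continuous)
  show ?U
  proof (intro allI impI)
    fix e :: real assume "e > 0"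
    then obtain d where d: "d > 0" "\<And>x y. dist y x < d \<Longrightarrow> dist (f y) (f x) < e"
      using \<open>uniformly_continuous_on UNIV f\<close> unfolding uniformly_continuous_on_def by (metis UNIV_I)
    obtain h where h: "1 / real CARD('p) ^ h < d" using exists_small_radius[OF d(1)] by blast
    have "pnorm (f x - f y) \<le> e"
      if "pnorm (Rep_padic_unit x - Rep_padic_unit y) \<le> 1 / real CARD('p) ^ h" for x y
      using d(2)[of x y] that h by (simp add: dist_padic_unit_def dist_padic_def)
    then show "\<exists>h. \<forall>x y. pnorm (Rep_padic_unit x - Rep_padic_unit y) \<le> 1 / real CARD('p) ^ h
        \<longrightarrow> pnorm (f x - f y) \<le> e" by blast
  qed
next
  assume U: ?U
  have "\<exists>d>0. \<forall>x'. dist x' x < d \<longrightarrow> dist (f x') (f x) < e" if e: "e > 0" for e :: real and x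
  proof -
    obtain h where h: "\<And>x y. pnorm (Rep_padic_unit x - Rep_padic_unit y) \<le> 1 / real CARD('p) ^ h
        \<Longrightarrow> pnorm (f x - f y) \<le> e / 2" using U half_gt_zero[OF e] by blast
    have "dist (f x') (f x) < e" if "dist x' x < 1 / real CARD('p) ^ h" for x'
      using h[of x' x] that e by (simp add: dist_padic_unit_def dist_padic_def)
    moreover have "1 / real CARD('p) ^ h > 0" using prime_card_gt_1[where 'p='p] by simp
    ultimately show ?thesis by blast
  qed
  then show "f \<in> cont_fun" by (simp add: cont_fun_def continuous_on_iff)
qed

lemma cont_fun_diff:
  fixes f g :: "'p::prime_card padic_unit \<Rightarrow> 'p padic"
  assumes "f \<in> cont_fun" "g \<in> cont_fun"
  shows "(\<lambda>x. f x - g x) \<in> cont_fun"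
  unfolding cont_fun_def continuous_on_iff mem_Collect_eq
proof (intro ballI allI impI)
  fix x :: "'p padic_unit" and e :: real assume e: "e > 0"
  obtain d1 where d1: "d1 > 0" "\<And>y. dist y x < d1 \<Longrightarrow> dist (f y) (f x) < e"
    using assms(1) e unfolding cont_fun_def continuous_on_iff by blast
  obtain d2 where d2: "d2 > 0" "\<And>y. dist y x < d2 \<Longrightarrow> dist (g y) (g x) < e"
    using assms(2) e unfolding cont_fun_def continuous_on_iff by blast
  have "dist (f y - g y) (f x - g x) < e" if "dist y x < min d1 d2" for y
  proof -
    have "f y - g y - (f x - g x) = (f y - f x) - (g y - g x)" by simp
    moreover have "pnorm (f y - f x) < e" "pnorm (g y - g x) < e"
      using d1(2)[of y] d2(2)[of y] that unfolding dist_padic_def by simp_all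
    ultimately show ?thesis
      using pnorm_diff_le[of "f y - f x" "g y - g x"] unfolding dist_padic_def by (simp only: max_less_iff_conj le_less_trans)
  qed
  then show "\<exists>d>0. \<forall>y\<in>UNIV. dist y x < d \<longrightarrow> dist (f y - g y) (f x - g x) < e"
    using d1(1) d2(1) by (intro exI[of _ "min d1 d2"]) auto
qed

lemma cont_fun_scale:
  fixes f :: "'p::prime_card padic_unit \<Rightarrow> 'p padic"
  assumes "f \<in> cont_fun"
  shows "(\<lambda>x. c * f x) \<in> cont_fun"
  unfolding cont_fun_iff_uniform
proof (intro allI impI)
  fix e :: real assume "e > 0"
  \<comment> \<open>The summand \<open>1\<close> covers \<open>c = 0\<close>.\<close>
  then have e: "e / (pnorm c + 1) > 0" using pnorm_nonneg[of c] by (simp add: add_nonneg_pos)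
  then obtain h where h: "\<And>x y. pnorm (Rep_padic_unit x - Rep_padic_unit y) \<le> 1 / real CARD('p) ^ h
      \<Longrightarrow> pnorm (f x - f y) \<le> e / (pnorm c + 1)"
    using assms unfolding cont_fun_iff_uniform by blast
  have "pnorm (c * f x - c * f y) \<le> e"
    if "pnorm (Rep_padic_unit x - Rep_padic_unit y) \<le> 1 / real CARD('p) ^ h" for x y
  proof -
    have "pnorm (c * f x - c * f y) = pnorm c * pnorm (f x - f y)"
      by (simp flip: right_diff_distrib add: pnorm_mult)
    also have "\<dots> \<le> (pnorm c + 1) * (e / (pnorm c + 1))"
      using h[OF that] by (intro mult_mono) (auto simp: add_nonneg_nonneg)
    also have "\<dots> = e" using pnorm_nonneg[of c] by (simp add: add_nonneg_eq_0_iff)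
    finally show ?thesis .
  qed
  then show "\<exists>h. \<forall>x y. pnorm (Rep_padic_unit x - Rep_padic_unit y) \<le> 1 / real CARD('p) ^ h
      \<longrightarrow> pnorm (c * f x - c * f y) \<le> e" by blast
qed

lemma cont_fun_diff_sum:
  fixes f :: "'p::prime_card padic_unit \<Rightarrow> 'p padic"
    and N :: nat
  assumes "f \<in> cont_fun" "\<And>k. g k \<in> cont_fun"
  shows "(\<lambda>x. f x - (\<Sum>k<N. c k * g k x)) \<in> cont_fun"
proof (induction N)
  case (Suc N)
  then show ?case using cont_fun_diff[OF Suc cont_fun_scale[OF assms(2)[of N], of "c N"]]
    by (simp add: algebra_simps)
qed (use assms(1) in simp)

lemma cont_fun_bounded:
  fixes f :: "'p::prime_card padic_unit \<Rightarrow> 'p padic"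
  assumes "f \<in> cont_fun"
  shows "\<exists>M. \<forall>x. pnorm (f x) \<le> M"
proof -
  have "compact (range f)"
    using assms compact_padic_unit by (auto simp: cont_fun_def intro: compact_continuous_image)
  then have "bounded (range f)" by (rule compact_imp_bounded)
  then show ?thesis unfolding bounded_any_center[of _ 0] by (auto simp: dist_padic_def)
qed

section \<open>The functions \<open>E_fun n\<close> as a basis of the continuous functions\<close>

lemma E_fun_eq_E_val: "E_fun n x = E_val n (Rep_padic_unit x)"
  by (simp add: E_fun_def E_val_def rat_poly_val_def)

lemma pnorm_E_fun_le_1: "pnorm (E_fun n x) \<le> 1"
  by (simp add: E_fun_eq_E_val pnorm_E_val_le_1 Rep_padic_unit_in_units)

lemma E_fun_cont: "E_fun n \<in> (cont_fun :: ('p::prime_card padic_unit \<Rightarrow> 'p padic) set)"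
  unfolding cont_fun_iff_uniform
proof (intro allI impI)
  fix e :: real assume e: "e > 0"
  have p: "real CARD('p) > 1" using prime_card_gt_1[where 'p='p] by simp
  define h where "h = Suc (Suc n)"
  have n: "n < totient (CARD('p) ^ h)" unfolding h_def by (rule less_totient_Suc)
  define C where "C = real CARD('p) ^ h / real CARD('p)"
  have C: "C > 0" using p by (simp add: C_def)
  obtain s where s: "1 / real CARD('p) ^ s < e / C" using exists_small_radius[of "e / C"] e C by auto
  \<comment> \<open>The Lipschitz bound with constant \<open>C\<close> is available only inside a
    class modulo \<open>p ^ h\<close>, so the radius must respect \<open>h\<close> as well as the
    \<open>s\<close> that serves \<open>e / C\<close>.\<close>
  have "pnorm (E_fun n x - E_fun n y) \<le> e"
    if xy: "pnorm (Rep_padic_unit x - Rep_padic_unit y) \<le> 1 / real CARD('p) ^ max h s" for x y :: "'p padic_unit"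
  proof -
    have "1 / real CARD('p) ^ max h s \<le> 1 / real CARD('p) ^ h"
      "1 / real CARD('p) ^ max h s \<le> 1 / real CARD('p) ^ s"
      using p by (intro divide_left_mono power_increasing; simp)+
    then have 1: "pnorm (Rep_padic_unit x - Rep_padic_unit y) \<le> 1 / real CARD('p) ^ h"
      and 2: "pnorm (Rep_padic_unit x - Rep_padic_unit y) \<le> e / C" using xy s by linarith+
    have "pnorm (E_fun n x - E_fun n y) \<le> C * pnorm (Rep_padic_unit x - Rep_padic_unit y)"
      unfolding E_fun_eq_E_val C_def
      by (rule pnorm_E_val_diff[OF Rep_padic_unit_in_units Rep_padic_unit_in_units n 1])
    also have "\<dots> \<le> C * (e / C)" using 2 C by (intro mult_left_mono) auto
    also have "\<dots> = e" using C by simp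
    finally show ?thesis .
  qed
  then show "\<exists>h. \<forall>x y. pnorm (Rep_padic_unit x - Rep_padic_unit y :: 'p padic) \<le> 1 / real CARD('p) ^ h
      \<longrightarrow> pnorm (E_fun n x - E_fun n y :: 'p padic) \<le> e" by blast
qed

lemma E_fun_coeff_bound:
  fixes c :: "nat \<Rightarrow> 'p::prime_card padic"
  assumes "\<And>x. pnorm (\<Sum>k<N. c k * E_fun k x) \<le> r" "k < N"
  shows "pnorm (c k) \<le> r"
proof (rule E_val_coeff_bound[OF _ assms(2)])
  show "pnorm (\<Sum>k<N. c k * E_val k x) \<le> r" if "x \<in> padic_units" for x
    using assms(1)[of "Abs_padic_unit x"] that by (simp add: E_fun_eq_E_val Rep_Abs_padic_unit)
qed

lemma E_fun_approx_step:
  fixes f :: "'p::prime_card padic_unit \<Rightarrow> 'p padic"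
  assumes f: "f \<in> cont_fun" and M: "M > 0" "\<And>x. pnorm (f x) \<le> M"
  shows "\<exists>N c. \<forall>x. pnorm (f x - (\<Sum>k<N. c k * E_fun k x)) \<le> M / real CARD('p)"
proof -
  have p: "real CARD('p) > 1" using prime_card_gt_1[where 'p='p] by simp
  then obtain h where h: "\<And>x y. pnorm (Rep_padic_unit x - Rep_padic_unit y) \<le> 1 / real CARD('p) ^ h
      \<Longrightarrow> pnorm (f x - f y) \<le> M / real CARD('p)"
    using f M(1) unfolding cont_fun_iff_uniform by (meson divide_pos_pos less_trans zero_less_one)
  obtain c where c: "\<And>x. x \<in> padic_units \<Longrightarrow>
      pnorm (f (Abs_padic_unit x) - (\<Sum>k<totient (CARD('p) ^ h). c k * E_val k x)) \<le> M / real CARD('p)"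
    using E_val_approx_level[of "\<lambda>x. f (Abs_padic_unit x)" M h] M(2) h Rep_Abs_padic_unit by metis
  show ?thesis
    using c[OF Rep_padic_unit_in_units] unfolding Rep_padic_unit_inverse E_fun_eq_E_val by blast
qed

text \<open>Each approximation step divides the bound on the remainder by \<open>p\<close>. The
  remainder is again continuous, so the step can be repeated, at a level that depends on the
  remainder.\<close>

lemma E_fun_dense:
  fixes f :: "'p::prime_card padic_unit \<Rightarrow> 'p padic"
  assumes f: "f \<in> cont_fun" and e: "e > 0"
  shows "\<exists>N c. \<forall>x. pnorm (f x - (\<Sum>k<N. c k * E_fun k x)) \<le> e"
proof -
  have p: "real CARD('p) > 1" using prime_card_gt_1[where 'p='p] by simp
  obtain M0 where "\<And>x. pnorm (f x) \<le> M0" using cont_fun_bounded[OF f] by blast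
  \<comment> \<open>The step works relative to a positive bound, which \<open>max 1\<close>
    guarantees also for \<open>f = 0\<close>.\<close>
  moreover define M where "M = max 1 M0"
  ultimately have M: "M > 0" "\<And>x. pnorm (f x) \<le> M" by (auto simp: le_max_iff_disj)
  have "\<exists>N c. \<forall>x. pnorm (f x - (\<Sum>k<N. c k * E_fun k x)) \<le> M / real CARD('p) ^ n" for n
  proof (induction n)
    case 0
    then show ?case using M(2) by (intro exI[of _ 0]) simp
  next
    case (Suc n)
    then obtain N c where c: "\<And>x. pnorm (f x - (\<Sum>k<N. c k * E_fun k x)) \<le> M / real CARD('p) ^ n"
      by blast
    have "\<exists>N' c'. \<forall>x. pnorm (f x - (\<Sum>k<N. c k * E_fun k x) - (\<Sum>k<N'. c' k * E_fun k x))
        \<le> M / real CARD('p) ^ n / real CARD('p)"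
      using M(1) p c by (intro E_fun_approx_step cont_fun_diff_sum f E_fun_cont) auto
    then obtain N' c' where c': "\<And>x. pnorm (f x - (\<Sum>k<N. c k * E_fun k x) - (\<Sum>k<N'. c' k * E_fun k x))
        \<le> M / real CARD('p) ^ n / real CARD('p)" by blast
    define d where "d k = (if k < N then c k else 0) + (if k < N' then c' k else 0)" for k
    have "(\<Sum>k<max N N'. d k * E_fun k x) = (\<Sum>k<N. c k * E_fun k x) + (\<Sum>k<N'. c' k * E_fun k x)" for x
      by (simp only: d_def distrib_right sum.distrib sum_lessThan_pad max.cobounded1 max.cobounded2)
    then have "pnorm (f x - (\<Sum>k<max N N'. d k * E_fun k x)) \<le> M / real CARD('p) ^ Suc n" for x
      using c'[of x] by (simp add: diff_diff_eq mult.commute)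
    then show ?case by blast
  qed
  moreover obtain n where n: "1 / real CARD('p) ^ n < e / M"
    using exists_small_radius[of "e / M"] e M(1) by auto
  moreover have "M / real CARD('p) ^ n \<le> e"
    using n M(1) mult_strict_left_mono[OF n M(1)] by simp
  ultimately show ?thesis using order_trans by meson
qed

lemma E_fun_orthonormal_basis:
  "orthonormal_basis (cont_fun :: ('p::prime_card padic_unit \<Rightarrow> 'p padic) set) fun_scale sup_norm E_fun"
  by (rule orthonormal_basis_criterion)
    (auto intro: E_fun_cont pnorm_E_fun_le_1 cont_fun_bounded E_fun_coeff_bound E_fun_dense)

section \<open>Even functions\<close>

text \<open>Here the centered range enters: it is symmetric except that, for even \<open>m\<close>,
  it contains \<open>- m / 2\<close> without \<open>m / 2\<close>. That exceptional residue is not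
  coprime to \<open>m\<close> when \<open>m > 2\<close>, so on totatives the lift is odd.\<close>

lemma centered_lift_minus:
  assumes m: "m > 2" and a: "a \<in> totatives m"
  shows "centered_lift m (m - a) = - centered_lift m a"
proof -
  have a': "a > 0" "a \<le> m" "coprime a m" using a by (auto simp: in_totatives_iff)
  have "a \<noteq> m" using a' m by auto
  have "m \<noteq> 2 * a"
  proof
    assume "m = 2 * a"
    then have "a dvd m" by simp
    then have "is_unit a" using a'(3) by (metis coprime_absorb_left)
    then show False using \<open>m = 2 * a\<close> m by simp
  qed
  have val: "centered_lift m b = (if b + m div 2 < m then int b else int b - int m)" if "b < m" for b
  proof -
    have "int m div 2 = int (m div 2)" by simp
    moreover have "(int b + int (m div 2)) mod int m = (if b + m div 2 < m then int b + int (m div 2)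
        else int b + int (m div 2) - int m)"
    proof (cases "b + m div 2 < m")
      case False
      have "(int b + int (m div 2)) mod int m = (int b + int (m div 2) - int m) mod int m" by simp
      also have "\<dots> = int b + int (m div 2) - int m"
        using False that m by (intro mod_pos_pos_trivial) linarith+
      finally show ?thesis using False by simp
    qed (simp flip: of_nat_add)
    ultimately show ?thesis using m by (simp add: centered_lift_eq)
  qed
  have "m - a < m" "a < m" using a' \<open>a \<noteq> m\<close> m by auto
  moreover have "m - a + m div 2 < m \<longleftrightarrow> \<not> a + m div 2 < m"
  proof -
    define d where "d = m div 2"
    have "2 * d \<le> m" "m \<le> 2 * d + 1" by (simp_all add: d_def)
    then show ?thesis unfolding d_def[symmetric] using \<open>m \<noteq> 2 * a\<close> \<open>a < m\<close> by arith
  qed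
  ultimately show ?thesis by (simp add: val of_nat_diff)
qed

text \<open>Replacing \<open>x\<close> by \<open>- x\<close> and pairing \<open>a\<close> with
  \<open>p ^ j - a\<close> changes the sign of every factor, and the number
  \<open>totient (p ^ j)\<close> of factors is even for \<open>p ^ j > 2\<close>.\<close>

lemma e_val_minus:
  fixes x :: "'p::prime_card padic"
  assumes m: "CARD('p) ^ j > 2"
  shows "e_val j (- x) = e_val j x"
proof -
  let ?m = "CARD('p) ^ j"
  have j: "j \<ge> 1" using m by (cases j) auto
  have reflect: "?m - a \<in> totatives ?m" if "a \<in> totatives ?m" for a
  proof -
    have a: "a > 0" "a \<le> ?m" "coprime a ?m" using that by (auto simp: in_totatives_iff)
    have "a \<noteq> ?m" using a m by auto
    moreover have "coprime (?m - a) ?m"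
      using a gcd_diff2_nat[of a ?m] by (simp only: coprime_iff_gcd_eq_1)
    ultimately show ?thesis using a by (auto simp: in_totatives_iff)
  qed
  have "(\<Prod>a\<in>totatives ?m. - x - of_int (centered_lift ?m a))
      = (\<Prod>a\<in>totatives ?m. - (x - of_int (centered_lift ?m a)))"
  proof (rule prod.reindex_bij_witness[of _ "\<lambda>a. ?m - a" "\<lambda>a. ?m - a"])
    fix a assume a: "a \<in> totatives ?m"
    show "?m - (?m - a) = a" "?m - (?m - a) = a" using a by (simp_all add: in_totatives_iff)
    show "?m - a \<in> totatives ?m" "?m - a \<in> totatives ?m" by (rule reflect[OF a])+
    show "- (x - of_int (centered_lift ?m (?m - a))) = - x - of_int (centered_lift ?m a)"
      by (simp add: centered_lift_minus[OF m a])
  qed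
  also have "\<dots> = (- 1) ^ totient ?m * (\<Prod>a\<in>totatives ?m. x - of_int (centered_lift ?m a))"
    by (subst prod_uminus) (simp add: totient_def)
  also have "even (totient ?m)" using m by (rule totient_even)
  then have "(- 1) ^ totient ?m * (\<Prod>a\<in>totatives ?m. x - of_int (centered_lift ?m a))
      = (\<Prod>a\<in>totatives ?m. x - of_int (centered_lift ?m a))" by simp
  finally show ?thesis by (simp only: e_val_pos[OF j])
qed

section \<open>Digits of even and odd indices, and parity of \<open>E_n\<close>\<close>

text \<open>As \<open>totient (p ^ j) = (p - 1) * p ^ (j - 1)\<close> for \<open>j \<ge> 1\<close>,
  the digits above position \<open>0\<close> are the base \<open>p\<close> digits of the quotient by
  \<open>p - 1\<close>. The closed form makes parity accessible.\<close>

definition totient_digit :: "nat \<Rightarrow> nat \<Rightarrow> nat \<Rightarrow> nat" where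
  "totient_digit p n j = (if j = 0 then n mod (p - 1) else n div (p - 1) div p ^ (j - 1) mod p)"

lemma totient_digits_totient_digit: "prime p \<Longrightarrow> totient_digits p n (totient_digit p n)"
  by (simp add: totient_digits_iff totient_digit_def fun_eq_iff)

lemma totient_digit_eq_0:
  assumes "prime p" "j \<ge> Suc (Suc n)"
  shows "totient_digit p n j = 0"
proof -
  have "n < totient (p ^ Suc (Suc n))"
    using le_totient_power[OF assms(1), of "Suc n"] by (simp del: power_Suc)
  then obtain d where d: "totient_digits p n d" "\<And>j. j \<ge> Suc (Suc n) \<Longrightarrow> d j = 0"
    using ex_totient_digits_bounded[OF assms(1)] by blast
  have "d = totient_digit p n"
    using d(1) totient_digits_totient_digit[OF assms(1), of n] by (simp only: totient_digits_iff[OF assms(1)])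
  then show ?thesis using d(2) assms(2) by blast
qed

lemma E_val_eq_prod:
  fixes x :: "'p::prime_card padic"
  assumes "J \<ge> Suc (Suc n)"
  shows "E_val n x = (\<Prod>j<J. e_val j x ^ totient_digit CARD('p) n j)"
proof -
  have "E_poly CARD('p) n = (\<Prod>j<J. e_poly CARD('p) j ^ totient_digit CARD('p) n j)"
    using assms totient_digit_eq_0[OF prime_card[where 'a='p], of n]
    by (intro E_poly_eq_prod prime_card totient_digits_totient_digit) auto
  then show ?thesis by (simp add: E_val_def e_val_def rat_poly_val_prod rat_poly_val_power)
qed

text \<open>The index \<open>j\<close> of the unique \<open>e\<^sub>j\<close> that is not an even function.\<close>

definition odd_index :: "nat \<Rightarrow> nat" where
  "odd_index p = (if p = 2 then 1 else 0)"

text \<open>For odd \<open>p\<close> the modulus \<open>p - 1\<close> is even, so digit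
  \<open>0\<close> has the parity of the index and passing from \<open>2 * n\<close> to
  \<open>2 * n + 1\<close> changes it alone. For \<open>p = 2\<close> the modulus is
  \<open>1\<close>, digit \<open>0\<close> always vanishes, and digit \<open>1\<close> is the last
  binary digit.\<close>

lemma totient_digit_double:
  assumes p: "prime p"
  shows "even (totient_digit p (2 * n) (odd_index p))"
    and "totient_digit p (2 * n + 1) j = totient_digit p (2 * n) j + (if j = odd_index p then 1 else 0)"
    and "p = 2 \<Longrightarrow> totient_digit p m 0 = 0" "p = 2 \<Longrightarrow> totient_digit p (2 * n) 1 = 0"
proof -
  have odd: "odd p" if "p \<noteq> 2" using that p prime_ge_2_nat[OF p] prime_odd_nat by fastforce
  show "even (totient_digit p (2 * n) (odd_index p))"
    using odd by (cases "p = 2") (auto simp: totient_digit_def odd_index_def dvd_mod_iff)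
  show "p = 2 \<Longrightarrow> totient_digit p m 0 = 0" "p = 2 \<Longrightarrow> totient_digit p (2 * n) 1 = 0"
    by (simp_all add: totient_digit_def)
  show "totient_digit p (2 * n + 1) j = totient_digit p (2 * n) j + (if j = odd_index p then 1 else 0)"
  proof (cases "p = 2")
    case True
    show ?thesis
    proof (cases "j \<le> 1")
      case True
      then show ?thesis using \<open>p = 2\<close> by (cases "j = 0") (auto simp: totient_digit_def odd_index_def)
    next
      case False
      then obtain i where "j = Suc (Suc i)" by (metis One_nat_def Suc_diff_Suc diff_zero not_le less_imp_Suc_add plus_1_eq_Suc)
      then show ?thesis using True by (simp add: totient_digit_def odd_index_def div_mult2_eq)
    qed
  next
    case False
    then have "even (p - 1)" using odd by simp
    then obtain t where t: "p - 1 = 2 * t" by (rule evenE)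
    have "(2 * n + 1) mod (2 * t) = 2 * n mod (2 * t) + 1"
      using mod_mult2_eq[of "2 * n + 1" 2 t] mod_mult2_eq[of "2 * n" 2 t] by simp
    moreover have "(2 * n + 1) div (2 * t) = 2 * n div (2 * t)"
      by (simp only: div_mult2_eq) simp
    ultimately show ?thesis using False t by (simp add: totient_digit_def odd_index_def)
  qed
qed

text \<open>Factors \<open>e_j\<close> with \<open>p ^ j > 2\<close> are even functions. What
  remains is harmless: for odd \<open>p\<close> only \<open>e_0 = X\<close>, whose exponent is even,
  and for \<open>p = 2\<close> the factors \<open>e_0\<close> and \<open>e_1\<close>, whose
  exponents are \<open>0\<close>.\<close>

lemma E_val_even_minus: "E_val (2 * n) (- x) = E_val (2 * n) (x :: 'p::prime_card padic)"
proof -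
  note dig = totient_digit_double[OF prime_card[where 'a='p]]
  have "e_val j (- x) ^ totient_digit CARD('p) (2 * n) j = e_val j x ^ totient_digit CARD('p) (2 * n) j" for j
  proof (cases "CARD('p) ^ j > 2")
    case True
    then show ?thesis by (simp add: e_val_minus)
  next
    case False
    show ?thesis
    proof (cases "CARD('p) = 2")
      case True
      then have "j \<le> 1" using False power_increasing[of 2 j "2 :: nat"] by (cases "j \<le> 1") auto
      then have "j = 0 \<or> j = 1" by auto
      then have "totient_digit CARD('p) (2 * n) j = 0" using True dig(3)[of "2 * n"] dig(4)[of n] by auto
      then show ?thesis by simp
    next
      case neq: False
      then have "CARD('p) > 2" using prime_card_gt_1[where 'p='p] by simp
      then have "j = 0" using False self_le_power[of "CARD('p)" j] by (cases "j = 0") auto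
      then show ?thesis using dig(1)[of n] neq by (simp add: e_val_0 odd_index_def)
    qed
  qed
  then show ?thesis by (simp only: E_val_eq_prod[OF order_refl])
qed

lemma E_val_odd: "E_val (2 * n + 1) x = e_val (odd_index CARD('p)) x * E_val (2 * n) (x :: 'p::prime_card padic)"
proof -
  let ?J = "Suc (Suc (2 * n + 1))" and ?i = "odd_index CARD('p)"
  have i: "?i < ?J" by (simp add: odd_index_def)
  have "E_val (2 * n + 1) x = (\<Prod>j<?J. e_val j x ^ (totient_digit CARD('p) (2 * n) j + (if j = ?i then 1 else 0)))"
    by (simp only: E_val_eq_prod[OF order_refl] totient_digit_double(2)[OF prime_card[where 'a='p]])
  also have "\<dots> = (\<Prod>j<?J. e_val j x ^ totient_digit CARD('p) (2 * n) j) * (\<Prod>j<?J. if j = ?i then e_val j x else 1)"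
    unfolding prod.distrib[symmetric] by (intro prod.cong) (auto simp: power_add)
  also have "(\<Prod>j<?J. if j = ?i then e_val j x else 1) = e_val ?i x"
    using i by (simp only: prod.delta finite_lessThan lessThan_iff if_True)
  also have "(\<Prod>j<?J. e_val j x ^ totient_digit CARD('p) (2 * n) j) = E_val (2 * n) x"
    by (rule E_val_eq_prod[symmetric]) simp
  finally show ?thesis by (simp only: mult.commute)
qed

text \<open>The points \<open>x\<close> and \<open>- x\<close> are at distance
  \<open>pnorm 2\<close>, which is \<open>1\<close> for odd \<open>p\<close> and
  \<open>1 / 2\<close> for \<open>p = 2\<close>. In both cases this is \<open>1 / p ^ h\<close> with
  \<open>h = odd_index p\<close>, and \<open>e_h\<close> stretches it to \<open>1\<close>.\<close>

lemma pnorm_e_val_odd_index_diff: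
  fixes x :: "'p::prime_card padic"
  assumes x: "x \<in> padic_units"
  shows "pnorm (e_val (odd_index CARD('p)) x - e_val (odd_index CARD('p)) (- x)) = 1"
proof -
  have p: "real CARD('p) > 1" using prime_card_gt_1[where 'p='p] by simp
  have two: "pnorm (2 :: 'p padic) = 1 / real CARD('p) ^ odd_index CARD('p)"
  proof (cases "CARD('p) = 2")
    case True
    then show ?thesis using pnorm_card[where 'p='p] by (simp add: odd_index_def)
  next
    case False
    then have "CARD('p) > 2" using prime_card_gt_1[where 'p='p] by simp
    then have "\<not> int CARD('p) dvd 2" using zdvd_not_zless[of 2 "int CARD('p)"] by simp
    then show ?thesis using False pnorm_of_int_eq_1_iff[of 2, where 'p='p] by (simp add: odd_index_def)
  qed
  have "x - - x = 2 * x" by simp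
  then have "pnorm (x - - x) = 1 / real CARD('p) ^ odd_index CARD('p)"
    using pnorm_padic_units[OF x] two by (simp only: pnorm_mult)
  then show ?thesis using pnorm_e_val_diff[OF x, of "- x" "odd_index CARD('p)"] p by simp
qed

section \<open>The basis of the even functions\<close>

lemma sum_lessThan_double:
  "(\<Sum>k<2 * N. g k) = (\<Sum>k<N. g (2 * k) + g (2 * k + 1))" for g :: "nat \<Rightarrow> 'a::comm_monoid_add"
  by (induction N) (simp_all add: add.assoc)

lemma E_fun_even: "E_fun (2 * n) (- x) = E_fun (2 * n) x"
  by (simp add: E_fun_eq_E_val E_val_even_minus)

lemma E_fun_even_dense:
  fixes f :: "'p::prime_card padic_unit \<Rightarrow> 'p padic"
  assumes f: "f \<in> cont_fun_even" and e: "e > 0"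
  shows "\<exists>N c. \<forall>x. pnorm (f x - (\<Sum>k<N. c k * E_fun (2 * k) x)) \<le> e"
proof -
  have f': "f \<in> cont_fun" "\<And>x. f (- x) = f x" using f by (auto simp: cont_fun_even_def)
  obtain N c0 where c0: "\<And>x. pnorm (f x - (\<Sum>k<N. c0 k * E_fun k x)) \<le> e"
    using E_fun_dense[OF f'(1) e] by blast
  define c where "c k = (if k < N then c0 k else 0)" for k
  define A where "A x = (\<Sum>k<N. c (2 * k) * E_fun (2 * k) x)" for x
  define B where "B x = (\<Sum>k<N. c (2 * k + 1) * E_fun (2 * k) x)" for x
  define w where "w x = e_val (odd_index CARD('p)) (Rep_padic_unit x)" for x :: "'p padic_unit"
  have approx: "pnorm (f x - (A x + w x * B x)) \<le> e" for x
  proof -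
    have "(\<Sum>k<N. c0 k * E_fun k x) = (\<Sum>k<2 * N. c k * E_fun k x)"
      unfolding c_def by (rule sum_lessThan_pad[symmetric]) simp
    also have "\<dots> = (\<Sum>k<N. c (2 * k) * E_fun (2 * k) x + w x * (c (2 * k + 1) * E_fun (2 * k) x))"
      unfolding sum_lessThan_double E_fun_eq_E_val E_val_odd w_def by (simp only: mult.left_commute)
    also have "\<dots> = A x + w x * B x" by (simp add: A_def B_def sum.distrib sum_distrib_left)
    finally show ?thesis using c0[of x] by simp
  qed
  have "pnorm (f x - A x) \<le> e" for x
  proof -
    have minus: "A (- x) = A x" "B (- x) = B x" by (simp_all add: A_def B_def E_fun_even)
    have "(w x - w (- x)) * B x = (f (- x) - (A (- x) + w (- x) * B (- x))) - (f x - (A x + w x * B x))"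
      by (simp add: minus f'(2) algebra_simps)
    then have "pnorm ((w x - w (- x)) * B x) \<le> max (pnorm (f (- x) - (A (- x) + w (- x) * B (- x))))
        (pnorm (f x - (A x + w x * B x)))"
      by (simp only: pnorm_diff_le)
    also have "\<dots> \<le> e" by (intro max.boundedI approx)
    finally have "pnorm ((w x - w (- x)) * B x) \<le> e" .
    moreover have "pnorm (w x - w (- x)) = 1"
      unfolding w_def Rep_padic_unit_uminus
      by (rule pnorm_e_val_odd_index_diff[OF Rep_padic_unit_in_units])
    ultimately have B: "pnorm (B x) \<le> e" by (simp add: pnorm_mult)
    have "pnorm (w x) \<le> 1" unfolding w_def by (rule pnorm_e_val_le_1[OF Rep_padic_unit_in_units])
    then have "pnorm (w x * B x) \<le> 1 * e" unfolding pnorm_mult using B by (intro mult_mono) auto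
    then have "pnorm (w x * B x) \<le> e" by simp
    moreover have "f x - A x - (w x * B x) = f x - (A x + w x * B x)" by simp
    ultimately show ?thesis using approx[of x] pnorm_le_of_diff[of "f x - A x" "w x * B x" e] by (simp only:)
  qed
  then show ?thesis unfolding A_def by (intro exI[of _ N] exI[of _ "\<lambda>k. c (2 * k)"]) simp
qed

lemma E_fun_even_coeff_bound:
  fixes c :: "nat \<Rightarrow> 'p::prime_card padic"
  assumes sum: "\<And>x. pnorm (\<Sum>k<N. c k * E_fun (2 * k) x) \<le> r" and k: "k < N"
  shows "pnorm (c k) \<le> r"
proof -
  \<comment> \<open>Zeros at the odd indices turn the sum into one over the full family, whose
    coefficient bound applies.\<close>
  define d where "d j = (if even j then c (j div 2) else 0)" for j
  have "(\<Sum>j<2 * N. d j * E_fun j x) = (\<Sum>k<N. c k * E_fun (2 * k) x)" for x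
    unfolding sum_lessThan_double by (simp add: d_def)
  then have "pnorm (\<Sum>j<2 * N. d j * E_fun j x) \<le> r" for x using sum[of x] by simp
  then have "pnorm (d (2 * k)) \<le> r" by (rule E_fun_coeff_bound) (use k in simp)
  then show ?thesis by (simp add: d_def)
qed

lemma E_fun_even_orthonormal_basis:
  "orthonormal_basis (cont_fun_even :: ('p::prime_card padic_unit \<Rightarrow> 'p padic) set)
    fun_scale sup_norm (\<lambda>n. E_fun (2 * n))"
proof (rule orthonormal_basis_criterion)
  show "E_fun (2 * k) \<in> (cont_fun_even :: ('p padic_unit \<Rightarrow> 'p padic) set)" for k
    by (simp add: cont_fun_even_def E_fun_cont E_fun_even)
  show "\<exists>M. \<forall>x. pnorm (f x) \<le> M" if "f \<in> cont_fun_even" for f :: "'p padic_unit \<Rightarrow> 'p padic"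
    using that cont_fun_bounded by (auto simp: cont_fun_even_def)
qed (rule pnorm_E_fun_le_1 E_fun_even_coeff_bound E_fun_even_dense; assumption)+

section \<open>The quotient by signs\<close>

text \<open>By the definition of the quotient topology, \<open>g\<close> is continuous exactly when
  its composite with the projection is; even functions are those that factor through the projection;
  and surjectivity of the projection preserves suprema.\<close>

lemma isometric_iso_padic_unit_pm:
  "isometric_iso
     (cont_fun :: ('p::prime_card padic_unit_pm \<Rightarrow> 'p padic) set)
     (cont_fun_even :: ('p padic_unit \<Rightarrow> 'p padic) set)
     (\<lambda>g. g \<circ> padic_unit_pm_class)"
  unfolding isometric_iso_def
proof (intro conjI ballI allI)
  let ?\<pi> = "padic_unit_pm_class :: 'p padic_unit \<Rightarrow> 'p padic_unit_pm"
  have class_eq: "?\<pi> x = ?\<pi> y \<longleftrightarrow> x = y \<or> x = - y" for x y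
    by (rule padic_unit_pm.abs_eq_iff)
  have rep: "?\<pi> (rep_padic_unit_pm y) = y" for y
    by (rule Quotient_abs_rep[OF Quotient_padic_unit_pm])
  have surj: "range ?\<pi> = UNIV" by (metis rep surjI)
  have minus_minus: "- (- x) = x" for x :: "'p padic_unit"
    by (simp flip: Rep_padic_unit_inject)
  have open_iff: "open (?\<pi> -` U) \<longleftrightarrow> open U" for U by (simp add: open_padic_unit_pm_def)
  have into: "g \<circ> ?\<pi> \<in> cont_fun_even" if "g \<in> cont_fun" for g :: "'p padic_unit_pm \<Rightarrow> 'p padic"
  proof -
    have "open (g -` U)" if "open U" for U
      using \<open>g \<in> cont_fun\<close> that by (auto simp: cont_fun_def continuous_on_open_vimage)
    moreover have "(g \<circ> ?\<pi>) -` U = ?\<pi> -` (g -` U)" for U by auto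
    ultimately have "continuous_on UNIV (g \<circ> ?\<pi>)"
      by (simp only: continuous_on_open_vimage[OF open_UNIV] open_iff Int_UNIV_right) blast
    moreover have "?\<pi> (- x) = ?\<pi> x" for x using class_eq by blast
    ultimately show ?thesis by (simp add: cont_fun_even_def cont_fun_def)
  qed
  have onto: "\<exists>g\<in>cont_fun. f = g \<circ> ?\<pi>" if f: "f \<in> cont_fun_even" for f :: "'p padic_unit \<Rightarrow> 'p padic"
  proof -
    \<comment> \<open>The chosen representatives need not depend continuously on the class; evenness
      of \<open>f\<close> makes \<open>g\<close> independent of the choice, and continuity comes
      from the quotient topology.\<close>
    define g where "g = f \<circ> rep_padic_unit_pm"
    have g: "g \<circ> ?\<pi> = f"
    proof
      fix x
      have "rep_padic_unit_pm (?\<pi> x) = x \<or> rep_padic_unit_pm (?\<pi> x) = - x"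
        using class_eq rep by blast
      then show "(g \<circ> ?\<pi>) x = f x" using f by (auto simp: g_def cont_fun_even_def)
    qed
    have "open (g -` U)" if "open U" for U
    proof -
      have "open ((g \<circ> ?\<pi>) -` U)"
        using f that unfolding g by (auto simp: cont_fun_even_def cont_fun_def continuous_on_open_vimage)
      moreover have "(g \<circ> ?\<pi>) -` U = ?\<pi> -` (g -` U)" by auto
      ultimately show ?thesis by (simp only: open_iff)
    qed
    then have "g \<in> cont_fun" by (simp add: cont_fun_def continuous_on_open_vimage)
    then show ?thesis using g by blast
  qed
  show "bij_betw (\<lambda>g. g \<circ> ?\<pi>) (cont_fun :: ('p padic_unit_pm \<Rightarrow> 'p padic) set) cont_fun_even"
    unfolding bij_betw_def
  proof
    show "inj_on (\<lambda>g. g \<circ> ?\<pi>) (cont_fun :: ('p padic_unit_pm \<Rightarrow> 'p padic) set)"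
    proof (rule inj_onI)
      fix g g' :: "'p padic_unit_pm \<Rightarrow> 'p padic"
      assume eq: "g \<circ> ?\<pi> = g' \<circ> ?\<pi>"
      show "g = g'"
      proof
        show "g y = g' y" for y using fun_cong[OF eq, of "rep_padic_unit_pm y"] by (simp add: rep)
      qed
    qed
    show "(\<lambda>g. g \<circ> ?\<pi>) ` (cont_fun :: ('p padic_unit_pm \<Rightarrow> 'p padic) set) = cont_fun_even"
      using into onto by blast
  qed
  show "(f + g) \<circ> ?\<pi> = (f \<circ> ?\<pi>) + (g \<circ> ?\<pi>)" for f g :: "'p padic_unit_pm \<Rightarrow> 'p padic"
    by (simp add: fun_eq_iff)
  show "fun_scale c f \<circ> ?\<pi> = fun_scale c (f \<circ> ?\<pi>)" for c and f :: "'p padic_unit_pm \<Rightarrow> 'p padic"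
    by (simp add: fun_eq_iff fun_scale_def)
  show "sup_norm (f \<circ> ?\<pi>) = sup_norm f" for f :: "'p padic_unit_pm \<Rightarrow> 'p padic"
  proof -
    have "range (\<lambda>x. pnorm ((f \<circ> ?\<pi>) x)) = (\<lambda>y. pnorm (f y)) ` range ?\<pi>" by (simp add: image_image)
    then show ?thesis by (simp add: sup_norm_def surj)
  qed
qed

theorem proposition2p3p5:
  shows "orthonormal_basis (cont_fun_even :: ('p::prime_card padic_unit \<Rightarrow> 'p padic) set)
           fun_scale sup_norm (\<lambda>n. E_fun (2 * n))
       \<and> isometric_iso
           (cont_fun :: ('p padic_unit_pm \<Rightarrow> 'p padic) set)
           (cont_fun_even :: ('p padic_unit \<Rightarrow> 'p padic) set)
           (\<lambda>g. g \<circ> padic_unit_pm_class)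
       \<and> orthonormal_basis (cont_fun :: ('p padic_unit \<Rightarrow> 'p padic) set)
           fun_scale sup_norm (\<lambda>n. E_fun n)"
  using E_fun_even_orthonormal_basis isometric_iso_padic_unit_pm E_fun_orthonormal_basis by blast

end
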